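(* Let $K$ be an algebraically closed field and let $v:K\to\mathbb T$ be a non-trivial valuation. Let $f:B_1\to B_2$ be a homomorphism of finitely generated bands. Consider the maps given by precomposition with $f$: \[ f_K:\operatorname{Hom}(B_2,K)\to\operatorname{Hom}(B_1,K),\qquad f_{\mathbb T}:\operatorname{Hom}(B_2,\mathbb T)\to\operatorname{Hom}(B_1,\mathbb T). \] Then for every $x\in\operatorname{Hom}(B_1,K)$ with image $x'=v\circ x\in\operatorname{Hom}(B_1,\mathbb T)$, we have \[ \dim f_K^{-1}(x)\;\le\;\dim f_{\mathbb T}^{-1}(x'). \] In particular, let $N$ be an embedded minor of a matroid $M$. Suppose the natural restriction map $\mathcal X_M(\mathbb T)\to\mathcal X_N(\mathbb T)$ has finite fibers, i.e. every rescaling class of valuated matroid structures on $N$ has at most finitely many extensions to $M$ up to rescaling equivalence. Then for every field $k$ the natural map $\mathcal X_M(k)\to\mathcal X_N(k)$ has finite fibers, i.e. every $k$-representation of $N$ has at most finitely many extensions to a $k$-representation of $M$, up to projective equivalence.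
   Context: A pointed monoid is a commutative multiplicative monoid $A$ with identity $1$ and an element $0$ such that $0\cdot a=0$ for all $a$. Its ambient semiring $A^+$ consists of the finite formal sums of nonzero elements of $A$. An ideal of $A^+$ is a subset containing $0$ that is closed under addition and under multiplication by elements of $A^+$. A band is a pointed monoid $B$ with an ideal $N_B\subseteq B^+$ (the nullset) such that each $a\in B$ has a unique $b\in B$ (denoted $-a$) with $a+b\in N_B$. A band homomorphism is a multiplicative map preserving $0$ and $1$ that sends formal sums in the nullset to formal sums in the nullset. $\operatorname{Hom}$ denotes band homomorphisms. A band is finitely generated if it is finitely generated as a monoid. Fields and rings are bands, with nullset the formal sums that sum to $0$. The tropical hyperfield $\mathbb T$ is the band $\mathbb R_{\ge 0}$ (under multiplication) whose nullset consists of $0$ and all formal sums in which the maximum term is attained at least twice. A valuation $v:K\to\mathbb T$ is a band homomorphism, i.e. a non-archimedean absolute value; it is non-trivial if it takes some value other than $0$ and $1$. Dimensions: - $\operatorname{Hom}(B_2,K)$ is identified with the $K$-points of the affine $K$-scheme $\operatorname{Spec}(K[B_2]/\langle N_{B_2}\rangle)$. The fiber $f_K^{-1}(x)$ is the set of $K$-points of a closed subscheme, and its dimension is the Krull dimension of that subscheme. - $\operatorname{Hom}(B,\mathbb T)$ is embedded in $\mathbb T^n=\mathbb R_{\ge0}^n$ by evaluation at a finite set of generators of $B$, with the subspace topology. Dimensions of its subsets are Lebesgue covering dimensions, which are independent of the choice of generators. Matroid part. Let $M$ be a matroid of rank $r$ on a finite set $E$, and let $P$ be a pasture, i.e. a band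 in which every nonzero element is invertible (fields and $\mathbb T$ are pastures). A weak $P$-representation of $M$ is a map $\Delta:E^r\to P$ with the following properties: - $\Delta$ is alternating: it changes by the sign of a permutation of the entries, where the sign is $\pm 1\in P$. - $\Delta(x_1,\dots,x_r)\ne0$ if and only if $\{x_1,\dots,x_r\}$ is a basis of $M$. - For all $x\in E^{r-2}$ and $a,b,c,d\in E$, the 3-term Plücker relation holds: $\Delta(x,a,b)\Delta(x,c,d)-\Delta(x,a,c)\Delta(x,b,d)+\Delta(x,a,d)\Delta(x,b,c)\in N_P$. Two weak $P$-representations are rescaling equivalent if they differ by multiplication by a nonzero constant together with a rescaling $\Delta(x_1,\dots,x_r)\mapsto t_{x_1}\cdots t_{x_r}\Delta(x_1,\dots,x_r)$ with all $t_e\in P\setminus\{0\}$. $\mathcal X_M(P)$ denotes the set of rescaling equivalence classes of weak $P$-representations of $M$. For a field $k$, $\mathcal X_M(k)$ is the set of projective equivalence classes of $k$-representations of $M$. $\mathcal X_M(\mathbb T)$ is the set of rescaling classes of valuated matroids with underlying matroid $M$. An embedded minor $N=M/C\setminus D$ (with $C,D$ disjoint subsets of $E$, written so that $C$ is independent and $D$ is coindependent in $M$) induces a restriction map $\mathcal X_M(P)\to\mathcal X_N(P)$ via $\Delta_N(y)=\Delta(y,c)$ for $y\in(E\setminus(C\cup D))^{r-|C|}$, where $c$ is a fixed ordering of $C$. *)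

theory Defs
  imports
    "HOL-Analysis.Analysis"
    "HOL-Algebra.QuotRing"
    "HOL-Library.Poly_Mapping"
begin

section \<open>Pointed monoids and bands\<close>

record 'a band = "'a monoid" +
  pzero :: 'a
  nullset :: "'a multiset set"

locale pointed_monoid = comm_monoid A for A :: "('a, 'm) band_scheme" (structure) +
  assumes pzero_closed: "pzero A \<in> carrier A"
    and pzero_mult: "a \<in> carrier A \<Longrightarrow> pzero A \<otimes> a = pzero A"

text \<open>The ambient semiring \<open>A\<^sup>+\<close>: a finite formal sum of nonzero elements is a multiset.\<close>

definition fsums :: "('a, 'm) band_scheme \<Rightarrow> 'a multiset set" where
  "fsums A = {M. set_mset M \<subseteq> carrier A - {pzero A}}"

text \<open>
  A formal sum of arbitrary elements is read in \<open>A\<^sup>+\<close> by dropping its zero terms; the zero element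
  of \<open>A\<^sup>+\<close> is the empty multiset.
\<close>

definition fsum :: "('a, 'm) band_scheme \<Rightarrow> 'a multiset \<Rightarrow> 'a multiset" where
  "fsum A M = filter_mset (\<lambda>a. a \<noteq> pzero A) M"

definition fsum_mult :: "('a, 'm) band_scheme \<Rightarrow> 'a multiset \<Rightarrow> 'a multiset \<Rightarrow> 'a multiset" where
  "fsum_mult A M N = fsum A (\<Sum>a\<in>#M. image_mset (\<lambda>b. a \<otimes>\<^bsub>A\<^esub> b) N)"

definition fsum_ideal :: "('a, 'm) band_scheme \<Rightarrow> 'a multiset set \<Rightarrow> bool" where
  "fsum_ideal A I \<longleftrightarrow> I \<subseteq> fsums A \<and> {#} \<in> I \<and> (\<forall>M\<in>I. \<forall>N\<in>I. M + N \<in> I) \<and>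
     (\<forall>M\<in>fsums A. \<forall>N\<in>I. fsum_mult A M N \<in> I)"

locale band = pointed_monoid B for B :: "('a, 'm) band_scheme" (structure) +
  assumes nullset_ideal: "fsum_ideal B (nullset B)"
    and ex1_neg: "a \<in> carrier B \<Longrightarrow> \<exists>!b. b \<in> carrier B \<and> fsum B {#a, b#} \<in> nullset B"

definition neg :: "('a, 'm) band_scheme \<Rightarrow> 'a \<Rightarrow> 'a" where
  "neg B a = (THE b. b \<in> carrier B \<and> fsum B {#a, b#} \<in> nullset B)"

definition band_hom :: "('a, 'm) band_scheme \<Rightarrow> ('b, 'n) band_scheme \<Rightarrow> ('a \<Rightarrow> 'b) set" where
  "band_hom B C = {\<phi> \<in> carrier B \<rightarrow>\<^sub>E carrier C.
     \<phi> (pzero B) = pzero C \<and> \<phi> \<one>\<^bsub>B\<^esub> = \<one>\<^bsub>C\<^esub> \<and>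
     (\<forall>a\<in>carrier B. \<forall>b\<in>carrier B. \<phi> (a \<otimes>\<^bsub>B\<^esub> b) = \<phi> a \<otimes>\<^bsub>C\<^esub> \<phi> b) \<and>
     (\<forall>M\<in>nullset B. fsum C (image_mset \<phi> M) \<in> nullset C)}"

definition generates :: "('a, 'm) band_scheme \<Rightarrow> 'a set \<Rightarrow> bool" where
  "generates B S \<longleftrightarrow> S \<subseteq> carrier B \<and> (\<forall>H. submonoid H B \<and> S \<subseteq> H \<longrightarrow> H = carrier B)"

definition finitely_generated :: "('a, 'm) band_scheme \<Rightarrow> bool" where
  "finitely_generated B \<longleftrightarrow> (\<exists>S. finite S \<and> generates B S)"

definition pasture :: "('a, 'm) band_scheme \<Rightarrow> bool" where
  "pasture P \<longleftrightarrow> band P \<and> carrier P - {pzero P} \<subseteq> Units P"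

definition precomp ::
    "('a, 'm) band_scheme \<Rightarrow> ('a \<Rightarrow> 'b) \<Rightarrow> ('b \<Rightarrow> 'c) \<Rightarrow> 'a \<Rightarrow> 'c" where
  "precomp B f y = compose (carrier B) y f"

definition hom_fiber ::
    "('a, 'm) band_scheme \<Rightarrow> ('b, 'n) band_scheme \<Rightarrow> ('c, 'o) band_scheme \<Rightarrow>
     ('a \<Rightarrow> 'b) \<Rightarrow> ('a \<Rightarrow> 'c) \<Rightarrow> ('b \<Rightarrow> 'c) set" where
  "hom_fiber B1 B2 C f x = {y \<in> band_hom B2 C. precomp B1 f y = x}"


section \<open>Rings and the tropical hyperfield as bands\<close>

definition ring_band :: "'k::comm_ring_1 band" where
  "ring_band = \<lparr>carrier = UNIV, monoid.mult = (*), one = 1, pzero = 0,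
     nullset = {M. 0 \<notin># M \<and> \<Sum>\<^sub># M = 0}\<rparr>"

definition tropical :: "real band" where
  "tropical = \<lparr>carrier = {0..}, monoid.mult = (*), one = 1, pzero = 0,
     nullset = {M. set_mset M \<subseteq> {0<..} \<and> (M = {#} \<or> 2 \<le> count M (Max (set_mset M)))}\<rparr>"

definition valuation :: "('k::field \<Rightarrow> real) \<Rightarrow> bool" where
  "valuation v \<longleftrightarrow> v \<in> band_hom ring_band tropical"

definition nontrivial_valuation :: "('k::field \<Rightarrow> real) \<Rightarrow> bool" where
  "nontrivial_valuation v \<longleftrightarrow> valuation v \<and> (\<exists>a. v a \<notin> {0, 1})"


section \<open>Dimension of fibers over a field\<close>

text \<open>\<open>c \<cdot> [b]\<close> in the (contracted) monoid algebra, where \<open>[0] = 0\<close>.\<close>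

definition alg_monom :: "('b, 'm) band_scheme \<Rightarrow> 'k::zero \<Rightarrow> 'b \<Rightarrow> ('b \<Rightarrow>\<^sub>0 'k)" where
  "alg_monom B c b = (if b = pzero B then 0 else Poly_Mapping.single b c)"

text \<open>\<open>K[B]\<close>: finite \<open>K\<close>-linear combinations of nonzero elements of \<open>B\<close>.\<close>

definition monoid_algebra :: "('b, 'm) band_scheme \<Rightarrow> ('b \<Rightarrow>\<^sub>0 'k::field) ring" where
  "monoid_algebra B = \<lparr>carrier = {p. Poly_Mapping.keys p \<subseteq> carrier B - {pzero B}},
     monoid.mult = (\<lambda>p q. \<Sum>a\<in>Poly_Mapping.keys p. \<Sum>b\<in>Poly_Mapping.keys q.
       alg_monom B (Poly_Mapping.lookup p a * Poly_Mapping.lookup q b) (a \<otimes>\<^bsub>B\<^esub> b)),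
     one = alg_monom B 1 \<one>\<^bsub>B\<^esub>, zero = 0, add = (+)\<rparr>"

definition null_ideal :: "('b, 'm) band_scheme \<Rightarrow> ('b \<Rightarrow>\<^sub>0 'k::field) set" where
  "null_ideal B = Idl\<^bsub>monoid_algebra B\<^esub> ((\<lambda>M. \<Sum>b\<in>#M. alg_monom B 1 b) ` nullset B)"

text \<open>\<open>K[B]/\<langle>N\<^sub>B\<rangle>\<close>\<close>

definition band_algebra :: "('b, 'm) band_scheme \<Rightarrow> ('b \<Rightarrow>\<^sub>0 'k::field) set ring" where
  "band_algebra B = monoid_algebra B Quot null_ideal B"

text \<open>
  The scheme-theoretic fiber over the \<open>K\<close>-point \<open>x\<close> is the closed subscheme of
  \<open>Spec (K[B2]/\<langle>N\<^sub>B\<^sub>2\<rangle>)\<close> cut out by the elements \<open>[f b] - x b\<close> with \<open>b\<close> in \<open>B1\<close>;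
  its set of \<open>K\<close>-points is the fiber \<open>hom_fiber B1 B2 ring_band f x\<close> (theorem \<open>fiber_points\<close>).
\<close>

definition fiber_ideal ::
    "('a, 'm) band_scheme \<Rightarrow> ('b, 'n) band_scheme \<Rightarrow> ('a \<Rightarrow> 'b) \<Rightarrow> ('a \<Rightarrow> 'k::field) \<Rightarrow>
     ('b \<Rightarrow>\<^sub>0 'k) set set" where
  "fiber_ideal B1 B2 f x = Idl\<^bsub>band_algebra B2\<^esub>
     ((\<lambda>b. null_ideal B2 +>\<^bsub>monoid_algebra B2\<^esub>
        (alg_monom B2 1 (f b) - alg_monom B2 (x b) \<one>\<^bsub>B2\<^esub>)) ` carrier B1)"

definition fiber_algebra ::
    "('a, 'm) band_scheme \<Rightarrow> ('b, 'n) band_scheme \<Rightarrow> ('a \<Rightarrow> 'b) \<Rightarrow> ('a \<Rightarrow> 'k::field) \<Rightarrow>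
     ('b \<Rightarrow>\<^sub>0 'k) set set ring" where
  "fiber_algebra B1 B2 f x = band_algebra B2 Quot fiber_ideal B1 B2 f x"

text \<open>The supremum is \<open>-\<infinity>\<close> for the zero ring, whose spectrum is empty.\<close>

definition krull_dim :: "('a, 'm) ring_scheme \<Rightarrow> ereal" where
  "krull_dim R = (SUP n \<in> {n. \<exists>\<pp>. (\<forall>i\<le>n. primeideal (\<pp> i) R) \<and> (\<forall>i<n. \<pp> i \<subset> \<pp> (Suc i))}.
     ereal (real n))"

definition field_fiber_dim ::
    "('a, 'm) band_scheme \<Rightarrow> ('b, 'n) band_scheme \<Rightarrow> ('a \<Rightarrow> 'b) \<Rightarrow> ('a \<Rightarrow> 'k::field) \<Rightarrow> ereal" where
  "field_fiber_dim B1 B2 f x = krull_dim (fiber_algebra B1 B2 f x)"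


section \<open>Dimension of sets of tropical points\<close>

definition covering_dim_le :: "'a topology \<Rightarrow> int \<Rightarrow> bool" where
  "covering_dim_le X n \<longleftrightarrow>
     (\<forall>\<U>. finite \<U> \<and> (\<forall>U\<in>\<U>. openin X U) \<and> \<Union>\<U> = topspace X \<longrightarrow>
       (\<exists>\<V>. (\<forall>V\<in>\<V>. openin X V) \<and> \<Union>\<V> = topspace X \<and> (\<forall>V\<in>\<V>. \<exists>U\<in>\<U>. V \<subseteq> U) \<and>
         (\<forall>p\<in>topspace X. finite {V\<in>\<V>. p \<in> V} \<and> int (card {V\<in>\<V>. p \<in> V}) \<le> n + 1)))"

text \<open>The empty space has dimension \<open>-1\<close>.\<close>

definition covering_dim :: "'a topology \<Rightarrow> ereal" where
  "covering_dim X = (INF n \<in> {n. - 1 \<le> n \<and> covering_dim_le X n}. ereal (real_of_int n))"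

text \<open>
  A set \<open>Y\<close> of homomorphisms into the tropical hyperfield as a subspace of \<open>\<real>\<^sub>\<ge>\<^sub>0\<^sup>S\<close>, by evaluation
  at the elements of a finite generating set \<open>S\<close>.
\<close>

definition tropical_space :: "'b set \<Rightarrow> ('b \<Rightarrow> real) set \<Rightarrow> ('b \<Rightarrow> real) topology" where
  "tropical_space S Y =
     subtopology (product_topology (\<lambda>_. top_of_set {0..}) S) ((\<lambda>y. restrict y S) ` Y)"

definition tropical_dim :: "'b set \<Rightarrow> ('b \<Rightarrow> real) set \<Rightarrow> ereal" where
  "tropical_dim S Y = covering_dim (tropical_space S Y)"


section \<open>Matroids\<close>

record 'e matroid =
  ground :: "'e set"
  indep :: "'e set \<Rightarrow> bool"

locale matroid =
  fixes M :: "'e matroid"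
  assumes ground_finite: "finite (ground M)"
    and indep_subset_ground: "indep M X \<Longrightarrow> X \<subseteq> ground M"
    and indep_empty: "indep M {}"
    and indep_subset: "indep M X \<Longrightarrow> Y \<subseteq> X \<Longrightarrow> indep M Y"
    and indep_augment: "indep M X \<Longrightarrow> indep M Y \<Longrightarrow> card X < card Y \<Longrightarrow>
          \<exists>e\<in>Y - X. indep M (insert e X)"

definition basis_in :: "'e matroid \<Rightarrow> 'e set \<Rightarrow> 'e set \<Rightarrow> bool" where
  "basis_in M A X \<longleftrightarrow> X \<subseteq> A \<and> indep M X \<and> (\<forall>Y. X \<subseteq> Y \<and> Y \<subseteq> A \<and> indep M Y \<longrightarrow> Y = X)"

definition basis :: "'e matroid \<Rightarrow> 'e set \<Rightarrow> bool" where
  "basis M X \<longleftrightarrow> basis_in M (ground M) X"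

definition rank :: "'e matroid \<Rightarrow> nat" where
  "rank M = Max (card ` {X. indep M X})"

definition coindep :: "'e matroid \<Rightarrow> 'e set \<Rightarrow> bool" where
  "coindep M D \<longleftrightarrow> (\<exists>X. basis M X \<and> D \<subseteq> ground M - X)"

definition delete :: "'e matroid \<Rightarrow> 'e set \<Rightarrow> 'e matroid" where
  "delete M D = \<lparr>ground = ground M - D, indep = (\<lambda>X. X \<subseteq> ground M - D \<and> indep M X)\<rparr>"

definition contract :: "'e matroid \<Rightarrow> 'e set \<Rightarrow> 'e matroid" where
  "contract M C = \<lparr>ground = ground M - C,
     indep = (\<lambda>X. X \<subseteq> ground M - C \<and> (\<exists>J. basis_in M C J \<and> indep M (X \<union> J)))\<rparr>"


section \<open>Weak representations over pastures\<close>

definition tuples :: "'e set \<Rightarrow> nat \<Rightarrow> 'e list set" where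
  "tuples E n = {xs. set xs \<subseteq> E \<and> length xs = n}"

definition sgn_in :: "('p, 'm) band_scheme \<Rightarrow> (nat \<Rightarrow> nat) \<Rightarrow> 'p" where
  "sgn_in P \<sigma> = (if evenperm \<sigma> then \<one>\<^bsub>P\<^esub> else neg P \<one>\<^bsub>P\<^esub>)"

definition weak_reps :: "'e matroid \<Rightarrow> ('p, 'm) band_scheme \<Rightarrow> ('e list \<Rightarrow> 'p) set" where
  "weak_reps M P = {\<Delta> \<in> tuples (ground M) (rank M) \<rightarrow>\<^sub>E carrier P.
     (\<forall>xs\<in>tuples (ground M) (rank M). \<forall>\<sigma>. \<sigma> permutes {..<rank M} \<longrightarrow>
        \<Delta> (permute_list \<sigma> xs) = sgn_in P \<sigma> \<otimes>\<^bsub>P\<^esub> \<Delta> xs) \<and>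
     (\<forall>xs\<in>tuples (ground M) (rank M). \<Delta> xs \<noteq> pzero P \<longleftrightarrow> basis M (set xs)) \<and>
     (\<forall>xs a b c d. xs @ [a, b] \<in> tuples (ground M) (rank M) \<and>
          c \<in> ground M \<and> d \<in> ground M \<longrightarrow>
        fsum P {# \<Delta> (xs @ [a, b]) \<otimes>\<^bsub>P\<^esub> \<Delta> (xs @ [c, d]),
                  neg P (\<Delta> (xs @ [a, c]) \<otimes>\<^bsub>P\<^esub> \<Delta> (xs @ [b, d])),
                  \<Delta> (xs @ [a, d]) \<otimes>\<^bsub>P\<^esub> \<Delta> (xs @ [b, c]) #} \<in> nullset P)}"

definition rescaling ::
    "'e matroid \<Rightarrow> ('p, 'm) band_scheme \<Rightarrow> (('e list \<Rightarrow> 'p) \<times> ('e list \<Rightarrow> 'p)) set" where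
  "rescaling M P = {(\<Delta>, \<Delta>'). \<Delta> \<in> weak_reps M P \<and> \<Delta>' \<in> weak_reps M P \<and>
     (\<exists>c\<in>carrier P - {pzero P}. \<exists>t\<in>ground M \<rightarrow> carrier P - {pzero P}.
        \<forall>xs\<in>tuples (ground M) (rank M).
          \<Delta>' xs = c \<otimes>\<^bsub>P\<^esub> (\<Otimes>\<^bsub>P\<^esub>i\<in>{..<rank M}. t (xs ! i)) \<otimes>\<^bsub>P\<^esub> \<Delta> xs)}"

definition rescaling_classes ::
    "'e matroid \<Rightarrow> ('p, 'm) band_scheme \<Rightarrow> ('e list \<Rightarrow> 'p) set set" where
  "rescaling_classes M P = weak_reps M P // rescaling M P"

text \<open>
  Restriction to the minor obtained by deleting \<open>D\<close> and contracting the entries of the list \<open>cs\<close>,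
  first for weak representations, then for rescaling classes.
\<close>

definition minor_rep ::
    "'e matroid \<Rightarrow> 'e list \<Rightarrow> 'e set \<Rightarrow> ('e list \<Rightarrow> 'p) \<Rightarrow> ('e list \<Rightarrow> 'p)" where
  "minor_rep M cs D \<Delta> =
     (\<lambda>ys\<in>tuples (ground M - (set cs \<union> D)) (rank M - length cs). \<Delta> (ys @ cs))"

definition minor_map ::
    "'e matroid \<Rightarrow> 'e list \<Rightarrow> 'e set \<Rightarrow> ('p, 'm) band_scheme \<Rightarrow>
     ('e list \<Rightarrow> 'p) set \<Rightarrow> ('e list \<Rightarrow> 'p) set" where
  "minor_map M cs D P X = rescaling (delete (contract M (set cs)) D) P `` (minor_rep M cs D ` X)"

definition finite_fibers_on :: "'a set \<Rightarrow> 'b set \<Rightarrow> ('a \<Rightarrow> 'b) \<Rightarrow> bool" where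
  "finite_fibers_on A B g \<longleftrightarrow> (\<forall>z\<in>B. finite {w\<in>A. g w = z})"


section \<open>Consistency of the definitions\<close>

lemma band_ring_band: "band (ring_band :: 'k::comm_ring_1 band)"
proof
  show "fsum_ideal ring_band (nullset (ring_band :: 'k band))"
  proof -
    have 1: "\<Sum>\<^sub># (filter_mset (\<lambda>a. a \<noteq> 0) M) = \<Sum>\<^sub># M" for M :: "'k multiset"
      by (induction M) auto
    have 2: "\<Sum>\<^sub># (\<Sum>a\<in>#M. image_mset (\<lambda>b. a * b) N) = \<Sum>\<^sub># M * \<Sum>\<^sub># N" for M N :: "'k multiset"
      by (induction M) (auto simp: distrib_right sum_mset_distrib_left[symmetric])
    show ?thesis unfolding fsum_ideal_def 
      by (auto simp: fsums_def ring_band_def fsum_mult_def fsum_def 1 2)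
  qed
  fix a :: 'k
  show "\<exists>!b. b \<in> carrier ring_band \<and> fsum ring_band {#a, b#} \<in> nullset ring_band"
    by (rule ex1I[of _ "-a"]) (auto simp: ring_band_def fsum_def eq_neg_iff_add_eq_0 add.commute split: if_splits)
qed (auto simp: ring_band_def algebra_simps)

lemma band_tropical: "band tropical"
proof
  have mx: "M \<in> nullset tropical \<longleftrightarrow> set_mset M \<subseteq> {0<..} \<and> (M = {#} \<or> (\<exists>m. (\<forall>a\<in>#M. a \<le> m) \<and> 2 \<le> count M m))" for M
  proof -
    have "2 \<le> count M (Max (set_mset M)) \<longleftrightarrow> (\<exists>m. (\<forall>a\<in>#M. a \<le> m) \<and> 2 \<le> count M m)" if "M \<noteq> {#}"
    proof
      assume "2 \<le> count M (Max (set_mset M))" then show "\<exists>m. (\<forall>a\<in>#M. a \<le> m) \<and> 2 \<le> count M m"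
        by (intro exI[of _ "Max (set_mset M)"]) auto
    next
      assume "\<exists>m. (\<forall>a\<in>#M. a \<le> m) \<and> 2 \<le> count M m"
      then obtain m where m: "\<forall>a\<in>#M. a \<le> m" "2 \<le> count M m" by auto
      then have "m \<in># M" by (metis count_eq_zero_iff not_numeral_le_zero)
      then have "Max (set_mset M) = m" using m by (intro Max_eqI) auto
      then show "2 \<le> count M (Max (set_mset M))" using m by simp
    qed
    then show ?thesis by (auto simp: tropical_def)
  qed
  have pos: "fsums tropical = {M. set_mset M \<subseteq> {0<..}}" by (auto simp: fsums_def tropical_def subset_iff less_le)
  show "fsum_ideal tropical (nullset tropical)"
    unfolding fsum_ideal_def
  proof (intro conjI ballI)
    fix M N :: "real multiset"
    {
      assume "M \<in> nullset tropical" "N \<in> nullset tropical"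
      then consider "M = {#}" | "N = {#}" | m n where "\<forall>a\<in>#M. a \<le> m" "2 \<le> count M m" "\<forall>a\<in>#N. a \<le> n" "2 \<le> count N n"
        by (auto simp: mx)
      then show "M + N \<in> nullset tropical"
      proof cases
        case (3 m n)
        have "\<exists>m. (\<forall>a\<in>#M+N. a \<le> m) \<and> 2 \<le> count (M+N) m"
          by (rule exI[of _ "max m n"]) (use 3 in \<open>auto simp: max_def; force\<close>)
        then show ?thesis using \<open>M \<in> _\<close> \<open>N \<in> _\<close> unfolding mx by auto
      qed (use \<open>M \<in> _\<close> \<open>N \<in> _\<close> in auto)
    }
    assume M: "M \<in> fsums tropical" and N: "N \<in> nullset tropical"
    let ?P = "\<Sum>a\<in>#M. image_mset (\<lambda>b. a * b) N"
    have Np: "set_mset N \<subseteq> {0<..}" using N mx by blast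
    have Mp: "set_mset M \<subseteq> {0<..}" using M pos by blast
    have Pp: "\<exists>a\<in>#M. \<exists>b\<in>#N. p = a * b" if "p \<in># ?P" for p using that by auto
    have P: "fsum_mult tropical M N = ?P"
      unfolding fsum_mult_def fsum_def using Pp Mp Np
      by (auto simp: tropical_def filter_mset_eq_conv)
    show "fsum_mult tropical M N \<in> nullset tropical"
    proof (cases "M = {#} \<or> N = {#}")
      case True then show ?thesis unfolding P mx by (auto simp: image_mset_const_eq)
    next
      case False
      then obtain n where n: "\<forall>a\<in>#N. a \<le> n" "2 \<le> count N n" using N mx by blast
      define m where "m = Max (set_mset M)"
      have m: "m \<in># M" "\<forall>a\<in>#M. a \<le> m" using False by (auto simp: m_def)
      have cnt: "count N n \<le> count (image_mset g N) (g n)" for g :: "real \<Rightarrow> real"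
        by (induction N) auto
      obtain M' where M': "M = add_mset m M'" using m(1) by (meson multi_member_split)
      have "image_mset (\<lambda>b. m * b) N \<subseteq># ?P" unfolding M' by simp
      then have "count (image_mset (\<lambda>b. m * b) N) (m * n) \<le> count ?P (m * n)" by (rule mset_subset_eq_count)
      moreover have "count N n \<le> count (image_mset (\<lambda>b. m * b) N) (m * n)"
        by (rule cnt)
      ultimately have 2: "2 \<le> count ?P (m * n)" using n by linarith
      have "\<forall>p\<in>#?P. p \<le> m * n" 
      proof
        fix p assume "p \<in># ?P"
        then obtain a b where ab: "a \<in># M" "b \<in># N" "p = a * b" using Pp by blast
        then have "0 < a" "0 < b" "a \<le> m" "b \<le> n" using Mp Np m n by auto
        then show "p \<le> m * n" unfolding ab by (intro mult_mono) auto
      qed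
      moreover have "set_mset ?P \<subseteq> {0<..}" using Pp Mp Np by fastforce
      ultimately show ?thesis unfolding P mx using 2 by blast
    qed
  qed (auto simp: mx pos)
  fix a :: real assume "a \<in> carrier tropical"
  then show "\<exists>!b. b \<in> carrier tropical \<and> fsum tropical {#a, b#} \<in> nullset tropical"
    unfolding mx by (intro ex1I[of _ a]) (auto simp: fsum_def tropical_def split: if_splits)
qed (auto simp: tropical_def algebra_simps)

lemma pasture_field: "pasture (ring_band :: 'k::field band)"
proof -
  have "a \<in> Units ring_band" if "a \<noteq> 0" for a :: 'k
    unfolding Units_def ring_band_def by (simp, rule exI[of _ "inverse a"]) (use that in simp)
  then have "carrier ring_band - {pzero ring_band} \<subseteq> Units (ring_band :: 'k band)"
    by (auto simp: ring_band_def)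
  then show ?thesis using band_ring_band unfolding pasture_def by blast
qed

lemma pasture_tropical: "pasture tropical"
proof -
  have "a \<in> Units tropical" if "0 \<le> a" "a \<noteq> 0" for a :: real
    unfolding Units_def tropical_def by (simp add: that, rule bexI[of _ "inverse a"]) (use that in simp_all)
  then have "carrier tropical - {pzero tropical} \<subseteq> Units tropical"
    by (auto simp: tropical_def)
  then show ?thesis using band_tropical unfolding pasture_def by blast
qed

abbreviation pm_lookup :: "('b \<Rightarrow>\<^sub>0 'k::zero) \<Rightarrow> 'b \<Rightarrow> 'k" where "pm_lookup \<equiv> Poly_Mapping.lookup"
abbreviation pm_keys :: "('b \<Rightarrow>\<^sub>0 'k::zero) \<Rightarrow> 'b set" where "pm_keys \<equiv> Poly_Mapping.keys"

lemma alg_monom_0 [simp]: "alg_monom B 0 b = 0" by (simp add: alg_monom_def)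
lemma alg_monom_add: "alg_monom B (c + d) b = alg_monom B c b + alg_monom B (d::'k::field) b"
  by (simp add: alg_monom_def single_add)
lemma alg_monom_sum: "alg_monom B (sum g F) b = (\<Sum>i\<in>F. alg_monom B (g i :: 'k::field) b)"
  by (induction F rule: infinite_finite_induct) (auto simp: alg_monom_add)

definition alg_mult :: "('b, 'm) band_scheme \<Rightarrow> ('b \<Rightarrow>\<^sub>0 'k::field) \<Rightarrow> ('b \<Rightarrow>\<^sub>0 'k) \<Rightarrow> ('b \<Rightarrow>\<^sub>0 'k)" where
 "alg_mult B p q = (\<Sum>a\<in>pm_keys p. \<Sum>b\<in>pm_keys q. alg_monom B (pm_lookup p a * pm_lookup q b) (a \<otimes>\<^bsub>B\<^esub> b))"

lemma alg_mult_super: assumes "finite F" "finite G" "pm_keys p \<subseteq> F" "pm_keys q \<subseteq> G"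
  shows "alg_mult B p q = (\<Sum>a\<in>F. \<Sum>b\<in>G. alg_monom B (pm_lookup p a * pm_lookup q b) (a \<otimes>\<^bsub>B\<^esub> b))"
proof -
  have "alg_mult B p q = (\<Sum>a\<in>pm_keys p. \<Sum>b\<in>G. alg_monom B (pm_lookup p a * pm_lookup q b) (a \<otimes>\<^bsub>B\<^esub> b))"
    unfolding alg_mult_def by (intro sum.cong refl sum.mono_neutral_left) (use assms in \<open>auto simp: in_keys_iff\<close>)
  also have "\<dots> = (\<Sum>a\<in>F. \<Sum>b\<in>G. alg_monom B (pm_lookup p a * pm_lookup q b) (a \<otimes>\<^bsub>B\<^esub> b))"
    by (intro sum.mono_neutral_left) (use assms in \<open>auto simp: in_keys_iff\<close>)
  finally show ?thesis .
qed

lemma alg_mult_addl: "alg_mult B (p + p') q = alg_mult B p q + alg_mult B p' q"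
proof -
  let ?F = "pm_keys p \<union> pm_keys p'"
  have k: "pm_keys (p+p') \<subseteq> ?F" by (rule keys_add)
  show ?thesis
    by (subst (1 2 3) alg_mult_super[where F = ?F and G = "pm_keys q"])
       (use k in \<open>auto simp: lookup_add alg_monom_add distrib_right sum.distrib\<close>)
qed
lemma alg_mult_addr: "alg_mult B q (p + p') = alg_mult B q p + alg_mult B q p'"
proof -
  let ?F = "pm_keys p \<union> pm_keys p'"
  have k: "pm_keys (p+p') \<subseteq> ?F" by (rule keys_add)
  show ?thesis
    by (subst (1 2 3) alg_mult_super[where G = ?F and F = "pm_keys q"])
       (use k in \<open>auto simp: lookup_add alg_monom_add distrib_left sum.distrib\<close>)
qed
lemma alg_mult_0 [simp]: "alg_mult B 0 q = 0" "alg_mult B q 0 = 0" by (auto simp: alg_mult_def)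
lemma alg_mult_suml: "alg_mult B (sum f I) q = (\<Sum>i\<in>I. alg_mult B (f i) q)"
  by (induction I rule: infinite_finite_induct) (auto simp: alg_mult_addl)
lemma alg_mult_sumr: "alg_mult B q (sum f I) = (\<Sum>i\<in>I. alg_mult B q (f i))"
  by (induction I rule: infinite_finite_induct) (auto simp: alg_mult_addr)

context pointed_monoid begin

lemma mult_pzero: "a \<in> carrier A \<Longrightarrow> a \<otimes> pzero A = pzero A"
  using pzero_mult m_comm pzero_closed by metis

lemma alg_mult_mon: assumes "a \<in> carrier A" "b \<in> carrier A"
  shows "alg_mult A (alg_monom A c a) (alg_monom A d b) = alg_monom A (c * d) (a \<otimes> b)"
proof (cases "a = pzero A \<or> b = pzero A")
  case True
  then have "a \<otimes> b = pzero A" using assms pzero_mult mult_pzero by auto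
  then show ?thesis using True by (auto simp: alg_monom_def)
next
  case False
  then show ?thesis
    by (subst alg_mult_super[where F = "{a}" and G = "{b}"]) (auto simp: alg_monom_def)
qed

definition "alg_carrier = {p :: 'a \<Rightarrow>\<^sub>0 'k::field. pm_keys p \<subseteq> carrier A - {pzero A}}"

lemma decomp: assumes "p \<in> alg_carrier" shows "p = (\<Sum>a\<in>pm_keys p. alg_monom A (pm_lookup p a) a)"
proof -
  have "(\<Sum>a\<in>pm_keys p. alg_monom A (pm_lookup p a) a) = (\<Sum>a\<in>pm_keys p. Poly_Mapping.single a (pm_lookup p a))"
    using assms by (intro sum.cong) (auto simp: alg_monom_def alg_carrier_def)
  also have "\<dots> = p"
  proof (rule poly_mapping_eqI)
    fix k show "pm_lookup (\<Sum>a\<in>pm_keys p. Poly_Mapping.single a (pm_lookup p a)) k = pm_lookup p k"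
      by (cases "k \<in> pm_keys p") (auto simp: lookup_sum lookup_single when_def in_keys_iff sum.delta)
  qed
  finally show ?thesis by simp
qed

lemma alg_carrier_add: "p \<in> alg_carrier \<Longrightarrow> q \<in> alg_carrier \<Longrightarrow> p + q \<in> alg_carrier"
  unfolding alg_carrier_def using keys_add[of p q] by blast
lemma alg_carrier_0: "0 \<in> alg_carrier" by (auto simp: alg_carrier_def)
lemma alg_carrier_sum: "(\<And>i. i \<in> I \<Longrightarrow> f i \<in> alg_carrier) \<Longrightarrow> sum f I \<in> alg_carrier"
  by (induction I rule: infinite_finite_induct) (auto simp: alg_carrier_0 alg_carrier_add)
lemma alg_carrier_mon: "a \<in> carrier A \<Longrightarrow> alg_monom A c a \<in> alg_carrier"
  by (auto simp: alg_monom_def alg_carrier_def)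
lemma alg_carrier_mul: "p \<in> alg_carrier \<Longrightarrow> q \<in> alg_carrier \<Longrightarrow> alg_mult A p q \<in> alg_carrier"
  unfolding alg_mult_def by (intro alg_carrier_sum alg_carrier_mon) (auto simp: alg_carrier_def)

lemma alg_mult_comm: "p \<in> alg_carrier \<Longrightarrow> q \<in> alg_carrier \<Longrightarrow> alg_mult A p q = alg_mult A q p"
  unfolding alg_mult_def
  by (subst sum.swap, intro sum.cong refl) (metis (no_types, lifting) DiffD1 alg_carrier_def m_comm mem_Collect_eq mult.commute subsetD)

lemma alg_mult_assoc: assumes "p \<in> alg_carrier" "q \<in> alg_carrier" "r \<in> alg_carrier"
  shows "alg_mult A (alg_mult A p q) r = alg_mult A p (alg_mult A q r)"
proof -
  have c: "\<And>a. a \<in> pm_keys p \<Longrightarrow> a \<in> carrier A" "\<And>a. a \<in> pm_keys q \<Longrightarrow> a \<in> carrier A" "\<And>a. a \<in> pm_keys r \<Longrightarrow> a \<in> carrier A"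
    using assms by (auto simp: alg_carrier_def)
  show ?thesis
    by (subst (1 2) decomp[OF assms(1)], subst (1 2) decomp[OF assms(2)], subst (1 2) decomp[OF assms(3)])
       (simp add: alg_mult_suml alg_mult_sumr alg_mult_mon c m_assoc mult.assoc)
qed

lemma alg_mult_one: assumes "p \<in> alg_carrier" shows "alg_mult A (alg_monom A 1 \<one>) p = p"
proof -
  have c: "\<And>a. a \<in> pm_keys p \<Longrightarrow> a \<in> carrier A"
    using assms by (auto simp: alg_carrier_def)
  have "alg_mult A (alg_monom A 1 \<one>) (\<Sum>a\<in>pm_keys p. alg_monom A (pm_lookup p a) a) = (\<Sum>a\<in>pm_keys p. alg_monom A (pm_lookup p a) a)"
    by (simp add: alg_mult_sumr alg_mult_mon c)
  then show ?thesis using decomp[OF assms] by simp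
qed

lemma monoid_algebra_eq: "monoid_algebra A = \<lparr>carrier = alg_carrier, monoid.mult = alg_mult A, one = alg_monom A 1 \<one>, zero = 0, add = (+)\<rparr>"
  by (simp add: monoid_algebra_def alg_carrier_def alg_mult_def[abs_def])

lemma cring_monoid_algebra: "cring (monoid_algebra A)"
proof (rule cringI)
  show "abelian_group (monoid_algebra A :: ('a \<Rightarrow>\<^sub>0 'k::field) ring)"
  proof (rule abelian_groupI)
    fix x :: "'a \<Rightarrow>\<^sub>0 'k" assume "x \<in> carrier (monoid_algebra A)"
    then show "\<exists>y\<in>carrier (monoid_algebra A). y \<oplus>\<^bsub>monoid_algebra A\<^esub> x = \<zero>\<^bsub>monoid_algebra A\<^esub>"
      by (intro bexI[of _ "-x"]) (auto simp: monoid_algebra_eq alg_carrier_def)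
  qed (auto simp: monoid_algebra_eq alg_carrier_add alg_carrier_0 add.assoc add.commute)
  show "Group.comm_monoid (monoid_algebra A)"
    by (rule comm_monoidI) (auto simp: monoid_algebra_eq alg_carrier_mul alg_carrier_mon alg_mult_assoc alg_mult_one intro: alg_mult_comm)
qed (auto simp: monoid_algebra_eq alg_mult_addl)

end

definition field_ring :: "'k::field ring" where
  "field_ring = \<lparr>carrier = UNIV, monoid.mult = (*), one = 1, zero = 0, add = (+)\<rparr>"

lemma cring_field_ring: "cring (field_ring :: 'k::field ring)"
proof (rule cringI)
  show "abelian_group (field_ring :: 'k ring)"
    by (rule abelian_groupI) (auto simp: field_ring_def algebra_simps intro: exI[of _ "- _"] add.left_inverse)
  show "Group.comm_monoid (field_ring :: 'k ring)"
    by (rule comm_monoidI) (auto simp: field_ring_def algebra_simps)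
qed (auto simp: field_ring_def algebra_simps)

lemma ring_hom_field_zero: assumes "cring R" "h \<in> ring_hom R (field_ring :: 'k::field ring)"
  shows "h \<zero>\<^bsub>R\<^esub> = 0"
  using ring_hom_zero[OF assms(2)] assms(1) cring_field_ring by (auto simp: cring_def field_ring_def)

lemma quotient_ring_hom:
  assumes R: "cring R" and G: "G \<subseteq> carrier R" and h: "h \<in> ring_hom R (field_ring :: 'k::field ring)"
    and hG: "\<And>g. g \<in> G \<Longrightarrow> h g = 0"
  shows "\<exists>h'. h' \<in> ring_hom (R Quot (Idl\<^bsub>R\<^esub> G)) field_ring \<and> (\<forall>r\<in>carrier R. h' (Idl\<^bsub>R\<^esub> G +>\<^bsub>R\<^esub> r) = h r)"
proof -
  interpret R: cring R by fact
  interpret K: cring "field_ring :: 'k ring" by (rule cring_field_ring)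
  interpret H: ring_hom_ring R "field_ring :: 'k ring" h
    by (rule ring_hom_ringI2) (use R.ring_axioms K.ring_axioms h in auto)
  let ?I = "Idl\<^bsub>R\<^esub> G"
  have I: "ideal ?I R" using G by (rule R.genideal_ideal)
  interpret I: ideal ?I R by fact
  have fz: "\<zero>\<^bsub>field_ring\<^esub> = (0::'k)" by (simp add: field_ring_def)
  have sub: "?I \<subseteq> a_kernel R field_ring h"
  proof (rule R.genideal_minimal[OF H.kernel_is_ideal subsetI])
    fix g assume g: "g \<in> G"
    have "g \<in> carrier R" using G g by (rule subsetD)
    moreover have "h g = \<zero>\<^bsub>field_ring\<^esub>" unfolding fz by (rule hG[OF g])
    ultimately show "g \<in> a_kernel R field_ring h"
      unfolding a_kernel_def' by blast
  qed
  have hc: "h ` (?I +>\<^bsub>R\<^esub> r) = {h r}" if r: "r \<in> carrier R" for r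
  proof -
    have 1: "h (i \<oplus>\<^bsub>R\<^esub> r) = h r" if "i \<in> ?I" for i
    proof -
      have "i \<in> a_kernel R field_ring h" using sub that by (rule subsetD)
      then have "i \<in> carrier R" "h i = 0" unfolding a_kernel_def' fz by blast+
      then show ?thesis using r by (simp add: H.hom_add) (simp add: field_ring_def)
    qed
    have "r \<in> ?I +>\<^bsub>R\<^esub> r" using I.a_rcos_self r by simp
    then show ?thesis using 1 unfolding a_r_coset_def' by fastforce
  qed
  define h' where "h' X = the_elem (h ` X)" for X
  have h': "h' (?I +>\<^bsub>R\<^esub> r) = h r" if "r \<in> carrier R" for r
    using hc[OF that] by (simp add: h'_def)
  have cQ: "\<exists>r\<in>carrier R. X = ?I +>\<^bsub>R\<^esub> r" if "X \<in> carrier (R Quot ?I)" for X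
    using that by (auto simp: FactRing_def A_RCOSETS_def')
  have "h' \<in> ring_hom (R Quot ?I) field_ring"
  proof (rule ring_hom_memI)
    fix X Y assume X: "X \<in> carrier (R Quot ?I)" and Y: "Y \<in> carrier (R Quot ?I)"
    obtain a b where a: "a \<in> carrier R" "X = ?I +>\<^bsub>R\<^esub> a" and b: "b \<in> carrier R" "Y = ?I +>\<^bsub>R\<^esub> b"
      using cQ[OF X] cQ[OF Y] by auto
    have "X \<otimes>\<^bsub>R Quot ?I\<^esub> Y = ?I +>\<^bsub>R\<^esub> (a \<otimes>\<^bsub>R\<^esub> b)"
      using a b I.rcoset_mult_add by (simp add: FactRing_def)
    then show "h' (X \<otimes>\<^bsub>R Quot ?I\<^esub> Y) = h' X \<otimes>\<^bsub>field_ring\<^esub> h' Y" using a b by (simp add: h')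
    have "X \<oplus>\<^bsub>R Quot ?I\<^esub> Y = ?I +>\<^bsub>R\<^esub> (a \<oplus>\<^bsub>R\<^esub> b)"
      using a b I.a_rcos_sum by (simp add: FactRing_def)
    then show "h' (X \<oplus>\<^bsub>R Quot ?I\<^esub> Y) = h' X \<oplus>\<^bsub>field_ring\<^esub> h' Y" using a b by (simp add: h')
  next
    have "\<one>\<^bsub>R Quot ?I\<^esub> = ?I +>\<^bsub>R\<^esub> \<one>\<^bsub>R\<^esub>" by (simp add: FactRing_def)
    then show "h' \<one>\<^bsub>R Quot ?I\<^esub> = \<one>\<^bsub>field_ring\<^esub>" by (simp add: h')
  qed (simp add: field_ring_def)
  with h' show ?thesis by auto
qed


text \<open>The image in the coordinate ring of the fiber of an element of \<open>K[B2]\<close>.\<close>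

definition fiber_class :: "('a, 'm) band_scheme \<Rightarrow> ('b, 'n) band_scheme \<Rightarrow> ('a \<Rightarrow> 'b) \<Rightarrow> ('a \<Rightarrow> 'k::field) \<Rightarrow> ('b \<Rightarrow>\<^sub>0 'k) \<Rightarrow> ('b \<Rightarrow>\<^sub>0 'k) set set" where
  "fiber_class B1 B2 f x p = fiber_ideal B1 B2 f x +>\<^bsub>band_algebra B2\<^esub> (null_ideal B2 +>\<^bsub>monoid_algebra B2\<^esub> p)"

text \<open>
  The \<open>K\<close>-algebra homomorphisms from the coordinate ring of the fiber to \<open>K\<close> are the elements
  of the set-theoretic fiber.
\<close>

theorem fiber_points:
  fixes B1 :: "('a, 'm) band_scheme" and B2 :: "('b, 'n) band_scheme" and x :: "'a \<Rightarrow> 'k::field"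
  assumes B2: "band B2" and f: "f \<in> band_hom B1 B2" and x: "x \<in> band_hom B1 ring_band"
  shows "bij_betw (\<lambda>\<phi>. \<lambda>b\<in>carrier B2. \<phi> (fiber_class B1 B2 f x (alg_monom B2 1 b)))
    {\<phi> \<in> ring_hom (fiber_algebra B1 B2 f x) field_ring \<inter> extensional (carrier (fiber_algebra B1 B2 f x)).
       \<forall>c. \<phi> (fiber_class B1 B2 f x (alg_monom B2 c \<one>\<^bsub>B2\<^esub>)) = c}
    (hom_fiber B1 B2 ring_band f x)"
proof -
  interpret B: band B2 by fact
  let ?R = "monoid_algebra B2 :: ('b \<Rightarrow>\<^sub>0 'k) ring"
  let ?I = "null_ideal B2 :: ('b \<Rightarrow>\<^sub>0 'k) set"
  let ?Q = "band_algebra B2 :: ('b \<Rightarrow>\<^sub>0 'k) set ring"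
  let ?J = "fiber_ideal B1 B2 f x"
  let ?F = "fiber_algebra B1 B2 f x"
  let ?m = "alg_monom B2 :: 'k \<Rightarrow> _"
  let ?u = "\<one>\<^bsub>B2\<^esub>"
  let ?c = "fiber_class B1 B2 f x"
  let ?s = "\<lambda>M. \<Sum>b\<in>#M. ?m 1 b"
  let ?g = "\<lambda>b. ?m 1 (f b) - ?m (x b) ?u"
  have fm: "f b \<in> carrier B2" if "b \<in> carrier B1" for b using f that by (auto simp: band_hom_def)
  have nc: "b \<in> carrier B2 \<and> b \<noteq> pzero B2" if "M \<in> nullset B2" "b \<in># M" for M b
    using B.nullset_ideal that by (auto simp: fsum_ideal_def fsums_def)
  have car_diff: "p - q \<in> B.alg_carrier" if "p \<in> B.alg_carrier" "q \<in> B.alg_carrier" for p q :: "'b \<Rightarrow>\<^sub>0 'k"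
    using that keys_diff[of p q] unfolding B.alg_carrier_def by blast
  have car_s: "?s M \<in> B.alg_carrier" if "\<And>b. b \<in># M \<Longrightarrow> b \<in> carrier B2" for M
    using that by (induction M) (auto simp: B.alg_carrier_0 B.alg_carrier_add B.alg_carrier_mon)
  have cR: "carrier ?R = B.alg_carrier" by (simp add: B.monoid_algebra_eq)
  interpret R: cring ?R by (rule B.cring_monoid_algebra)
  have G1: "?s ` nullset B2 \<subseteq> carrier ?R" using car_s nc by (auto simp: cR)
  interpret I: ideal ?I ?R unfolding null_ideal_def by (rule R.genideal_ideal[OF G1])
  interpret Q: cring ?Q unfolding band_algebra_def by (rule I.quotient_is_cring[OF R.cring_axioms])
  let ?q = "\<lambda>p. ?I +>\<^bsub>?R\<^esub> p"
  have q: "?q \<in> ring_hom ?R ?Q" unfolding band_algebra_def by (rule I.rcos_ring_hom)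
  have g: "?g b \<in> B.alg_carrier" if "b \<in> carrier B1" for b
    using fm[OF that] by (intro car_diff B.alg_carrier_mon) auto
  have G2: "(\<lambda>b. ?q (?g b)) ` carrier B1 \<subseteq> carrier ?Q"
    using g ring_hom_closed[OF q] by (auto simp: cR)
  have J: "ideal ?J ?Q" unfolding fiber_ideal_def by (rule Q.genideal_ideal[OF G2])
  interpret J: ideal ?J ?Q by (rule J)
  interpret F: cring ?F unfolding fiber_algebra_def by (rule J.quotient_is_cring[OF Q.cring_axioms])
  have qJ: "(\<lambda>X. ?J +>\<^bsub>?Q\<^esub> X) \<in> ring_hom ?Q ?F" unfolding fiber_algebra_def by (rule J.rcos_ring_hom)
  have c: "?c \<in> ring_hom ?R ?F"
    using ring_hom_trans[OF q qJ] by (simp add: o_def fiber_class_def[abs_def])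
  have surjc: "\<exists>p\<in>B.alg_carrier. X = ?c p" if "X \<in> carrier ?F" for X
  proof -
    have "\<exists>Y\<in>carrier ?Q. X = ?J +>\<^bsub>?Q\<^esub> Y" using that by (auto simp: fiber_algebra_def FactRing_def A_RCOSETS_def')
    then obtain Y where Y: "Y\<in>carrier ?Q" "X = ?J +>\<^bsub>?Q\<^esub> Y" by auto
    then have "\<exists>p\<in>carrier ?R. Y = ?q p" unfolding band_algebra_def by (auto simp: FactRing_def A_RCOSETS_def')
    then show ?thesis using Y by (auto simp: cR fiber_class_def)
  qed
  have z: "?c p = \<zero>\<^bsub>?F\<^esub>" if "p \<in> ?I" for p
  proof -
    have "?q p = ?I" using that by (simp add: I.a_rcos_const)
    also have "\<dots> = \<zero>\<^bsub>?Q\<^esub>" by (simp add: band_algebra_def FactRing_def)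
    finally have "?q p \<in> ?J" by simp
    then show ?thesis by (simp add: fiber_class_def J.a_rcos_const fiber_algebra_def FactRing_def)
  qed
  have z1: "?c (?s M) = \<zero>\<^bsub>?F\<^esub>" if "M \<in> nullset B2" for M
    by (rule z) (use that R.genideal_self[OF G1] in \<open>auto simp: null_ideal_def\<close>)
  have z2: "?c (?g b) = \<zero>\<^bsub>?F\<^esub>" if "b \<in> carrier B1" for b
  proof -
    have "?q (?g b) \<in> ?J" using that Q.genideal_self[OF G2] unfolding fiber_ideal_def by auto
    then show ?thesis by (simp add: fiber_class_def J.a_rcos_const fiber_algebra_def FactRing_def)
  qed
  define H where "H = {\<phi> \<in> ring_hom ?F field_ring \<inter> extensional (carrier ?F). \<forall>c. \<phi> (?c (?m c ?u)) = c}"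
  have add: "\<phi> (?c (p + r)) = \<phi> (?c p) + \<phi> (?c r)"
    and mul: "\<phi> (?c (alg_mult B2 p r)) = \<phi> (?c p) * \<phi> (?c r)" if "\<phi> \<in> H" "p \<in> B.alg_carrier" "r \<in> B.alg_carrier" for \<phi> p r
  proof -
    have h: "\<phi> \<circ> ?c \<in> ring_hom ?R field_ring" using that c by (intro ring_hom_trans[OF c]) (auto simp: H_def)
    show "\<phi> (?c (p + r)) = \<phi> (?c p) + \<phi> (?c r)" "\<phi> (?c (alg_mult B2 p r)) = \<phi> (?c p) * \<phi> (?c r)"
      using ring_hom_add[OF h, of p r] ring_hom_mult[OF h, of p r] that by (auto simp: B.monoid_algebra_eq field_ring_def)
  qed
  have zer: "\<phi> (?c 0) = 0" "\<phi> \<zero>\<^bsub>?F\<^esub> = 0" if "\<phi> \<in> H" for \<phi>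
  proof -
    have h: "\<phi> \<circ> ?c \<in> ring_hom ?R field_ring" using that c by (intro ring_hom_trans[OF c]) (auto simp: H_def)
    show "\<phi> (?c 0) = 0" using ring_hom_field_zero[OF R.cring_axioms h] by (simp add: B.monoid_algebra_eq)
    show "\<phi> \<zero>\<^bsub>?F\<^esub> = 0" using ring_hom_field_zero[OF F.cring_axioms] that by (auto simp: H_def)
  qed
  have mon: "\<phi> (?c (?m d b)) = d * \<phi> (?c (?m 1 b))" if "\<phi> \<in> H" "b \<in> carrier B2" for \<phi> d b
    using mul[OF that(1), of "?m d ?u" "?m 1 b"] that by (simp add: B.alg_carrier_mon B.alg_mult_mon H_def)
  have summ: "\<phi> (?c (?s M)) = (\<Sum>b\<in>#M. \<phi> (?c (?m 1 b)))" if "\<phi> \<in> H" "\<And>b. b \<in># M \<Longrightarrow> b \<in> carrier B2" for \<phi> M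
    using that(2) by (induction M) (auto simp: zer that(1) add car_s B.alg_carrier_mon)
  have sumk: "\<phi> (?c (sum h A)) = (\<Sum>a\<in>A. \<phi> (?c (h a)))" if "\<phi> \<in> H" "\<And>a. a \<in> A \<Longrightarrow> h a \<in> B.alg_carrier" for \<phi> A and h :: "'b \<Rightarrow> _"
    using that(2) by (induction A rule: infinite_finite_induct) (auto simp: zer that(1) add B.alg_carrier_sum)
  let ?T = "\<lambda>\<phi>. \<lambda>b\<in>carrier B2. \<phi> (?c (?m 1 b))"
  have val: "\<phi> (?c p) = (\<Sum>b\<in>pm_keys p. pm_lookup p b * ?T \<phi> b)" if "\<phi> \<in> H" "p \<in> B.alg_carrier" for \<phi> p
  proof -
    have k: "b \<in> carrier B2" if "b \<in> pm_keys p" for b using that \<open>p \<in> B.alg_carrier\<close> by (auto simp: B.alg_carrier_def)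
    have "\<phi> (?c p) = \<phi> (?c (\<Sum>b\<in>pm_keys p. ?m (pm_lookup p b) b))" using B.decomp[OF that(2)] by simp
    also have "\<dots> = (\<Sum>b\<in>pm_keys p. \<phi> (?c (?m (pm_lookup p b) b)))" by (rule sumk) (use that k in \<open>auto simp: B.alg_carrier_mon\<close>)
    also have "\<dots> = (\<Sum>b\<in>pm_keys p. pm_lookup p b * ?T \<phi> b)"
      by (rule sum.cong) (use that k mon in auto)
    finally show ?thesis .
  qed
  have rb: "carrier (ring_band :: 'k band) = UNIV" "(\<otimes>\<^bsub>ring_band\<^esub>) = ((*) :: 'k \<Rightarrow> _)"
     "\<one>\<^bsub>ring_band\<^esub> = (1::'k)" "pzero ring_band = (0::'k)" by (auto simp: ring_band_def)
  have fs: "\<Sum>\<^sub># (fsum ring_band (M :: 'k multiset)) = \<Sum>\<^sub># M" "0 \<notin># fsum ring_band (M :: 'k multiset)" for M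
    by (induction M) (auto simp: fsum_def ring_band_def)
  have T1: "?T \<phi> \<in> hom_fiber B1 B2 ring_band f x" if h: "\<phi> \<in> H" for \<phi>
  proof -
    have 1: "(\<Sum>b\<in>#M. ?T \<phi> b) = 0" if "M \<in> nullset B2" for M
    proof -
      have "(\<Sum>b\<in>#M. ?T \<phi> b) = (\<Sum>b\<in>#M. \<phi> (?c (?m 1 b)))"
        by (intro arg_cong[where f=sum_mset] image_mset_cong) (use nc[OF that] in auto)
      also have "\<dots> = \<phi> (?c (?s M))" using summ[OF h, of M] nc[OF that] by auto
      also have "\<dots> = 0" using z1[OF that] zer[OF h] by simp
      finally show ?thesis .
    qed
    have mm: "\<phi> (?c (?m 1 (a \<otimes>\<^bsub>B2\<^esub> b))) = \<phi> (?c (?m 1 a)) * \<phi> (?c (?m 1 b))"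
      if "a \<in> carrier B2" "b \<in> carrier B2" for a b
      using mul[OF h, of "?m 1 a" "?m 1 b"] that by (simp add: B.alg_carrier_mon B.alg_mult_mon)
    have n1: "fsum ring_band (image_mset (?T \<phi>) M) \<in> nullset ring_band" if "M \<in> nullset B2" for M
    proof -
      have "\<Sum>\<^sub># (fsum ring_band (image_mset (?T \<phi>) M)) = 0" by (subst fs(1)) (rule 1[OF that])
      then show ?thesis using fs(2)[of "image_mset (?T \<phi>) M"] by (simp add: ring_band_def)
    qed
    have "?T \<phi> \<in> band_hom B2 ring_band"
      unfolding band_hom_def
      using h n1 mm zer[OF h]
      by (auto simp: B.pzero_closed rb B.alg_carrier_mon B.alg_mult_mon H_def alg_monom_def[of _ _ "pzero B2"])
    moreover have "\<phi> (?c (?m 1 (f b))) = x b" if "b \<in> carrier B1" for b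
    proof -
      have "\<phi> (?c (?m 1 (f b))) = \<phi> (?c (?g b + ?m (x b) ?u))" by simp
      also have "\<dots> = x b" using add[OF h g[OF that], of "?m (x b) ?u"] z2[OF that] zer[OF h] h
        by (simp add: B.alg_carrier_mon) (simp add: H_def)
      finally show ?thesis .
    qed
    moreover have "x \<in> extensional (carrier B1)" using x by (auto simp: band_hom_def PiE_def)
    ultimately show ?thesis using fm 
      by (auto simp: hom_fiber_def precomp_def compose_def extensional_def fun_eq_iff)
  qed
  have inj: "inj_on ?T H"
  proof (rule inj_onI)
    fix \<phi> \<psi> assume h: "\<phi> \<in> H" "\<psi> \<in> H" and e: "?T \<phi> = ?T \<psi>"
    have "\<phi> X = \<psi> X" if X: "X \<in> carrier ?F" for X
    proof -
      obtain p where p: "p \<in> B.alg_carrier" "X = ?c p" using surjc[OF X] by blast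
      show ?thesis unfolding p(2) val[OF h(1) p(1)] val[OF h(2) p(1)] e ..
    qed
    then show "\<phi> = \<psi>" using h by (intro extensionalityI[of _ "carrier ?F"]) (auto simp: H_def)
  qed
  have surj: "\<exists>\<phi>\<in>H. ?T \<phi> = y" if y: "y \<in> hom_fiber B1 B2 ring_band f x" for y
  proof -
    have y0: "y (pzero B2) = 0" "y ?u = 1" and ym: "\<And>a b. a \<in> carrier B2 \<Longrightarrow> b \<in> carrier B2 \<Longrightarrow> y (a \<otimes>\<^bsub>B2\<^esub> b) = y a * y b"
      and ye: "y \<in> extensional (carrier B2)"
      using y by (auto simp: hom_fiber_def band_hom_def rb PiE_def)
    have yp: "y (f b) = x b" if "b \<in> carrier B1" for b
    proof -
      have "compose (carrier B1) y f = x" using y by (simp add: hom_fiber_def precomp_def)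
      then have "compose (carrier B1) y f b = x b" by simp
      then show ?thesis using that by (simp add: compose_eq)
    qed
    have yn: "(\<Sum>b\<in>#M. y b) = 0" if "M \<in> nullset B2" for M
    proof -
      have "fsum ring_band (image_mset y M) \<in> nullset ring_band" using y that by (auto simp: hom_fiber_def band_hom_def)
      then have "\<Sum>\<^sub># (fsum ring_band (image_mset y M)) = 0" by (simp add: ring_band_def)
      then show ?thesis using fs by simp
    qed
    define ev where "ev p = (\<Sum>b\<in>pm_keys p. pm_lookup p b * y b)" for p :: "'b \<Rightarrow>\<^sub>0 'k"
    have evs: "ev p = (\<Sum>b\<in>A. pm_lookup p b * y b)" if "finite A" "pm_keys p \<subseteq> A" for p A
      unfolding ev_def by (rule sum.mono_neutral_left) (use that in \<open>auto simp: in_keys_iff\<close>)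
    have eva: "ev (p + r) = ev p + ev r" for p r
      using keys_add[of p r] by (subst (1 2 3) evs[of "pm_keys p \<union> pm_keys r"]) (auto simp: lookup_add distrib_right sum.distrib)
    have ev0: "ev 0 = 0" by (simp add: ev_def)
    have evm: "ev (?m d b) = d * y b" for d b
      using y0 by (subst evs[of "{b}"]) (auto simp: alg_monom_def)
    have evsum: "ev (sum h A) = (\<Sum>a\<in>A. ev (h a))" for A and h :: "'b \<Rightarrow> _"
      by (induction A rule: infinite_finite_induct) (auto simp: eva ev0)
    have evmul: "ev (alg_mult B2 p r) = ev p * ev r" if "p \<in> B.alg_carrier" "r \<in> B.alg_carrier" for p r
    proof -
      have "ev (alg_mult B2 p r) = (\<Sum>a\<in>pm_keys p. \<Sum>b\<in>pm_keys r. (pm_lookup p a * pm_lookup r b) * (y a * y b))"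
        unfolding alg_mult_def evsum evm
        by (intro sum.cong refl) (use that ym in \<open>auto simp: B.alg_carrier_def subset_iff\<close>)
      also have "\<dots> = ev p * ev r" by (simp add: ev_def sum_product ac_simps)
      finally show ?thesis .
    qed
    have evh: "ev \<in> ring_hom ?R field_ring"
      by (rule ring_hom_memI) (auto simp: B.monoid_algebra_eq field_ring_def eva evmul evm y0)
    have evG: "ev (?s M) = 0" if "M \<in> nullset B2" for M
    proof -
      have "ev (?s M) = (\<Sum>b\<in>#M. y b)" by (induction M) (auto simp: eva ev0 evm)
      then show ?thesis using yn that by simp
    qed
    have k1: "ev r = 0" if "r \<in> ?s ` nullset B2" for r using evG that by blast
    obtain e1 where e1: "e1 \<in> ring_hom ?Q field_ring" "\<And>r. r \<in> B.alg_carrier \<Longrightarrow> e1 (?q r) = ev r"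
      using quotient_ring_hom[OF R.cring_axioms G1 evh k1] unfolding band_algebra_def null_ideal_def cR by blast
    have "e1 (?q (?g b)) = 0" if "b \<in> carrier B1" for b
    proof -
      have "ev (?g b + ?m (x b) ?u) = ev (?g b) + ev (?m (x b) ?u)" by (rule eva)
      then show ?thesis using e1(2)[OF g[OF that]] that by (simp add: evm yp y0)
    qed
    then have k2: "e1 X = 0" if "X \<in> (\<lambda>b. ?q (?g b)) ` carrier B1" for X using that by blast
    obtain e2 where e2: "e2 \<in> ring_hom ?F field_ring" "\<And>r. r \<in> carrier ?Q \<Longrightarrow> e2 (?J +>\<^bsub>?Q\<^esub> r) = e1 r"
      using quotient_ring_hom[OF Q.cring_axioms G2 e1(1) k2] unfolding fiber_algebra_def fiber_ideal_def by blast
    have e3: "e2 (?c p) = ev p" if "p \<in> B.alg_carrier" for p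
      using e2(2)[of "?q p"] e1(2)[OF that] ring_hom_closed[OF q, of p] that by (simp add: fiber_class_def cR)
    define \<phi> where "\<phi> = restrict e2 (carrier ?F)"
    have cc: "?c p \<in> carrier ?F" if "p \<in> B.alg_carrier" for p using ring_hom_closed[OF c, of p] that cR by auto
    have p3: "\<phi> (?c p) = ev p" if "p \<in> B.alg_carrier" for p using e3 cc that by (simp add: \<phi>_def)
    have "\<phi> \<in> ring_hom ?F field_ring"
      using e2(1) by (auto simp: \<phi>_def ring_hom_def)
    then have "\<phi> \<in> H" by (simp add: H_def p3 B.alg_carrier_mon evm y0) (simp add: \<phi>_def)
    moreover have "?T \<phi> = y"
      by (rule extensionalityI[of _ "carrier B2"]) (auto simp: ye p3 B.alg_carrier_mon evm)
    ultimately show ?thesis by blast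
  qed
  show ?thesis unfolding bij_betw_def H_def[symmetric]
  proof (intro conjI inj subset_antisym subsetI)
    fix y assume "y \<in> ?T ` H"
    then show "y \<in> hom_fiber B1 B2 ring_band f x" using T1 by blast
  next
    fix y assume "y \<in> hom_fiber B1 B2 ring_band f x"
    then obtain \<phi> where "\<phi> \<in> H" "?T \<phi> = y" using surj by blast
    then show "y \<in> ?T ` H" by blast
  qed
qed

end

theory Submission
  imports Defs "HOL-Library.Function_Algebras"
begin

text \<open>
  Let \<open>\<pp>\<^sub>0 \<subset> \<dots> \<subset> \<pp>\<^sub>d\<close> be primes of the coordinate ring of the fiber over a field \<open>K\<close>. Modulo \<open>\<pp>\<^sub>0\<close>
  some \<open>e \<ge> d\<close> of the generators form a transcendence basis, and \<open>v\<close> extends to valuations \<open>w\<^sub>r\<close> that are the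
  Gauss norm with weights \<open>r \<in> (0,\<infinity>)\<^sup>e\<close> on the polynomials in these generators. Every \<open>w\<^sub>r\<close> is a point of
  the tropical fiber. Any further generator satisfies an algebraic equation, so that \<open>w\<^sub>r\<close> of it lies in a finite
  set of continuous functions of \<open>r\<close>. As the tropical fiber is closed, one choice of these
  functions gives a section of a coordinate projection over a whole \<open>e\<close>-dimensional box, and Lebesgue's covering
  theorem bounds the covering dimension from below.

  For matroids, an infinite fiber over a field has a generic point, at which some
  coordinate of a rescaling normal form is transcendental. The valuations \<open>w\<^sub>r\<close> that extend the trivial valuation
  then turn it into infinitely many rescaling classes of valuated matroids in one tropical fiber.
\<close>

text \<open>All fields are replaced by one commutative ring with a prime \<open>P\<close>: a
  valuation of the fraction field of a subring modulo \<open>P\<close> is a real function on the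
  subring that vanishes exactly on \<open>P\<close>, and algebraic or transcendental is meant modulo
  \<open>P\<close>. No quotient and no fraction field is formed for this, and every tower of
  extensions stays inside one type. The obstacle is to extend a valuation along an algebraic element
  with values that remain real, since Chevalley's theorem controls only the valuation ring and not
  the value group. Instead, as in Berkovich's proof that spectra of normed rings are nonempty,
  Zorn's lemma gives a minimal seminorm below a suitable norm, and minimality forces it to be
  multiplicative. The same theorem gives the prime behind the generic point, as the kernel of such a
  seminorm. Extensions obtained in this way are chosen separately for every \<open>r\<close> and
  need not depend continuously on it. What is continuous is the finite list of candidates for the
  value of a generator, read off from its equation like the slopes of a Newton polygon. The
  consistent choice is therefore made afterwards, by a finite closed cover of a box.\<close>

locale prime_kernel =
  fixes P :: "'r::comm_ring_1 set"
  assumes zero_P: "0 \<in> P"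
    and add_P: "a \<in> P \<Longrightarrow> b \<in> P \<Longrightarrow> a + b \<in> P"
    and mult_P: "b \<in> P \<Longrightarrow> a * b \<in> P"
    and one_P: "1 \<notin> P"
    and prime_P: "a * b \<in> P \<Longrightarrow> a \<in> P \<or> b \<in> P"
begin

lemma uminus_P: "a \<in> P \<Longrightarrow> - a \<in> P"
  using mult_P[of a "-1"] by simp

lemma diff_P: "a \<in> P \<Longrightarrow> b \<in> P \<Longrightarrow> a - b \<in> P"
  using add_P[of a "- b"] uminus_P by simp

lemma mult_P': "a \<in> P \<Longrightarrow> a * b \<in> P"
  using mult_P[of a b] by (simp add: mult.commute)

lemma sum_P: "(\<And>i. i \<in> I \<Longrightarrow> f i \<in> P) \<Longrightarrow> sum f I \<in> P"
  by (induction I rule: infinite_finite_induct) (auto simp: zero_P add_P)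

lemma prime_power: "a ^ n \<in> P \<Longrightarrow> a \<in> P"
  by (induction n) (use one_P prime_P in auto)

lemma diff_P_iff: "a - b \<in> P \<Longrightarrow> a \<in> P \<longleftrightarrow> b \<in> P"
  using add_P[of "a - b" b] diff_P[of a "a - b"] by auto

end

definition subring_set :: "'r::comm_ring_1 set \<Rightarrow> bool" where
  "subring_set U \<longleftrightarrow> 1 \<in> U \<and> (\<forall>a\<in>U. \<forall>b\<in>U. a - b \<in> U \<and> a * b \<in> U)"

lemma subring_setD:
  assumes "subring_set U"
  shows "1 \<in> U" "0 \<in> U" "a \<in> U \<Longrightarrow> b \<in> U \<Longrightarrow> a - b \<in> U" "a \<in> U \<Longrightarrow> b \<in> U \<Longrightarrow> a * b \<in> U"
    "a \<in> U \<Longrightarrow> - a \<in> U" "a \<in> U \<Longrightarrow> b \<in> U \<Longrightarrow> a + b \<in> U" "a \<in> U \<Longrightarrow> a ^ n \<in> U"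
proof -
  show 1: "1 \<in> U" and d: "\<And>a b. a \<in> U \<Longrightarrow> b \<in> U \<Longrightarrow> a - b \<in> U"
    and m: "\<And>a b. a \<in> U \<Longrightarrow> b \<in> U \<Longrightarrow> a * b \<in> U"
    using assms by (auto simp: subring_set_def)
  show 0: "0 \<in> U" using d[OF 1 1] by simp
  show n: "\<And>a. a \<in> U \<Longrightarrow> - a \<in> U" using d[OF 0] by simp
  show "\<And>a b. a \<in> U \<Longrightarrow> b \<in> U \<Longrightarrow> a + b \<in> U" using d n by (metis diff_minus_eq_add)
  show "\<And>a. a \<in> U \<Longrightarrow> a ^ n \<in> U" by (induction n) (auto simp: 1 m)
qed

lemma subring_set_sum: "subring_set U \<Longrightarrow> (\<And>i. i \<in> I \<Longrightarrow> f i \<in> U) \<Longrightarrow> sum f I \<in> U"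
  by (induction I rule: infinite_finite_induct) (auto simp: subring_setD)

lemma le_mult_approx:
  fixes a b c :: real
  assumes "\<And>x. 0 < x \<Longrightarrow> c \<le> (a + x) * (b + x)"
  shows "c \<le> a * b"
proof (rule tendsto_lowerbound)
  show "((\<lambda>x. (a + x) * (b + x)) \<longlongrightarrow> a * b) (at_right 0)"
    by (auto intro!: tendsto_eq_intros)
  show "\<forall>\<^sub>F x in at_right 0. c \<le> (a + x) * (b + x)"
    using eventually_at_right_less[of 0] by eventually_elim (rule assms)
qed simp

subsection \<open>Multiplicative seminorms below a given one\<close>

text \<open>\<open>N\<close> is the bound from above and \<open>M\<close> a set on which a seminorm
  below \<open>N\<close> may not drop; it keeps the minimal seminorm from collapsing. For algebraic
  extensions \<open>M\<close> is \<open>U - P\<close> for the base ring \<open>U\<close>; for the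
  generic prime it is the set of sequences with finitely many zeros.\<close>

locale seminorm_below =
  fixes U M :: "'r::comm_ring_1 set" and N :: "'r \<Rightarrow> real"
  assumes subring: "subring_set U"
    and M_sub: "M \<subseteq> U"
    and N_one: "N 1 = 1"
    and N_M: "m \<in> M \<Longrightarrow> a \<in> U \<Longrightarrow> N (m * a) = N m * N a"
begin

text \<open>The value 0 outside \<open>U\<close> is a convention that turns comparison on
  \<open>U\<close> into the pointwise order of functions, so that a minimal element satisfies
  equations between functions.\<close>

definition seminorm :: "('r \<Rightarrow> real) \<Rightarrow> bool" where
  "seminorm w \<longleftrightarrow> (\<forall>a. 0 \<le> w a) \<and> (\<forall>a. a \<notin> U \<longrightarrow> w a = 0) \<and> w 0 = 0 \<and> w 1 = 1 \<and>
     (\<forall>a\<in>U. \<forall>b\<in>U. w (a * b) \<le> w a * w b \<and> w (a + b) \<le> max (w a) (w b)) \<and>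
     (\<forall>m\<in>M. w m = N m) \<and> (\<forall>m\<in>M. \<forall>a\<in>U. w (m * a) = N m * w a)"

lemma seminormD:
  assumes "seminorm w"
  shows "0 \<le> w a" "a \<notin> U \<Longrightarrow> w a = 0" "w 0 = 0" "w 1 = 1"
    "a \<in> U \<Longrightarrow> b \<in> U \<Longrightarrow> w (a * b) \<le> w a * w b"
    "a \<in> U \<Longrightarrow> b \<in> U \<Longrightarrow> w (a + b) \<le> max (w a) (w b)"
    "m \<in> M \<Longrightarrow> w m = N m" "m \<in> M \<Longrightarrow> a \<in> U \<Longrightarrow> w (m * a) = N m * w a"
  using assms unfolding seminorm_def by auto

lemmas U = subring_setD[OF subring]

lemma seminorm_power:
  assumes "seminorm w" "a \<in> U" shows "w (a ^ n) \<le> w a ^ n"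
proof (induction n)
  case (Suc n)
  have "w (a * a ^ n) \<le> w a * w (a ^ n)" using seminormD(5)[OF assms(1,2) U(7)[OF assms(2)]] .
  also have "\<dots> \<le> w a * w a ^ n" using Suc seminormD(1)[OF assms(1)] by (intro mult_left_mono) auto
  finally show ?case by simp
qed (simp add: seminormD[OF assms(1)])

lemma seminorm_sum:
  assumes "seminorm w" "finite I" "\<And>i. i \<in> I \<Longrightarrow> f i \<in> U" "\<And>i. i \<in> I \<Longrightarrow> w (f i) \<le> B" "0 \<le> B"
  shows "w (sum f I) \<le> B"
  using assms(2-5)
proof (induction I rule: finite_induct)
  case (insert i I)
  have "sum f I \<in> U" using insert by (intro subring_set_sum[OF subring]) auto
  then have "w (f i + sum f I) \<le> max (w (f i)) (w (sum f I))"
    using insert by (intro seminormD(6)[OF assms(1)]) auto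
  also have "\<dots> \<le> B" using insert by simp
  finally show ?case using insert by simp
qed (simp add: seminormD[OF assms(1)])

text \<open>Iterates the ultrametric inequality; it makes binomial coefficients harmless in every
  characteristic.\<close>

lemma seminorm_of_nat:
  assumes "seminorm w" "a \<in> U" shows "w (of_nat n * a) \<le> w a"
proof -
  have "w (\<Sum>i<n. a) \<le> w a" using assms seminormD(1)[OF assms(1)] by (intro seminorm_sum[OF assms(1)]) auto
  then show ?thesis by simp
qed

text \<open>Division of the exponent by \<open>n\<close> with remainder: the quotient contributes
  powers of \<open>w (a ^ n)\<close>, and \<open>C\<close> absorbs the finitely many
  remainders.\<close>

lemma power_bound:
  assumes w: "seminorm w" and a: "a \<in> U" and n: "0 < n" and \<rho>: "0 < \<rho>" and le: "w (a ^ n) \<le> \<rho> ^ n"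
  shows "\<exists>C>0. \<forall>i. w (a ^ i) \<le> C * \<rho> ^ i"
proof -
  define C where "C = Max ((\<lambda>u. w (a ^ u) / \<rho> ^ u) ` {..<n}) + 1"
  have C: "w (a ^ u) \<le> C * \<rho> ^ u" if "u < n" for u
  proof -
    have "w (a ^ u) / \<rho> ^ u \<le> Max ((\<lambda>u. w (a ^ u) / \<rho> ^ u) ` {..<n})" using that by (intro Max_ge) auto
    then have "w (a ^ u) / \<rho> ^ u \<le> C" by (simp add: C_def)
    then show ?thesis using \<rho> by (simp add: divide_simps)
  qed
  have "0 \<le> w (a ^ 0) / \<rho> ^ 0" using seminormD(4)[OF w] by simp
  also have "\<dots> \<le> Max ((\<lambda>u. w (a ^ u) / \<rho> ^ u) ` {..<n})" using n by (intro Max_ge finite_imageI finite_lessThan imageI) simp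
  finally have Cp: "C > 0" by (simp add: C_def)
  have "w (a ^ i) \<le> C * \<rho> ^ i" for i
  proof -
    have i: "i = n * (i div n) + i mod n" by simp
    have "w (a ^ i) = w ((a ^ n) ^ (i div n) * a ^ (i mod n))"
      by (subst i) (simp only: power_add power_mult)
    also have "\<dots> \<le> w ((a ^ n) ^ (i div n)) * w (a ^ (i mod n))"
      using a by (intro seminormD(5)[OF w]) (auto intro: U)
    also have "\<dots> \<le> (\<rho> ^ n) ^ (i div n) * (C * \<rho> ^ (i mod n))"
    proof (intro mult_mono C)
      have "w ((a ^ n) ^ (i div n)) \<le> w (a ^ n) ^ (i div n)" using a by (intro seminorm_power[OF w]) (auto intro: U)
      also have "\<dots> \<le> (\<rho> ^ n) ^ (i div n)" using le seminormD(1)[OF w] by (intro power_mono) auto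
      finally show "w ((a ^ n) ^ (i div n)) \<le> (\<rho> ^ n) ^ (i div n)" .
    qed (use n \<rho> seminormD(1)[OF w] in auto)
    also have "\<dots> = C * (\<rho> ^ (n * (i div n) + i mod n))" by (simp only: power_add power_mult) simp
    finally show ?thesis by simp
  qed
  then show ?thesis using Cp by blast
qed

text \<open>Gelfand's spectral radius. The infimum replaces the limit, so that nothing has to
  converge. A minimal seminorm equals its spectral seminorm and is therefore multiplicative on
  powers of one element.\<close>

definition spectral :: "('r \<Rightarrow> real) \<Rightarrow> 'r \<Rightarrow> real" where
  "spectral w a = (if a \<in> U then (INF n\<in>{0<..}. root n (w (a ^ n))) else 0)"

text \<open>The delicate point is the ultrametric inequality. For \<open>\<rho>\<close> above both
  spectral values, the powers of \<open>a\<close> and of \<open>b\<close> are bounded by constants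
  times powers of \<open>\<rho>\<close>, hence so is every binomial term of
  \<open>(a + b) ^ n\<close>, and the \<open>n\<close>-th root removes the constants in the
  limit.\<close>

lemma spectral_props:
  assumes w: "seminorm w"
  shows "seminorm (spectral w)" and "spectral w a \<le> w a" and "a \<in> U \<Longrightarrow> 0 < n \<Longrightarrow> spectral w a ^ n \<le> w (a ^ n)"
proof -
  let ?f = "\<lambda>a n. root n (w (a ^ n))"
  note D = seminormD[OF w]
  have bdd: "bdd_below (?f a ` {0<..})" for a
    by (rule bdd_belowI[of _ 0]) (auto simp: D real_root_ge_zero)
  have ne: "{0<..} \<noteq> ({}::nat set)" by (simp add: greaterThan_def) (metis zero_less_one)
  have low: "spectral w a \<le> ?f a n" if "0 < n" "a \<in> U" for a n
    using that bdd by (auto simp: spectral_def intro: cINF_lower)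
  have great: "x \<le> spectral w a" if "a \<in> U" "\<And>n. 0 < n \<Longrightarrow> x \<le> ?f a n" for a x
    using that ne by (auto simp: spectral_def intro!: cINF_greatest)
  have nn: "0 \<le> spectral w a" for a
  proof (cases "a \<in> U")
    case True
    then show ?thesis by (rule great) (simp add: D real_root_ge_zero)
  qed (simp add: spectral_def)
  show pw: "spectral w a ^ n \<le> w (a ^ n)" if "a \<in> U" "0 < n" for a n
  proof -
    have "spectral w a ^ n \<le> ?f a n ^ n" using low[OF that(2,1)] nn by (intro power_mono) auto
    then show ?thesis using that D(1) by simp
  qed
  show le: "spectral w a \<le> w a" for a
    using pw[of a 1] D(1)[of a] by (cases "a \<in> U") (auto simp: spectral_def)
  have approx: "\<exists>n>0. ?f a n < x" if "a \<in> U" "spectral w a < x" for a x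
    using great[OF that(1), of x] that(2) by force
  have 0: "spectral w 0 = 0" using le[of 0] nn[of 0] D by simp
  have mult: "spectral w (a * b) \<le> spectral w a * spectral w b" if ab: "a \<in> U" "b \<in> U" for a b
  proof (rule le_mult_approx)
    fix x :: real assume x: "0 < x"
    obtain n where n: "n > 0" "?f a n < spectral w a + x" using approx[OF ab(1)] x by (metis less_add_same_cancel1)
    obtain k where k: "k > 0" "?f b k < spectral w b + x" using approx[OF ab(2)] x by (metis less_add_same_cancel1)
    \<comment> \<open>Nearly optimal exponents \<open>n\<close> for \<open>a\<close> and
      \<open>k\<close> for \<open>b\<close> are brought to the common exponent
      \<open>n * k\<close>.\<close>
    have "w ((a * b) ^ (n * k)) = w ((a ^ n) ^ k * (b ^ k) ^ n)"
      by (simp add: power_mult_distrib power_mult[symmetric] mult.commute)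
    also have "\<dots> \<le> w ((a ^ n) ^ k) * w ((b ^ k) ^ n)" using ab by (intro D) (auto intro: U)
    also have "\<dots> \<le> w (a ^ n) ^ k * w (b ^ k) ^ n"
      using ab D by (intro mult_mono seminorm_power[OF w]) (auto intro: U)
    also have "\<dots> = (?f a n ^ n) ^ k * (?f b k ^ k) ^ n" using n k D by simp
    also have "\<dots> = (?f a n * ?f b k) ^ (n * k)"
      by (simp add: power_mult_distrib power_mult[symmetric] mult.commute)
    finally have "spectral w (a * b) ^ (n * k) \<le> (?f a n * ?f b k) ^ (n * k)"
      using pw[of "a * b" "n * k"] ab n k by (auto simp: U)
    then have "spectral w (a * b) \<le> ?f a n * ?f b k"
      using n k D real_root_ge_zero by (subst (asm) power_mono_iff) (auto simp: nn)
    also have "\<dots> \<le> (spectral w a + x) * (spectral w b + x)"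
      using n k D real_root_ge_zero nn x by (intro mult_mono add_nonneg_nonneg) (auto intro: less_imp_le)
    finally show "spectral w (a * b) \<le> (spectral w a + x) * (spectral w b + x)" .
  qed
  have nonarch: "spectral w (a + b) \<le> max (spectral w a) (spectral w b)" if ab: "a \<in> U" "b \<in> U" for a b
  proof (rule dense_ge)
    fix \<rho> assume \<rho>: "max (spectral w a) (spectral w b) < \<rho>"
    then have \<rho>0: "0 < \<rho>" using nn[of a] by (auto simp: max_def split: if_splits)
    have bd: "\<exists>C>0. \<forall>i. w (c ^ i) \<le> C * \<rho> ^ i" if c: "c \<in> U" "spectral w c < \<rho>" for c
    proof -
      obtain n where n: "n > 0" "?f c n < \<rho>" using approx[OF c] by auto
      have "w (c ^ n) = ?f c n ^ n" using n D by simp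
      also have "\<dots> \<le> \<rho> ^ n" using n D real_root_ge_zero by (intro power_mono) auto
      finally show ?thesis by (intro power_bound[OF w c(1) n(1) \<rho>0])
    qed
    obtain A where A: "A > 0" "\<And>i. w (a ^ i) \<le> A * \<rho> ^ i" using bd[OF ab(1)] \<rho> by auto
    obtain B where B: "B > 0" "\<And>i. w (b ^ i) \<le> B * \<rho> ^ i" using bd[OF ab(2)] \<rho> by auto
    have bound: "w ((a + b) ^ n) \<le> A * B * \<rho> ^ n" for n
      unfolding binomial_ring
    proof (rule seminorm_sum[OF w])
      fix i assume i: "i \<in> {..n}"
      have "w (of_nat (n choose i) * a ^ i * b ^ (n - i)) \<le> w (a ^ i * b ^ (n - i))"
        unfolding mult.assoc using ab by (intro seminorm_of_nat[OF w]) (auto intro!: U)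
      also have "\<dots> \<le> w (a ^ i) * w (b ^ (n - i))" using ab by (intro D) (auto intro!: U)
      also have "\<dots> \<le> (A * \<rho> ^ i) * (B * \<rho> ^ (n - i))"
        using A B D \<rho>0 by (intro mult_mono) auto
      also have "\<dots> = A * B * (\<rho> ^ i * \<rho> ^ (n - i))" by simp
      also have "\<rho> ^ i * \<rho> ^ (n - i) = \<rho> ^ n" using i by (simp add: power_add[symmetric])
      finally show "w (of_nat (n choose i) * a ^ i * b ^ (n - i)) \<le> A * B * \<rho> ^ n" .
    next
      fix i assume i: "i \<in> {..n}"
      have "of_nat (n choose i) \<in> U" for i by (induction "n choose i" ) (auto simp: U intro: subring_set_sum[OF subring, of "{..<n choose i}" "\<lambda>_. 1", simplified])
      then show "of_nat (n choose i) * a ^ i * b ^ (n - i) \<in> U" using ab by (auto intro!: U)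
    qed (use A B \<rho>0 in auto)
    have ev: "spectral w (a + b) \<le> root n (A * B) * \<rho>" if "0 < n" for n
    proof -
      have "spectral w (a + b) \<le> ?f (a + b) n" using low that ab U by simp
      also have "\<dots> \<le> root n (A * B * \<rho> ^ n)" using bound that by simp
      also have "\<dots> = root n (A * B) * \<rho>" using that \<rho>0 by (simp add: real_root_mult real_root_power_cancel)
      finally show ?thesis .
    qed
    have "(\<lambda>n. root n (A * B) * \<rho>) \<longlonglongrightarrow> 1 * \<rho>"
      using A B by (intro tendsto_mult LIMSEQ_root_const tendsto_const) auto
    then have "spectral w (a + b) \<le> 1 * \<rho>"
      by (rule LIMSEQ_le_const) (use ev in \<open>auto intro!: exI[of _ 1]\<close>)
    then show "spectral w (a + b) \<le> \<rho>" by simp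
  qed
  have Mp: "w (m ^ n * a) = N m ^ n * w a" if "m \<in> M" "a \<in> U" for m a n
    using that
  proof (induction n)
    case (Suc n)
    have "w (m * (m ^ n * a)) = N m * w (m ^ n * a)" using that M_sub by (intro D) (auto intro!: U)
    then show ?case using Suc by (simp add: mult.assoc)
  qed simp
  have Nnn: "0 \<le> N m" if "m \<in> M" for m using D(1)[of m] D(7)[OF that] by simp
  have Mm: "spectral w (m * a) = N m * spectral w a" if m: "m \<in> M" and a: "a \<in> U" for m a
  proof -
    have mU: "m \<in> U" using m M_sub by auto
    have f: "?f (m * a) n = N m * ?f a n" if "0 < n" for n
      using that Mp[OF m, of "a ^ n" n] a Nnn[OF m] U
      by (simp add: power_mult_distrib real_root_mult real_root_power_cancel)
    show ?thesis
    proof (rule antisym)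
      show "spectral w (m * a) \<le> N m * spectral w a"
      proof (cases "N m = 0")
        case True
        then show ?thesis using low[of 1 "m * a"] f[of 1] mU a by (auto simp: U)
      next
        case False
        then have Np: "0 < N m" using Nnn[OF m] by simp
        have "spectral w (m * a) / N m \<le> spectral w a"
          using low[of _ "m * a"] f mU a Np by (intro great) (auto simp: U divide_simps mult.commute)
        then show ?thesis using Np by (simp add: divide_simps mult.commute)
      qed
      show "N m * spectral w a \<le> spectral w (m * a)"
        using mU a Nnn[OF m] by (intro great) (auto simp: U f intro!: mult_left_mono low)
    qed
  qed
  have 1: "spectral w 1 = 1"
  proof (rule antisym)
    show "spectral w 1 \<le> 1" using low[of 1 1] D by (simp add: U)
    show "1 \<le> spectral w 1" using D by (intro great) (auto simp: U)
  qed
  have Me: "spectral w m = N m" if "m \<in> M" for m using Mm[OF that, of 1] 1 by (simp add: U)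
  show "seminorm (spectral w)"
    unfolding seminorm_def using nn 0 1 mult nonarch Me Mm by (auto simp: spectral_def)
qed

text \<open>The lower bound that Zorn's lemma asks for. Since \<open>C\<close> is a chain, two
  infima can be approximated by one and the same member (\<open>approx2\<close>), which carries the
  inequalities for products and sums over to the infimum.\<close>

lemma seminorm_Inf:
  assumes C: "\<And>w. w \<in> C \<Longrightarrow> seminorm w" and ne: "C \<noteq> {}"
    and chain: "\<And>w w'. w \<in> C \<Longrightarrow> w' \<in> C \<Longrightarrow> w \<le> w' \<or> w' \<le> w"
  shows "seminorm (\<lambda>a. INF w\<in>C. w a)"
proof -
  let ?w = "\<lambda>a. INF w\<in>C. w a"
  note D = seminormD[OF C]
  have bdd: "bdd_below ((\<lambda>w. w a) ` C)" for a
    by (rule bdd_belowI[of _ 0]) (auto simp: D)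
  have low: "?w a \<le> w a" if "w \<in> C" for w a using that bdd by (intro cINF_lower) auto
  have great: "x \<le> ?w a" if "\<And>w. w \<in> C \<Longrightarrow> x \<le> w a" for x a using that ne by (intro cINF_greatest)
  have const: "?w a = x" if "\<And>w. w \<in> C \<Longrightarrow> w a = x" for a x
  proof -
    have "(\<lambda>w. w a) ` C = (\<lambda>w. x) ` C" by (rule image_cong) (use that in auto)
    then show ?thesis using ne by simp
  qed
  have nn: "0 \<le> ?w a" for a by (rule great) (simp add: D)
  have approx: "\<exists>w\<in>C. w a < x" if "?w a < x" for a x
    using great[of x a] that by force
  have approx2: "\<exists>w\<in>C. w a < x \<and> w b < y" if "?w a < x" "?w b < y" for a b x y
  proof -
    obtain w1 where w1: "w1 \<in> C" "w1 a < x" using approx[OF \<open>?w a < x\<close>] by blast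
    obtain w2 where w2: "w2 \<in> C" "w2 b < y" using approx[OF \<open>?w b < y\<close>] by blast
    note w = w1 w2
    from chain[OF w(1,3)] show ?thesis
    proof
      assume "w1 \<le> w2"
      then have "w1 b \<le> w2 b" by (rule le_funD)
      then show ?thesis using w by (intro bexI[of _ w1]) auto
    next
      assume "w2 \<le> w1"
      then have "w2 a \<le> w1 a" by (rule le_funD)
      then show ?thesis using w by (intro bexI[of _ w2]) auto
    qed
  qed
  have mult: "?w (a * b) \<le> ?w a * ?w b" if ab: "a \<in> U" "b \<in> U" for a b
  proof (rule le_mult_approx)
    fix x :: real assume x: "0 < x"
    obtain w where w: "w \<in> C" "w a < ?w a + x" "w b < ?w b + x"
      using approx2[of a "?w a + x" b "?w b + x"] x by auto
    have "?w (a * b) \<le> w (a * b)" by (rule low[OF w(1)])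
    also have "\<dots> \<le> w a * w b" by (rule D(5)[OF w(1) ab])
    also have "\<dots> \<le> (?w a + x) * (?w b + x)"
      using w D x nn by (intro mult_mono) (auto intro: add_nonneg_nonneg less_imp_le)
    finally show "?w (a * b) \<le> (?w a + x) * (?w b + x)" .
  qed
  have nonarch: "?w (a + b) \<le> max (?w a) (?w b)" if ab: "a \<in> U" "b \<in> U" for a b
  proof (rule dense_ge)
    fix \<rho> assume "max (?w a) (?w b) < \<rho>"
    then obtain w where w: "w \<in> C" "w a < \<rho>" "w b < \<rho>" using approx2[of a \<rho> b \<rho>] by auto
    have "?w (a + b) \<le> w (a + b)" by (rule low[OF w(1)])
    also have "\<dots> \<le> max (w a) (w b)" by (rule D(6)[OF w(1) ab])
    finally show "?w (a + b) \<le> \<rho>" using w by simp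
  qed
  have Mm: "?w (m * a) = N m * ?w a" if m: "m \<in> M" and a: "a \<in> U" for m a
  proof (rule antisym)
    obtain w0 where "w0 \<in> C" using ne by auto
    then have Nnn: "0 \<le> N m" using D(7)[OF \<open>w0 \<in> C\<close> m] D(1)[OF \<open>w0 \<in> C\<close>, of m] by simp
    show "N m * ?w a \<le> ?w (m * a)"
    proof (rule great)
      fix w assume w: "w \<in> C"
      show "N m * ?w a \<le> w (m * a)"
        unfolding D(8)[OF w m a] by (rule mult_left_mono[OF low[OF w] Nnn])
    qed
    show "?w (m * a) \<le> N m * ?w a"
    proof (cases "N m = 0")
      case True
      then show ?thesis using low[OF \<open>w0 \<in> C\<close>, of "m * a"] D(8)[OF \<open>w0 \<in> C\<close> m a] by simp
    next
      case False
      have "?w (m * a) / N m \<le> ?w a"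
      proof (rule great)
        fix w assume w: "w \<in> C"
        show "?w (m * a) / N m \<le> w a"
          using low[OF w, of "m * a"] False Nnn unfolding D(8)[OF w m a]
          by (simp add: divide_simps mult.commute)
      qed
      then show ?thesis using False Nnn by (simp add: divide_simps mult.commute)
    qed
  qed
  have "?w a = 0" if "a \<notin> U" for a by (rule const) (rule D(2)[OF _ that])
  moreover have "?w 0 = 0" by (rule const) (rule D(3))
  moreover have "?w 1 = 1" by (rule const) (rule D(4))
  moreover have "?w m = N m" if "m \<in> M" for m by (rule const) (rule D(7)[OF _ that])
  ultimately show ?thesis
    unfolding seminorm_def using nn mult nonarch Mm by blast
qed

text \<open>
  For a seminorm \<open>w\<close> with \<open>w (b\<^sup>n) = (w b)\<^sup>n\<close>, the limit of \<open>w (a b\<^sup>n) / (w b)\<^sup>n\<close> is a seminorm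
  below \<open>w\<close> for which multiplication by \<open>b\<close> is homogeneous.
\<close>

lemma seminorm_homogenize:
  assumes w: "seminorm w" and b: "b \<in> U" "w b \<noteq> 0" and pow: "\<And>n. w (b ^ n) = w b ^ n"
  shows "\<exists>w'. seminorm w' \<and> (\<forall>a. w' a \<le> w a) \<and> (\<forall>a\<in>U. w' (a * b) = w' a * w b)"
proof -
  note D = seminormD[OF w]
  have bp: "0 < w b" using D(1)[of b] b by simp
  define f where "f a n = w (a * b ^ n) / w b ^ n" for a n
  have bn: "b ^ n \<in> U" for n using b U by simp
  have fnn: "0 \<le> f a n" for a n using D by (simp add: f_def)
  have dec: "f a (Suc n) \<le> f a n" if "a \<in> U" for a n
  proof -
    have "w (a * b ^ n * b) \<le> w (a * b ^ n) * w b" using that b bn U by (intro D) auto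
    then show ?thesis using bp by (simp add: f_def field_simps mult.assoc)
  qed
  define w' where "w' a = (if a \<in> U then lim (f a) else 0)" for a
  have conv: "f a \<longlonglongrightarrow> w' a" if a: "a \<in> U" for a
  proof -
    have "convergent (f a)"
    proof -
      have "decseq (f a)" using dec[OF a] by (simp add: decseq_Suc_iff)
      moreover have "\<forall>n. 0 \<le> f a n" using fnn by blast
      ultimately obtain L where "f a \<longlonglongrightarrow> L" using decseq_convergent[of "f a" 0] by blast
      then show ?thesis by (rule convergentI)
    qed
    then show ?thesis using a by (simp add: w'_def convergent_LIMSEQ_iff)
  qed
  have nn: "0 \<le> w' a" for a
  proof (cases "a \<in> U")
    case True
    then show ?thesis by (rule LIMSEQ_le_const[OF conv]) (simp add: fnn)
  qed (simp add: w'_def)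
  have le: "w' a \<le> w a" for a
  proof (cases "a \<in> U")
    case True
    have "w' a \<le> f a 0" by (rule decseq_ge[OF _ conv[OF True]]) (simp add: decseq_Suc_iff dec[OF True])
    then show ?thesis by (simp add: f_def)
  qed (simp add: w'_def D)
  have 0: "w' 0 = 0" using le[of 0] nn[of 0] D by simp
  have one: "w' 1 = 1"
    by (rule LIMSEQ_unique[OF conv]) (use bp in \<open>auto simp: U f_def[abs_def] pow\<close>)
  have hom: "w' (a * b) = w' a * w b" if a: "a \<in> U" for a
  proof (rule LIMSEQ_unique[OF conv])
    have "f (a * b) = (\<lambda>n. f a (Suc n) * w b)"
      using bp by (simp add: f_def mult.assoc fun_eq_iff)
    then show "f (a * b) \<longlonglongrightarrow> w' a * w b"
      using tendsto_mult_right[OF LIMSEQ_Suc[OF conv[OF a]], of "w b"] by (simp only:)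
  qed (use a b U in auto)
  have mult: "w' (a * c) \<le> w' a * w' c" if ac: "a \<in> U" "c \<in> U" for a c
  proof (rule LIMSEQ_le)
    \<comment> \<open>Even exponents let \<open>b ^ (2 * n)\<close> be shared equally by the two
      factors \<open>a\<close> and \<open>c\<close>.\<close>
    have "strict_mono (\<lambda>n::nat. 2 * n)" by (simp add: strict_mono_def)
    then show "(\<lambda>n. f (a * c) (2 * n)) \<longlonglongrightarrow> w' (a * c)"
      using LIMSEQ_subseq_LIMSEQ[OF conv] ac U by (auto simp: o_def)
    show "(\<lambda>n. f a n * f c n) \<longlonglongrightarrow> w' a * w' c" using conv ac by (intro tendsto_mult) auto
    have "f (a * c) (2 * n) \<le> f a n * f c n" for n
    proof -
      have "b ^ (2 * n) = b ^ n * b ^ n" by (simp only: mult_2 power_add)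
      then have e: "a * c * b ^ (2 * n) = (a * b ^ n) * (c * b ^ n)" by (simp add: mult_ac)
      have "w (a * c * b ^ (2 * n)) \<le> w (a * b ^ n) * w (c * b ^ n)"
        unfolding e using ac bn U by (intro D) auto
      then show ?thesis using bp by (simp add: f_def mult_2 power_add divide_right_mono)
    qed
    then show "\<exists>N. \<forall>n\<ge>N. f (a * c) (2 * n) \<le> f a n * f c n" by blast
  qed
  have nonarch: "w' (a + c) \<le> max (w' a) (w' c)" if ac: "a \<in> U" "c \<in> U" for a c
  proof (rule LIMSEQ_le)
    show "f (a + c) \<longlonglongrightarrow> w' (a + c)" using conv ac U by auto
    show "(\<lambda>n. max (f a n) (f c n)) \<longlonglongrightarrow> max (w' a) (w' c)" using conv ac by (intro tendsto_max) auto
    have "f (a + c) n \<le> max (f a n) (f c n)" for n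
    proof -
      have "w (a * b ^ n + c * b ^ n) \<le> max (w (a * b ^ n)) (w (c * b ^ n))"
        using ac bn U by (intro D) auto
      then show ?thesis using bp by (auto simp: f_def distrib_right max_def divide_simps split: if_splits)
    qed
    then show "\<exists>N. \<forall>n\<ge>N. f (a + c) n \<le> max (f a n) (f c n)" by blast
  qed
  have Mm: "w' (m * a) = N m * w' a" if m: "m \<in> M" and a: "a \<in> U" for m a
  proof (rule LIMSEQ_unique[OF conv])
    have "f (m * a) = (\<lambda>n. N m * f a n)"
      using D(8)[OF m, of "a * b ^ n" for n] a bn U by (simp add: f_def mult.assoc fun_eq_iff)
    then show "f (m * a) \<longlonglongrightarrow> N m * w' a"
      using tendsto_mult_left[OF conv[OF a], of "N m"] by (simp only:)
  qed (use m a M_sub U in auto)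
  have Me: "w' m = N m" if "m \<in> M" for m using Mm[OF that, of 1] one by (simp add: U)
  have "seminorm w'"
    unfolding seminorm_def using nn 0 one mult nonarch Me Mm by (auto simp: w'_def)
  then show ?thesis using le hom by blast
qed

text \<open>A seminorm that is minimal below \<open>N\<close> coincides with its spectral seminorm,
  so it respects powers, and then with its homogenization at any \<open>b\<close> with
  \<open>w b \<noteq> 0\<close>, so it respects multiplication by \<open>b\<close>. If
  \<open>w b = 0\<close>, submultiplicativity is enough.\<close>

theorem multiplicative_below:
  assumes N0: "N 0 = 0" and Nn: "\<And>a. a \<in> U \<Longrightarrow> 0 \<le> N a"
    and Nm: "\<And>a b. a \<in> U \<Longrightarrow> b \<in> U \<Longrightarrow> N (a * b) \<le> N a * N b"
    and Na: "\<And>a b. a \<in> U \<Longrightarrow> b \<in> U \<Longrightarrow> N (a + b) \<le> max (N a) (N b)"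
  shows "\<exists>w. (\<forall>a\<in>U. 0 \<le> w a \<and> w a \<le> N a) \<and> w 1 = 1 \<and> (\<forall>m\<in>M. w m = N m) \<and>
    (\<forall>a\<in>U. \<forall>b\<in>U. w (a * b) = w a * w b \<and> w (a + b) \<le> max (w a) (w b))"
proof -
  define N' where "N' a = (if a \<in> U then N a else 0)" for a
  have MU: "m \<in> U" if "m \<in> M" for m using that M_sub by auto
  have N': "seminorm N'"
    unfolding seminorm_def N'_def using Nn Nm Na N0 N_one N_M MU U by (auto simp: subset_iff)
  define A where "A = {w. seminorm w \<and> w \<le> N'}"
  have "\<exists>m\<in>A. \<forall>a\<in>A. a \<le> m \<longrightarrow> a = m"
  proof (rule predicate_Zorn)
    show "partial_order_on A (relation_of (\<lambda>x y. y \<le> x) A)"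
      by (auto simp: partial_order_on_def preorder_on_def refl_on_def trans_def antisym_def relation_of_def)
    fix C assume C: "C \<in> Chains (relation_of (\<lambda>x y. y \<le> x) A)"
    then have CA: "C \<subseteq> A" and ch: "\<And>w w'. w \<in> C \<Longrightarrow> w' \<in> C \<Longrightarrow> w \<le> w' \<or> w' \<le> w"
      by (auto simp: Chains_def relation_of_def)
    show "\<exists>u\<in>A. \<forall>a\<in>C. u \<le> a"
    proof (cases "C = {}")
      case True
      then show ?thesis using N' by (auto simp: A_def intro!: exI[of _ N'])
    next
      case False
      let ?w = "\<lambda>a. INF w\<in>C. w a"
      have s: "seminorm ?w" using CA ch False by (intro seminorm_Inf) (auto simp: A_def)
      have "?w a \<le> w a" if "w \<in> C" for w a
        by (intro cINF_lower bdd_belowI[of _ 0]) (use that CA seminormD(1) in \<open>auto simp: A_def\<close>)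
      then have l: "?w \<le> w" if "w \<in> C" for w using that by (auto simp: le_fun_def)
      obtain w0 where "w0 \<in> C" using False by auto
      then have "?w \<le> N'" using l[of w0] CA by (auto simp: A_def intro: order_trans)
      then show ?thesis using s l by (intro bexI[of _ ?w]) (auto simp: A_def)
    qed
  qed
  then obtain w where w: "seminorm w" "w \<le> N'" and min: "\<And>w'. seminorm w' \<Longrightarrow> w' \<le> w \<Longrightarrow> w' = w"
    unfolding A_def by (auto intro: order_trans)
  note D = seminormD[OF w(1)]
  have sp: "spectral w = w" using spectral_props(1,2)[OF w(1)] by (intro min) (auto simp: le_fun_def)
  have pow: "w (b ^ n) = w b ^ n" if "b \<in> U" for b n
  proof (cases "n = 0")
    case False
    then show ?thesis
      using spectral_props(3)[OF w(1) that, of n] seminorm_power[OF w(1) that, of n] by (simp add: sp)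
  qed (simp add: D)
  have mult: "w (a * b) = w a * w b" if "a \<in> U" "b \<in> U" for a b
  proof (cases "w b = 0")
    case True
    then show ?thesis using D(5)[OF that] D(1)[of "a * b"] by simp
  next
    case False
    then obtain w' where w': "seminorm w'" "\<And>a. w' a \<le> w a" "\<And>a. a \<in> U \<Longrightarrow> w' (a * b) = w' a * w b"
      using seminorm_homogenize[OF w(1) \<open>b \<in> U\<close> _ pow[OF \<open>b \<in> U\<close>]] by blast
    then have "w' = w" by (intro min) (auto simp: le_fun_def)
    then show ?thesis using w'(3) that by simp
  qed
  have "w a \<le> N a" if "a \<in> U" for a using w(2) that by (auto simp: le_fun_def N'_def dest!: spec[of _ a])
  then show ?thesis using D mult by (intro exI[of _ w]) auto
qed

end

subsection \<open>Valuations on subrings\<close>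

definition val_on :: "'r::comm_ring_1 set \<Rightarrow> 'r set \<Rightarrow> ('r \<Rightarrow> real) \<Rightarrow> bool" where
  "val_on P U w \<longleftrightarrow> w 1 = 1 \<and> (\<forall>a\<in>U. 0 \<le> w a \<and> (w a = 0 \<longleftrightarrow> a \<in> P)) \<and>
     (\<forall>a\<in>U. \<forall>b\<in>U. w (a * b) = w a * w b \<and> w (a + b) \<le> max (w a) (w b))"

definition poly_over :: "'r::comm_ring_1 set \<Rightarrow> 'r poly set" where
  "poly_over U = {q. \<forall>i. coeff q i \<in> U}"

definition adjoin :: "'r::comm_ring_1 set \<Rightarrow> 'r \<Rightarrow> 'r set" where
  "adjoin U t = (\<lambda>q. poly q t) ` poly_over U"

context prime_kernel begin

definition P_poly where
  "P_poly q \<longleftrightarrow> (\<forall>i. coeff q i \<in> P)"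

text \<open>Transcendence of the class of \<open>t\<close> over the fraction field of
  \<open>U\<close> modulo \<open>P\<close>: clearing denominators leaves polynomials over
  \<open>U\<close>, and a relation is trivial when its coefficients lie in \<open>P\<close>.\<close>

definition transcendental_over where
  "transcendental_over U t \<longleftrightarrow> (\<forall>q\<in>poly_over U. poly q t \<in> P \<longrightarrow> P_poly q)"

end

locale subring_mod = prime_kernel P for P :: "'r::comm_ring_1 set" +
  fixes U :: "'r set"
  assumes subring: "subring_set U"
begin

lemmas U = subring_setD[OF subring]

lemma poly_over_0: "0 \<in> poly_over U" by (simp add: poly_over_def U)
lemma poly_over_1: "1 \<in> poly_over U" by (simp add: poly_over_def U coeff_1)
lemma poly_over_add: "p \<in> poly_over U \<Longrightarrow> q \<in> poly_over U \<Longrightarrow> p + q \<in> poly_over U"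
  by (simp add: poly_over_def U)
lemma poly_over_diff: "p \<in> poly_over U \<Longrightarrow> q \<in> poly_over U \<Longrightarrow> p - q \<in> poly_over U"
  by (simp add: poly_over_def U)
lemma poly_over_smult: "a \<in> U \<Longrightarrow> q \<in> poly_over U \<Longrightarrow> smult a q \<in> poly_over U"
  by (simp add: poly_over_def U)
lemma poly_over_mult: "p \<in> poly_over U \<Longrightarrow> q \<in> poly_over U \<Longrightarrow> p * q \<in> poly_over U"
  by (auto simp: poly_over_def U coeff_mult intro!: subring_set_sum[OF subring])
lemma poly_over_monom: "a \<in> U \<Longrightarrow> monom a n \<in> poly_over U"
  by (simp add: poly_over_def U coeff_monom)
lemma poly_over_const: "a \<in> U \<Longrightarrow> [:a:] \<in> poly_over U"
  using poly_over_monom[of a 0] by (simp add: monom_0)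
lemma poly_over_lead: "q \<in> poly_over U \<Longrightarrow> lead_coeff q \<in> U"
  by (simp add: poly_over_def)

lemma adjoinI: "q \<in> poly_over U \<Longrightarrow> poly q t \<in> adjoin U t" by (auto simp: adjoin_def)

lemma subring_adjoin: "subring_set (adjoin U t)"
  unfolding subring_set_def adjoin_def
proof (intro conjI ballI)
  show "1 \<in> (\<lambda>q. poly q t) ` poly_over U" by (rule image_eqI[OF _ poly_over_1]) simp
  fix a b assume "a \<in> (\<lambda>q. poly q t) ` poly_over U" "b \<in> (\<lambda>q. poly q t) ` poly_over U"
  then obtain p q where pq: "p \<in> poly_over U" "q \<in> poly_over U" "a = poly p t" "b = poly q t" by auto
  show "a - b \<in> (\<lambda>q. poly q t) ` poly_over U" by (rule image_eqI[OF _ poly_over_diff[OF pq(1,2)]]) (simp add: pq)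
  show "a * b \<in> (\<lambda>q. poly q t) ` poly_over U" by (rule image_eqI[OF _ poly_over_mult[OF pq(1,2)]]) (simp add: pq)
qed

lemma adjoin_base: "U \<subseteq> adjoin U t"
proof
  fix a assume "a \<in> U"
  then show "a \<in> adjoin U t" using adjoinI[OF poly_over_const[of a], of t] by simp
qed

lemma adjoin_gen: "t \<in> adjoin U t"
  using adjoinI[of "[:0, 1:]" t] poly_over_monom[of 1 1] U by (simp add: monom_altdef)

lemma P_poly_value: "P_poly q \<Longrightarrow> poly q t \<in> P"
  by (auto simp: P_poly_def poly_altdef intro!: sum_P mult_P')

lemma P_poly_simps:
  "P_poly 0" "P_poly p \<Longrightarrow> P_poly q \<Longrightarrow> P_poly (p + q)" "P_poly p \<Longrightarrow> P_poly q \<Longrightarrow> P_poly (p - q)"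
  by (auto simp: P_poly_def zero_P add_P diff_P)

lemma P_poly_mult: "P_poly p \<Longrightarrow> P_poly (p * q)"
  by (auto simp: P_poly_def coeff_mult intro!: sum_P mult_P')

text \<open>If the leading coefficient of an example of least degree lay in \<open>P\<close>,
  dropping the leading term would give a smaller example. This is how polynomials get a genuine
  degree modulo \<open>P\<close>.\<close>

lemma lead_not_P:
  assumes "Q q" "q \<in> poly_over U" "\<not> P_poly q"
    and closed: "\<And>q. Q q \<Longrightarrow> q \<in> poly_over U \<Longrightarrow> lead_coeff q \<in> P \<Longrightarrow> Q (q - monom (lead_coeff q) (degree q))"
  obtains p where "Q p" "p \<in> poly_over U" "lead_coeff p \<notin> P"
    "\<And>r. Q r \<Longrightarrow> r \<in> poly_over U \<Longrightarrow> degree r < degree p \<Longrightarrow> P_poly r"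
proof -
  let ?A = "\<lambda>q. Q q \<and> q \<in> poly_over U \<and> \<not> P_poly q"
  obtain p where p: "?A p" and min: "\<And>r. ?A r \<Longrightarrow> degree p \<le> degree r"
    using assms(1-3) ex_has_least_nat[of ?A q degree] by blast
  have "lead_coeff p \<notin> P"
  proof
    assume l: "lead_coeff p \<in> P"
    let ?m = "monom (lead_coeff p) (degree p)"
    have P: "P_poly ?m" using l by (simp add: P_poly_def coeff_monom zero_P)
    have "\<not> P_poly (p - ?m)" using p P P_poly_simps(2)[of "p - ?m" ?m] by auto
    moreover have "p - ?m \<in> poly_over U" using p by (intro poly_over_diff poly_over_monom poly_over_lead) auto
    ultimately have A: "?A (p - ?m)" using p closed l by blast
    have "degree p \<noteq> 0"
    proof
      assume "degree p = 0"
      then have "P_poly p" using l by (auto simp: P_poly_def zero_P coeff_eq_0 split: nat.splits) (metis coeff_eq_0 gr0I zero_P)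
      then show False using p by simp
    qed
    moreover have "degree (p - ?m) \<le> degree p" by (intro degree_diff_le) (auto simp: degree_monom_le)
    moreover have "coeff (p - ?m) (degree p) = 0" by (simp add: coeff_monom)
    ultimately have "degree (p - ?m) < degree p"
      by (metis leading_coeff_0_iff degree_0 le_neq_implies_less neq0_conv)
    then show False using min[OF A] by simp
  qed
  then show ?thesis using that p min by (metis not_le)
qed

text \<open>The leading coefficient of \<open>p\<close> need not be invertible, so \<open>f\<close>
  is multiplied by a power of it. The degree bound for the quotient \<open>g\<close> later shows
  that a cofactor of a minimal polynomial is too short to vanish at \<open>t\<close>.\<close>

lemma pseudo_division:
  assumes p: "p \<in> poly_over U" and n: "0 < degree p" and f: "f \<in> poly_over U"
  shows "\<exists>k g r. g \<in> poly_over U \<and> r \<in> poly_over U \<and> smult (lead_coeff p ^ k) f = g * p + r \<and>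
    degree r < degree p \<and> degree g \<le> degree f - degree p"
  using f
proof (induction "degree f" arbitrary: f rule: less_induct)
  case less
  show ?case
  proof (cases "degree f < degree p")
    case True
    then show ?thesis using less by (intro exI[of _ 0] exI[of _ f]) (simp add: poly_over_0)
  next
    case False
    define m where "m = monom (lead_coeff f) (degree f - degree p)"
    define f' where "f' = smult (lead_coeff p) f - m * p"
    have m: "m \<in> poly_over U" using less by (auto simp: m_def intro: poly_over_monom poly_over_lead)
    have f': "f' \<in> poly_over U" unfolding f'_def
      using less p m by (intro poly_over_diff poly_over_mult poly_over_smult poly_over_lead) auto
    have dm: "degree m \<le> degree f - degree p" by (simp add: m_def degree_monom_le)
    have "degree (m * p) \<le> degree m + degree p" by (rule degree_mult_le)
    then have "degree (m * p) \<le> degree f" using dm False by simp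
    then have le: "degree f' \<le> degree f" unfolding f'_def by (intro degree_diff_le) (auto intro: degree_smult_le order_trans)
    have "coeff (m * p) (degree f) = lead_coeff f * lead_coeff p"
      using False by (simp add: m_def coeff_monom_mult)
    then have "coeff f' (degree f) = 0" by (simp add: f'_def mult.commute)
    then have lt: "degree f' < degree f"
      using le n False by (metis leading_coeff_0_iff degree_0 le_neq_implies_less neq0_conv not_less)
    obtain k g r where IH: "g \<in> poly_over U" "r \<in> poly_over U" "smult (lead_coeff p ^ k) f' = g * p + r"
        "degree r < degree p" "degree g \<le> degree f' - degree p"
      using less(1)[OF lt f'] by blast
    let ?g = "g + smult (lead_coeff p ^ k) m"
    have "smult (lead_coeff p ^ Suc k) f = smult (lead_coeff p ^ k) (f' + m * p)"
      by (simp add: f'_def mult.commute)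
    also have "\<dots> = ?g * p + r" by (simp add: smult_add_right IH(3) distrib_right)
    finally have "smult (lead_coeff p ^ Suc k) f = ?g * p + r" .
    moreover have "?g \<in> poly_over U" using IH m p by (intro poly_over_add poly_over_smult U(7) poly_over_lead)
    moreover have "degree ?g \<le> degree f - degree p"
      using IH(5) lt dm by (intro degree_add_le) (auto intro: order_trans[OF degree_smult_le])
    ultimately show ?thesis using IH by blast
  qed
qed

lemma minimal_polynomial:
  assumes "\<not> transcendental_over U t"
  obtains p where "p \<in> poly_over U" "lead_coeff p \<notin> P" "poly p t \<in> P" "0 < degree p"
    "\<And>r. poly r t \<in> P \<Longrightarrow> r \<in> poly_over U \<Longrightarrow> degree r < degree p \<Longrightarrow> P_poly r"
proof -
  obtain q where q: "q \<in> poly_over U" "poly q t \<in> P" "\<not> P_poly q"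
    using assms by (auto simp: transcendental_over_def)
  obtain p where p: "poly p t \<in> P" "p \<in> poly_over U" "lead_coeff p \<notin> P"
    "\<And>r. poly r t \<in> P \<Longrightarrow> r \<in> poly_over U \<Longrightarrow> degree r < degree p \<Longrightarrow> P_poly r"
    using lead_not_P[of "\<lambda>q. poly q t \<in> P", OF q(2,1,3)] by (auto simp: poly_monom intro: diff_P mult_P')
  have "degree p \<noteq> 0"
  proof
    assume "degree p = 0"
    then obtain c where "p = [:c:]" by (rule degree_eq_zeroE)
    then show False using p by simp
  qed
  then show ?thesis using that p by blast
qed

text \<open>The fraction field of \<open>U[t]\<close> modulo \<open>P\<close> is generated over \<open>U[t]\<close> by inverses of elements of \<open>U\<close>.\<close>

lemma algebraic_adjoin_inverse:
  assumes t: "\<not> transcendental_over U t" and a: "a \<in> adjoin U t" "a \<notin> P"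
  shows "\<exists>b\<in>adjoin U t. \<exists>c\<in>U - P. a * b - c \<in> P"
proof -
  obtain p where p: "p \<in> poly_over U" "lead_coeff p \<notin> P" "poly p t \<in> P" "0 < degree p"
    and min: "\<And>r. poly r t \<in> P \<Longrightarrow> r \<in> poly_over U \<Longrightarrow> degree r < degree p \<Longrightarrow> P_poly r"
    using minimal_polynomial[OF t] by blast
  obtain q where q: "q \<in> poly_over U" "a = poly q t" using a by (auto simp: adjoin_def)
  interpret A: subring_mod P "adjoin U t" by unfold_locales (rule subring_adjoin)
  \<comment> \<open>\<open>Q h\<close> says that the value of \<open>h\<close> at \<open>t\<close>
    lies in the ideal generated by \<open>a\<close>, modulo \<open>P\<close>. A member of least
    degree plays the part of the gcd of \<open>q\<close> and \<open>p\<close>. If it is constant, it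
    is the wanted \<open>c\<close>.\<close>
  define Q where "Q h \<longleftrightarrow> (\<exists>b\<in>adjoin U t. poly h t - a * b \<in> P)" for h
  have "\<not> P_poly q" using a P_poly_value q by blast
  moreover have "Q q" using q A.U zero_P by (auto simp: Q_def intro!: bexI[of _ 1])
  moreover have "Q (h - monom (lead_coeff h) (degree h))" if "Q h" "lead_coeff h \<in> P" for h
  proof -
    obtain b where b: "b \<in> adjoin U t" "poly h t - a * b \<in> P" using \<open>Q h\<close> by (auto simp: Q_def)
    have "poly (h - monom (lead_coeff h) (degree h)) t - a * b = (poly h t - a * b) - lead_coeff h * t ^ degree h"
      by (simp add: poly_monom)
    also have "\<dots> \<in> P" by (intro diff_P b mult_P' that)
    finally show ?thesis using b by (auto simp: Q_def)
  qed
  ultimately obtain h where h: "Q h" "h \<in> poly_over U" "lead_coeff h \<notin> P"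
    "\<And>r. Q r \<Longrightarrow> r \<in> poly_over U \<Longrightarrow> degree r < degree h \<Longrightarrow> P_poly r"
    using lead_not_P[of Q q] q(1) by metis
  obtain b where b: "b \<in> adjoin U t" "poly h t - a * b \<in> P" using h by (auto simp: Q_def)
  show ?thesis
  proof (cases "degree h = 0")
    case True
    then obtain c where c: "h = [:c:]" by (rule degree_eq_zeroE)
    have "- (poly h t - a * b) \<in> P" by (rule uminus_P[OF b(2)])
    then show ?thesis using c h b poly_over_lead[OF h(2)] by (intro bexI[of _ b] bexI[of _ c]) auto
  next
    case False
    have divides: "\<exists>u\<in>U-P. \<exists>g\<in>poly_over U. degree g \<le> degree f - degree h \<and> P_poly (smult u f - g * h)"
      if f: "f \<in> poly_over U" and fa: "\<exists>c\<in>adjoin U t. poly f t - a * c \<in> P" for f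
    proof -
      obtain k g r where d: "g \<in> poly_over U" "r \<in> poly_over U" "smult (lead_coeff h ^ k) f = g * h + r"
        "degree r < degree h" "degree g \<le> degree f - degree h"
        using pseudo_division[OF h(2) _ f] False by blast
      let ?u = "lead_coeff h ^ k"
      obtain c where c: "c \<in> adjoin U t" "poly f t - a * c \<in> P" using fa by auto
      have "?u \<in> U" by (rule U(7)[OF poly_over_lead[OF h(2)]])
      moreover have "?u \<notin> P" using h(3) prime_power by blast
      ultimately have u: "?u \<in> U - P" by simp
      have gt: "poly g t \<in> adjoin U t" using d by (auto intro: adjoinI)
      have "poly r t = ?u * poly f t - poly g t * poly h t"
        using arg_cong[OF d(3), of "\<lambda>f. poly f t"] by simp
      then have "poly r t - a * (?u * c - poly g t * b) =
          ?u * (poly f t - a * c) - poly g t * (poly h t - a * b)" by (simp add: algebra_simps)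
      also have "\<dots> \<in> P" by (intro diff_P mult_P b c)
      finally have r: "poly r t - a * (?u * c - poly g t * b) \<in> P" .
      have "?u \<in> adjoin U t" using u adjoin_base[of t] by blast
      then have "?u * c - poly g t * b \<in> adjoin U t" using A.U(3,4) c(1) gt b(1) by simp
      then have "Q r" unfolding Q_def using r by blast
      then have "P_poly r" using h(4) d by blast
      moreover have "smult ?u f - g * h = r" using d(3) by simp
      ultimately show ?thesis using u d by metis
    qed
    \<comment> \<open>A nonconstant \<open>h\<close> leads to a contradiction. Up to a factor
      outside \<open>P\<close> it divides \<open>p\<close> modulo \<open>P\<close>; the cofactor
      \<open>g\<close> has smaller degree than \<open>p\<close>, so \<open>g\<close> does not vanish
      at \<open>t\<close> and \<open>h\<close> does. As \<open>h\<close> divides \<open>q\<close> in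
      the same sense, \<open>a\<close> would lie in \<open>P\<close>.\<close>
    have "\<exists>c\<in>adjoin U t. poly p t - a * c \<in> P" using p(3) A.U(2) by (intro bexI[of _ 0]) auto
    from divides[OF p(1) this] obtain u g where g: "u \<in> U - P" "g \<in> poly_over U" "degree g \<le> degree p - degree h" "P_poly (smult u p - g * h)"
      by blast
    have "poly (smult u p - g * h) t \<in> P" by (rule P_poly_value[OF g(4)])
    then have "poly g t * poly h t \<in> P"
      using diff_P[of "u * poly p t" "poly (smult u p - g * h) t"] mult_P[OF p(3)] by simp
    moreover have "poly g t \<notin> P"
    proof
      assume "poly g t \<in> P"
      moreover have "degree g < degree p" using g(3) False p(4) by linarith
      ultimately have "P_poly g" using min g by blast
      then have "P_poly (smult u p)" using P_poly_simps(2)[OF g(4) P_poly_mult[of g h]] by simp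
      then have "u * lead_coeff p \<in> P" by (simp add: P_poly_def)
      then show False using prime_P g p by blast
    qed
    ultimately have hP: "poly h t \<in> P" using prime_P by blast
    have "\<exists>c\<in>adjoin U t. poly q t - a * c \<in> P" using q(2) A.U(1) zero_P by (intro bexI[of _ 1]) auto
    from divides[OF q(1) this] obtain u' g' where g': "u' \<in> U - P" "g' \<in> poly_over U" "P_poly (smult u' q - g' * h)"
      by blast
    have "poly (smult u' q - g' * h) t + poly g' t * poly h t \<in> P"
      by (intro add_P P_poly_value[OF g'(3)] mult_P hP)
    then have "u' * a \<in> P" using q(2) by simp
    then have "u' \<in> P \<or> a \<in> P" by (rule prime_P)
    then show ?thesis using g'(1) a(2) by simp
  qed
qed

end

section \<open>Ultrametric calculus modulo \<open>P\<close>\<close>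

locale valued_subring = subring_mod P U for P U :: "'r::comm_ring_1 set" +
  fixes w :: "'r \<Rightarrow> real"
  assumes val: "val_on P U w"
begin

lemma val_simps:
  shows val_one: "w 1 = 1" and val_nonneg: "a \<in> U \<Longrightarrow> 0 \<le> w a"
    and val_eq_0: "a \<in> U \<Longrightarrow> w a = 0 \<longleftrightarrow> a \<in> P"
    and val_mult: "a \<in> U \<Longrightarrow> b \<in> U \<Longrightarrow> w (a * b) = w a * w b"
    and val_add: "a \<in> U \<Longrightarrow> b \<in> U \<Longrightarrow> w (a + b) \<le> max (w a) (w b)"
  using val by (auto simp: val_on_def)

lemma val_0: "w 0 = 0" using val_eq_0[of 0] U zero_P by simp

lemma val_minus: "a \<in> U \<Longrightarrow> w (- a) = w a"
proof -
  assume a: "a \<in> U"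
  have 1: "- 1 \<in> U" using U by simp
  have "w (- 1) * w (- 1) = 1" using val_mult[OF 1 1] val_one by simp
  then have "w (- 1) = 1" using val_nonneg[OF 1] by (metis abs_of_nonneg abs_1 abs_mult_self_eq real_sqrt_abs2 real_sqrt_one)
  then show ?thesis using val_mult[OF 1 a] by simp
qed

lemma val_diff: "a \<in> U \<Longrightarrow> b \<in> U \<Longrightarrow> w (a - b) \<le> max (w a) (w b)"
  using val_add[of a "- b"] val_minus[of b] U by simp

lemma val_power: "a \<in> U \<Longrightarrow> w (a ^ n) = w a ^ n"
  by (induction n) (auto simp: val_one val_mult U)

lemma val_cong: assumes "a \<in> U" "b \<in> U" "a - b \<in> P" shows "w a = w b"
proof -
  have *: "w a \<le> w b" if "a \<in> U" "b \<in> U" "a - b \<in> P" for a b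
  proof -
    have "w (b + (a - b)) \<le> max (w b) (w (a - b))" using that U by (intro val_add) auto
    moreover have "w (a - b) = 0" using that val_eq_0[of "a - b"] U by simp
    ultimately show ?thesis using val_nonneg[OF that(2)] by simp
  qed
  have "b - a \<in> P" using uminus_P[OF assms(3)] by simp
  then show ?thesis using *[of a b] *[of b a] assms by force
qed

lemma val_sum:
  assumes "finite I" "\<And>i. i \<in> I \<Longrightarrow> f i \<in> U" "\<And>i. i \<in> I \<Longrightarrow> w (f i) \<le> B" "0 \<le> B"
  shows "w (sum f I) \<le> B"
  using assms
proof (induction I rule: finite_induct)
  case (insert i I)
  have "sum f I \<in> U" using insert by (intro subring_set_sum[OF subring]) auto
  then have "w (f i + sum f I) \<le> max (w (f i)) (w (sum f I))"
    using insert by (intro val_add) auto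
  also have "\<dots> \<le> B" using insert by simp
  finally show ?case using insert by simp
qed (simp add: val_0)

lemma val_dominant:
  assumes "a \<in> U" "b \<in> U" "w b < w a" shows "w (a + b) = w a"
proof (rule antisym)
  show "w (a + b) \<le> w a" using val_add[OF assms(1,2)] assms by simp
  have "w a \<le> max (w (a + b)) (w b)" using val_diff[of "a + b" b] assms U by simp
  then show "w a \<le> w (a + b)" using assms by simp
qed

lemma val_dominant_sum:
  assumes "finite I" "\<And>i. i \<in> I \<Longrightarrow> f i \<in> U" "k \<in> I" "\<And>i. i \<in> I \<Longrightarrow> i \<noteq> k \<Longrightarrow> w (f i) < w (f k)"
  shows "w (sum f I) = w (f k)"
proof (cases "I = {k}")
  case False
  have s: "sum f (I - {k}) \<in> U" using assms by (intro subring_set_sum[OF subring]) auto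
  have ne: "I - {k} \<noteq> {}" using False assms by auto
  define B where "B = Max ((\<lambda>i. w (f i)) ` (I - {k}))"
  have "B < w (f k)" unfolding B_def using assms ne by (subst Max_less_iff) auto
  moreover have "w (sum f (I - {k})) \<le> B"
  proof (rule val_sum)
    show le: "w (f i) \<le> B" if "i \<in> I - {k}" for i unfolding B_def using that assms by (intro Max_ge) auto
    obtain i where "i \<in> I - {k}" using ne by auto
    then show "0 \<le> B" using le[of i] val_nonneg[of "f i"] assms by force
  qed (use assms in auto)
  ultimately have "w (f k + sum f (I - {k})) = w (f k)" using assms s by (intro val_dominant) auto
  then show ?thesis using sum.remove[OF assms(1,3), of f] by simp
qed simp

end

section \<open>Gauss norms and extension along a transcendental element\<close>

definition gauss_norm :: "('r::comm_ring_1 \<Rightarrow> real) \<Rightarrow> real \<Rightarrow> 'r poly \<Rightarrow> real" where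
  "gauss_norm w c q = Max ((\<lambda>i. w (coeff q i) * c ^ i) ` {..degree q})"

locale gauss = valued_subring P U w for P U :: "'r::comm_ring_1 set" and w +
  fixes c :: real
  assumes c_pos: "0 < c"
begin

abbreviation gnorm where "gnorm \<equiv> gauss_norm w c"
lemmas gnorm_def = gauss_norm_def[of w c]

text \<open>The last index at which the Gauss norm is attained. Last indices add up under
  multiplication. This proves that the norm is multiplicative and, for algebraic extensions, that a
  multiple of \<open>p\<close> attains its norm at an index not below
  \<open>degree p\<close>.\<close>

definition is_top where
  "is_top q i \<longleftrightarrow> w (coeff q i) * c ^ i = gnorm q \<and> (\<forall>k>i. w (coeff q k) * c ^ k < gnorm q)"

lemma over: "q \<in> poly_over U \<Longrightarrow> coeff q i \<in> U" by (simp add: poly_over_def)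

lemma term_nonneg: "q \<in> poly_over U \<Longrightarrow> 0 \<le> w (coeff q i) * c ^ i"
  using c_pos val_nonneg over by simp

lemma gnorm_attained: "\<exists>i. w (coeff q i) * c ^ i = gnorm q"
proof -
  have "gnorm q \<in> (\<lambda>i. w (coeff q i) * c ^ i) ` {..degree q}"
    unfolding gnorm_def by (rule Max_in) auto
  then show ?thesis by auto
qed

lemma gnorm_nonneg: "q \<in> poly_over U \<Longrightarrow> 0 \<le> gnorm q"
  using term_nonneg[of q] gnorm_attained[of q] by metis

lemma gnorm_ge: "q \<in> poly_over U \<Longrightarrow> w (coeff q i) * c ^ i \<le> gnorm q"
proof (cases "i \<le> degree q")
  case True
  then show ?thesis by (auto simp: gnorm_def intro!: Max_ge)
next
  case False
  assume "q \<in> poly_over U"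
  then show ?thesis using False gnorm_nonneg[of q] by (simp add: coeff_eq_0 val_0)
qed

lemma gnorm_le: "(\<And>i. w (coeff q i) * c ^ i \<le> B) \<Longrightarrow> gnorm q \<le> B"
  using gnorm_attained[of q] by metis

lemma gnorm_eq_0: assumes q: "q \<in> poly_over U" shows "gnorm q = 0 \<longleftrightarrow> P_poly q"
proof
  assume 0: "gnorm q = 0"
  show "P_poly q" unfolding P_poly_def
  proof
    fix i
    have "w (coeff q i) * c ^ i = 0" using gnorm_ge[OF q, of i] term_nonneg[OF q, of i] 0 by simp
    then show "coeff q i \<in> P" using c_pos val_eq_0[OF over[OF q]] by simp
  qed
next
  assume "P_poly q"
  then have "w (coeff q i) * c ^ i = 0" for i using val_eq_0[OF over[OF q]] by (simp add: P_poly_def)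
  moreover obtain i where "w (coeff q i) * c ^ i = gnorm q" using gnorm_attained by blast
  ultimately show "gnorm q = 0" by metis
qed

lemma gnorm_cong:
  assumes "p \<in> poly_over U" "q \<in> poly_over U" "P_poly (p - q)" shows "gnorm p = gnorm q"
proof -
  have "w (coeff p i) = w (coeff q i)" for i
    using assms by (intro val_cong) (auto simp: P_poly_def over)
  then have "gnorm p \<le> gnorm q" "gnorm q \<le> gnorm p"
    using gnorm_ge assms by (metis gnorm_le)+
  then show ?thesis by simp
qed

lemma gnorm_add:
  assumes "p \<in> poly_over U" "q \<in> poly_over U" shows "gnorm (p + q) \<le> max (gnorm p) (gnorm q)"
proof (rule gnorm_le)
  fix i
  have "w (coeff (p + q) i) * c ^ i \<le> max (w (coeff p i)) (w (coeff q i)) * c ^ i"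
    using val_add[OF over[OF assms(1)] over[OF assms(2)], of i i] c_pos by simp
  also have "\<dots> = max (w (coeff p i) * c ^ i) (w (coeff q i) * c ^ i)"
    using c_pos by (simp add: max_def)
  also have "\<dots> \<le> max (gnorm p) (gnorm q)" using gnorm_ge assms by (intro max.mono) auto
  finally show "w (coeff (p + q) i) * c ^ i \<le> max (gnorm p) (gnorm q)" .
qed

lemma gnorm_smult:
  assumes "a \<in> U" "q \<in> poly_over U" shows "gnorm (smult a q) = w a * gnorm q"
proof (rule antisym)
  have e: "w (coeff (smult a q) i) * c ^ i = w a * (w (coeff q i) * c ^ i)" for i
    using val_mult[OF assms(1) over[OF assms(2)]] by simp
  show "gnorm (smult a q) \<le> w a * gnorm q"
    unfolding e[abs_def] using gnorm_ge[OF assms(2)] val_nonneg[OF assms(1)]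
    by (intro gnorm_le) (simp only: e, rule mult_left_mono)
  obtain i where "w (coeff q i) * c ^ i = gnorm q" using gnorm_attained by blast
  then show "w a * gnorm q \<le> gnorm (smult a q)"
    using gnorm_ge[OF poly_over_smult[OF assms], of i] e[of i] by simp
qed

lemma gnorm_const: "a \<in> U \<Longrightarrow> gnorm [:a:] = w a" by (simp add: gnorm_def)

lemma ex_top: assumes q: "q \<in> poly_over U" and pos: "0 < gnorm q" shows "\<exists>i. is_top q i"
proof -
  let ?I = "{i. w (coeff q i) * c ^ i = gnorm q}"
  have "i \<le> degree q" if "i \<in> ?I" for i
    using that pos by (cases "i \<le> degree q") (auto simp: coeff_eq_0 val_0)
  then have fin: "finite ?I" by (meson finite_nat_set_iff_bounded_le)
  have ne: "?I \<noteq> {}" using gnorm_attained by blast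
  have "is_top q (Max ?I)" unfolding is_top_def
  proof (intro conjI allI impI)
    show "w (coeff q (Max ?I)) * c ^ Max ?I = gnorm q" using Max_in[OF fin ne] by simp
    fix k assume "Max ?I < k"
    then have "k \<notin> ?I" using Max_ge[OF fin, of k] by auto
    then show "w (coeff q k) * c ^ k < gnorm q" using gnorm_ge[OF q, of k] by simp
  qed
  then show ?thesis by blast
qed

lemma term_product:
  assumes "p \<in> poly_over U" "q \<in> poly_over U" "k \<le> n"
  shows "w (coeff p k * coeff q (n - k)) * c ^ n = (w (coeff p k) * c ^ k) * (w (coeff q (n - k)) * c ^ (n - k))"
proof -
  have "c ^ n = c ^ k * c ^ (n - k)" using assms by (simp add: power_add[symmetric])
  then show ?thesis using val_mult[OF over over] assms by simp
qed

lemma gnorm_mult_le: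
  assumes "p \<in> poly_over U" "q \<in> poly_over U" shows "gnorm (p * q) \<le> gnorm p * gnorm q"
proof (rule gnorm_le)
  fix n
  have "w (coeff (p * q) n) \<le> gnorm p * gnorm q / c ^ n"
    unfolding coeff_mult
  proof (rule val_sum)
    fix k assume k: "k \<in> {..n}"
    have "w (coeff p k * coeff q (n - k)) * c ^ n \<le> gnorm p * gnorm q"
      using k assms unfolding term_product[OF assms, of k n, simplified k[simplified], OF TrueI]
      by (intro mult_mono gnorm_ge gnorm_nonneg term_nonneg)
    then show "w (coeff p k * coeff q (n - k)) \<le> gnorm p * gnorm q / c ^ n" using c_pos by (simp add: field_simps)
  qed (use assms c_pos gnorm_nonneg over U in auto)
  then show "w (coeff (p * q) n) * c ^ n \<le> gnorm p * gnorm q" using c_pos by (simp add: field_simps)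
qed

text \<open>In the coefficient at \<open>i + j\<close> the term \<open>k = i\<close> strictly
  dominates: for \<open>k > i\<close> the factor from \<open>p\<close> is below its norm, for
  \<open>k < i\<close> the factor from \<open>q\<close> is.\<close>

lemma gnorm_mult_top:
  assumes p: "p \<in> poly_over U" "is_top p i" "0 < gnorm p" and q: "q \<in> poly_over U" "is_top q j" "0 < gnorm q"
  shows "w (coeff (p * q) (i + j)) * c ^ (i + j) = gnorm p * gnorm q"
proof -
  let ?f = "\<lambda>k. coeff p k * coeff q (i + j - k)"
  have ij: "w (?f i) * c ^ (i + j) = gnorm p * gnorm q"
    using term_product[OF p(1) q(1), of i "i + j"] p(2) q(2) by (simp add: is_top_def)
  have "w (coeff (p * q) (i + j)) = w (?f i)" unfolding coeff_mult
  proof (rule val_dominant_sum)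
    fix k assume k: "k \<in> {..i + j}" "k \<noteq> i"
    have "(w (coeff p k) * c ^ k) * (w (coeff q (i + j - k)) * c ^ (i + j - k)) < gnorm p * gnorm q"
    proof (cases "i < k")
      case True
      then have "w (coeff p k) * c ^ k < gnorm p" using p by (simp add: is_top_def)
      then have "(w (coeff p k) * c ^ k) * gnorm q < gnorm p * gnorm q" using q(3) by simp
      moreover have "(w (coeff p k) * c ^ k) * (w (coeff q (i + j - k)) * c ^ (i + j - k)) \<le> (w (coeff p k) * c ^ k) * gnorm q"
        by (intro mult_left_mono gnorm_ge[OF q(1)] term_nonneg[OF p(1)])
      ultimately show ?thesis by linarith
    next
      case False
      then have "j < i + j - k" using k by auto
      then have "w (coeff q (i + j - k)) * c ^ (i + j - k) < gnorm q" using q by (simp add: is_top_def)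
      then have "(w (coeff p k) * c ^ k) * (w (coeff q (i + j - k)) * c ^ (i + j - k)) \<le> gnorm p * (w (coeff q (i + j - k)) * c ^ (i + j - k))"
        "gnorm p * (w (coeff q (i + j - k)) * c ^ (i + j - k)) < gnorm p * gnorm q"
        using gnorm_ge[OF p(1)] term_nonneg[OF q(1)] p(3) by (auto intro: mult_right_mono)
      then show ?thesis by linarith
    qed
    then have "w (?f k) * c ^ (i + j) < w (?f i) * c ^ (i + j)"
      using term_product[OF p(1) q(1), of k "i + j"] k ij by simp
    then show "w (?f k) < w (?f i)" using c_pos by simp
  qed (use p q over U in auto)
  then show ?thesis using ij by simp
qed

lemma gnorm_mult:
  assumes "p \<in> poly_over U" "q \<in> poly_over U" shows "gnorm (p * q) = gnorm p * gnorm q"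
proof (cases "gnorm p = 0 \<or> gnorm q = 0")
  case True
  then show ?thesis using gnorm_mult_le[OF assms] gnorm_nonneg[OF poly_over_mult[OF assms]] by auto
next
  case False
  then have pos: "0 < gnorm p" "0 < gnorm q" using gnorm_nonneg assms by (metis less_eq_real_def)+
  then obtain i j where "is_top p i" "is_top q j" using ex_top assms by blast
  then have "gnorm p * gnorm q \<le> gnorm (p * q)"
    using gnorm_mult_top[OF assms(1) _ pos(1) assms(2) _ pos(2)] gnorm_ge[OF poly_over_mult[OF assms]] by metis
  then show ?thesis using gnorm_mult_le[OF assms] by simp
qed

text \<open>Polynomials with equal values at \<open>t\<close> differ by coefficients in
  \<open>P\<close>, so the Gauss norm depends only on the value.\<close>

lemma transcendental_extension:
  assumes t: "transcendental_over U t"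
  shows "\<exists>w'. val_on P (adjoin U t) w' \<and> (\<forall>q\<in>poly_over U. w' (poly q t) = gnorm q)"
proof -
  define w' where "w' a = gnorm (SOME q. q \<in> poly_over U \<and> poly q t = a)" for a
  have w': "w' (poly q t) = gnorm q" if q: "q \<in> poly_over U" for q
  proof -
    define q' where "q' = (SOME q'. q' \<in> poly_over U \<and> poly q' t = poly q t)"
    have q': "q' \<in> poly_over U \<and> poly q' t = poly q t" unfolding q'_def by (rule someI[of _ q]) (use q in simp)
    then have "poly (q' - q) t \<in> P" using zero_P by simp
    then have "P_poly (q' - q)" using t poly_over_diff q q' by (auto simp: transcendental_over_def)
    then show ?thesis using gnorm_cong q q' by (simp add: w'_def q'_def)
  qed
  have "val_on P (adjoin U t) w'" unfolding val_on_def
  proof (intro conjI ballI)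
    show "w' 1 = 1" using w'[OF poly_over_1] gnorm_const[of 1] U val_one by (simp add: one_pCons)
  next
    fix a assume "a \<in> adjoin U t"
    then obtain p where p: "p \<in> poly_over U" "a = poly p t" by (auto simp: adjoin_def)
    show "0 \<le> w' a" using p w' gnorm_nonneg by simp
    show "w' a = 0 \<longleftrightarrow> a \<in> P"
      using p w' gnorm_eq_0 t P_poly_value by (auto simp: transcendental_over_def)
    fix b assume "b \<in> adjoin U t"
    then obtain q where q: "q \<in> poly_over U" "b = poly q t" by (auto simp: adjoin_def)
    show "w' (a * b) = w' a * w' b"
      using w'[OF poly_over_mult[OF p(1) q(1)]] w' p q gnorm_mult by simp
    show "w' (a + b) \<le> max (w' a) (w' b)"
      using w'[OF poly_over_add[OF p(1) q(1)]] w' p q gnorm_add by simp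
  qed
  then show ?thesis using w' by blast
qed

end

text \<open>\<open>N\<close> is the quotient norm of the Gauss norm on fractions
  \<open>q / u\<close> with \<open>u\<close> in \<open>U - P\<close>, and a multiplicative seminorm
  below it that agrees with \<open>w\<close> on \<open>U - P\<close> is the extension. Two things
  rest on the algebraic equation \<open>p\<close>: that the quotient norm of 1 is still 1, and that
  the seminorm vanishes only on \<open>P\<close>.\<close>

lemma (in valued_subring) algebraic_extension:
  assumes t: "\<not> transcendental_over U t"
  shows "\<exists>w'. val_on P (adjoin U t) w' \<and> (\<forall>a\<in>U. w' a = w a)"
proof -
  obtain p where p: "p \<in> poly_over U" "lead_coeff p \<notin> P" "poly p t \<in> P" "0 < degree p"
    and min: "\<And>r. poly r t \<in> P \<Longrightarrow> r \<in> poly_over U \<Longrightarrow> degree r < degree p \<Longrightarrow> P_poly r"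
    using minimal_polynomial[OF t] by blast
  let ?n = "degree p" and ?l = "lead_coeff p"
  have lU: "?l \<in> U" by (rule poly_over_lead[OF p(1)])
  have lp: "0 < w ?l" using val_eq_0[OF lU] val_nonneg[OF lU] p(2) by simp
  \<comment> \<open>So large that the leading term of \<open>p\<close> strictly dominates all
    others, which puts the last index of \<open>p\<close> at its degree.\<close>
  define c where "c = 1 + (\<Sum>i<?n. w (coeff p i) / w ?l)"
  have pi: "0 \<le> w (coeff p i)" for i using p(1) val_nonneg by (simp add: poly_over_def)
  have c1: "1 \<le> c" using pi lp by (auto simp: c_def intro!: sum_nonneg)
  interpret G: gauss P U w c by unfold_locales (use c1 in simp)
  interpret A: subring_mod P "adjoin U t" by unfold_locales (rule subring_adjoin)
  have small: "w (coeff p i) * c ^ i < w ?l * c ^ ?n" if "i < ?n" for i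
  proof -
    have "w (coeff p i) / w ?l \<le> (\<Sum>i<?n. w (coeff p i) / w ?l)"
      using that pi lp by (intro member_le_sum) auto
    then have "w (coeff p i) / w ?l < c" by (simp add: c_def)
    then have "w (coeff p i) < w ?l * c" using lp by (simp add: divide_simps mult.commute)
    then have "w (coeff p i) * c ^ i < (w ?l * c) * c ^ i" using c1 by simp
    also have "\<dots> = w ?l * c ^ Suc i" by simp
    also have "\<dots> \<le> w ?l * c ^ ?n" using that c1 lp by (intro mult_left_mono power_increasing) auto
    finally show ?thesis .
  qed
  have top_p: "G.is_top p ?n" and gp: "0 < G.gnorm p"
  proof -
    obtain i where i: "w (coeff p i) * c ^ i = G.gnorm p" using G.gnorm_attained by blast
    have ge: "w ?l * c ^ ?n \<le> G.gnorm p" by (rule G.gnorm_ge[OF p(1)])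
    moreover have "0 < w ?l * c ^ ?n" using lp c1 by simp
    ultimately show gp: "0 < G.gnorm p" by linarith
    have hi: "w (coeff p k) * c ^ k = 0" if "?n < k" for k using that by (simp add: coeff_eq_0 val_0)
    have "i = ?n" using small[of i] hi[of i] i ge gp by (cases i ?n rule: linorder_cases) auto
    moreover have "w (coeff p k) * c ^ k < G.gnorm p" if "?n < k" for k
      unfolding hi[OF that] by (rule gp)
    ultimately show "G.is_top p ?n" using i unfolding G.is_top_def by blast
  qed
  \<comment> \<open>the constant term cannot dominate in a multiple of \<open>p\<close>, as its top index is at least \<open>degree p\<close>\<close>
  have const: "w u \<le> G.gnorm q" if u: "u \<in> U" and q: "q \<in> poly_over U" and e: "u - poly q t \<in> P" for u q
  proof -
    define h where "h = q - [:u:]"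
    have hU: "h \<in> poly_over U" unfolding h_def using q u by (intro poly_over_diff poly_over_const)
    have ht: "poly h t \<in> P" using uminus_P[OF e] by (simp add: h_def)
    obtain k g r where d: "g \<in> poly_over U" "r \<in> poly_over U" "smult (?l ^ k) h = g * p + r" "degree r < ?n"
      using pseudo_division[OF p(1,4) hU] by blast
    have "poly r t = ?l ^ k * poly h t - poly g t * poly p t"
      using arg_cong[OF d(3), of "\<lambda>f. poly f t"] by simp
    also have "\<dots> \<in> P" by (intro diff_P mult_P ht p)
    finally have rP: "P_poly r" using min d by blast
    have lk: "?l ^ k \<in> U" "0 < w (?l ^ k)" using U(7)[OF lU] lp val_power[OF lU] by auto
    have sU: "smult (?l ^ k) h \<in> poly_over U" by (rule poly_over_smult[OF lk(1) hU])
    have gpU: "g * p \<in> poly_over U" by (rule poly_over_mult[OF d(1) p(1)])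
    have "P_poly (smult (?l ^ k) h - g * p)" using rP d(3) by simp
    then have eqs: "w (coeff (smult (?l ^ k) h) i) = w (coeff (g * p) i)" "G.gnorm (smult (?l ^ k) h) = G.gnorm (g * p)" for i
      using G.gnorm_cong[OF sU gpU] by (auto intro!: val_cong G.over[OF sU] G.over[OF gpU] simp del: coeff_smult simp: P_poly_def)
    have hq: "G.gnorm h \<le> G.gnorm q"
    proof (cases "G.gnorm g = 0")
      case True
      then have "w (?l ^ k) * G.gnorm h = 0"
        using G.gnorm_smult[OF lk(1) hU] eqs(2) G.gnorm_mult[OF d(1) p(1)] by simp
      then show ?thesis using lk G.gnorm_nonneg[OF q] by simp
    next
      case False
      then have gg: "0 < G.gnorm g" using G.gnorm_nonneg[OF d(1)] by simp
      then obtain j where j: "G.is_top g j" using G.ex_top[OF d(1)] by blast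
      have "w (coeff (g * p) (j + ?n)) * c ^ (j + ?n) = G.gnorm (g * p)"
        using G.gnorm_mult_top[OF d(1) j gg p(1) top_p gp] G.gnorm_mult[OF d(1) p(1)] by simp
      then have "w (?l ^ k) * (w (coeff h (j + ?n)) * c ^ (j + ?n)) = w (?l ^ k) * G.gnorm h"
        using eqs(1)[of "j + ?n"] eqs(2) G.gnorm_smult[OF lk(1) hU] val_mult[OF lk(1) G.over[OF hU]]
        by (simp add: mult.assoc[symmetric])
      then have "w (coeff h (j + ?n)) * c ^ (j + ?n) = G.gnorm h" using lk by simp
      moreover have "coeff h (j + ?n) = coeff q (j + ?n)"
        using p(4) by (simp add: h_def coeff_pCons split: nat.splits)
      ultimately show ?thesis using G.gnorm_ge[OF q, of "j + ?n"] by simp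
    qed
    have "u = coeff q 0 - coeff h 0" by (simp add: h_def)
    then have "w u \<le> max (w (coeff q 0)) (w (coeff h 0))"
      using val_diff[OF G.over[OF q] G.over[OF hU], of 0 0] by simp
    also have "\<dots> \<le> max (G.gnorm q) (G.gnorm h)"
      using G.gnorm_ge[OF q, of 0] G.gnorm_ge[OF hU, of 0] by (intro max.mono) auto
    finally show ?thesis using hq by simp
  qed
  \<comment> \<open>All norms of fractions \<open>q / u\<close> that represent \<open>a\<close>
    modulo \<open>P\<close>. Denominators from \<open>U - P\<close> make \<open>N\<close>
    homogeneous under multiplication by such elements, not just submultiplicative.\<close>
  define R where "R a = {G.gnorm q / w u | q u. q \<in> poly_over U \<and> u \<in> U - P \<and> u * a - poly q t \<in> P}" for a
  define N where "N a = Inf (R a)" for a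
  have up: "0 < w u" if "u \<in> U - P" for u using that val_eq_0[of u] val_nonneg[of u] by force
  have Rnn: "0 \<le> x" if "x \<in> R a" for x a
  proof -
    obtain q u where "x = G.gnorm q / w u" "q \<in> poly_over U" "u \<in> U - P" using \<open>x \<in> R a\<close> unfolding R_def by blast
    then show ?thesis using up[of u] G.gnorm_nonneg[of q] by simp
  qed
  have RI: "G.gnorm q / w u \<in> R a" if "q \<in> poly_over U" "u \<in> U - P" "u * a - poly q t \<in> P" for q u a
    using that unfolding R_def by blast
  have R1: "G.gnorm q \<in> R a" if "q \<in> poly_over U" "a - poly q t \<in> P" for q a
    using RI[of q 1 a] that U(1) one_P val_one by simp
  have Rne: "R a \<noteq> {}" if "a \<in> adjoin U t" for a
  proof -
    obtain q where "q \<in> poly_over U" "a = poly q t" using \<open>a \<in> adjoin U t\<close> by (auto simp: adjoin_def)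
    then have "G.gnorm q \<in> R a" using zero_P by (intro R1) auto
    then show ?thesis by blast
  qed
  have Nle: "N a \<le> x" if "x \<in> R a" for a x
    unfolding N_def using that Rnn by (intro cInf_lower bdd_belowI[of _ 0])
  have Nge: "B \<le> N a" if "a \<in> adjoin U t" "\<And>x. x \<in> R a \<Longrightarrow> B \<le> x" for a B
    unfolding N_def using that Rne by (intro cInf_greatest)
  have Nnn: "0 \<le> N a" if "a \<in> adjoin U t" for a using Nge[OF that] Rnn by blast
  have Napprox: "\<exists>x\<in>R a. x < B" if "a \<in> adjoin U t" "N a < B" for a B
    using Nge[OF that(1), of B] that(2) by force
  have NP: "N a = 0" if "a \<in> adjoin U t" "a \<in> P" for a
  proof (rule antisym)
    have "G.gnorm 0 \<in> R a" using that poly_over_0 by (intro R1) auto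
    moreover have "G.gnorm 0 = 0" using G.gnorm_eq_0[OF poly_over_0] P_poly_simps by simp
    ultimately show "N a \<le> 0" using Nle by force
  qed (rule Nnn[OF that(1)])
  have Rmult: "x * y \<in> R (a * b)" if xy: "x \<in> R a" "y \<in> R b" for x y a b
  proof -
    obtain q u where q: "x = G.gnorm q / w u" "q \<in> poly_over U" "u \<in> U - P" "u * a - poly q t \<in> P" using xy unfolding R_def by blast
    obtain q' u' where q': "y = G.gnorm q' / w u'" "q' \<in> poly_over U" "u' \<in> U - P" "u' * b - poly q' t \<in> P" using xy unfolding R_def by blast
    have "u * u' * (a * b) - poly (q * q') t = u * a * (u' * b - poly q' t) + poly q' t * (u * a - poly q t)"
      by (simp add: algebra_simps)
    also have "\<dots> \<in> P" by (intro add_P mult_P q q')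
    finally have "u * u' * (a * b) - poly (q * q') t \<in> P" .
    moreover have "u * u' \<in> U - P" using q(3) q'(3) U(4) prime_P by blast
    moreover have "x * y = G.gnorm (q * q') / w (u * u')" using q q' by (simp add: G.gnorm_mult val_mult)
    ultimately show ?thesis unfolding R_def using poly_over_mult[OF q(2) q'(2)] by blast
  qed
  have Radd: "\<exists>z\<in>R (a + b). z \<le> max x y" if xy: "x \<in> R a" "y \<in> R b" for x y a b
  proof -
    obtain q u where q: "x = G.gnorm q / w u" "q \<in> poly_over U" "u \<in> U - P" "u * a - poly q t \<in> P" using xy unfolding R_def by blast
    obtain q' u' where q': "y = G.gnorm q' / w u'" "q' \<in> poly_over U" "u' \<in> U - P" "u' * b - poly q' t \<in> P" using xy unfolding R_def by blast
    let ?q = "smult u' q + smult u q'"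
    have s: "smult u' q \<in> poly_over U" "smult u q' \<in> poly_over U" using q q' by (auto intro: poly_over_smult)
    have "u * u' * (a + b) - poly ?q t = u' * (u * a - poly q t) + u * (u' * b - poly q' t)"
      by (simp add: algebra_simps)
    also have "\<dots> \<in> P" by (intro add_P mult_P q q')
    finally have "u * u' * (a + b) - poly ?q t \<in> P" .
    moreover have "u * u' \<in> U - P" using q(3) q'(3) U(4) prime_P by blast
    ultimately have z: "G.gnorm ?q / w (u * u') \<in> R (a + b)"
      unfolding R_def using poly_over_add[OF s] by blast
    have "G.gnorm ?q \<le> max (w u' * G.gnorm q) (w u * G.gnorm q')"
      using G.gnorm_add[OF s] q q' by (simp add: G.gnorm_smult)
    then have "G.gnorm ?q / w (u * u') \<le> max (w u' * G.gnorm q) (w u * G.gnorm q') / w (u * u')"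
      using q(3) q'(3) up val_mult by (intro divide_right_mono) (auto intro: less_imp_le)
    also have "\<dots> = max x y"
    proof -
      have K: "0 < w (u * u')" using up[OF q(3)] up[OF q'(3)] q(3) q'(3) by (simp add: val_mult)
      have "w u' * G.gnorm q = w (u * u') * x" "w u * G.gnorm q' = w (u * u') * y"
        using q(1,3) q'(1,3) up[OF q(3)] up[OF q'(3)] by (auto simp: val_mult)
      then show ?thesis using K by (auto simp: max_def)
    qed
    finally show ?thesis using z by blast
  qed
  have Nm: "N (a * b) \<le> N a * N b" if ab: "a \<in> adjoin U t" "b \<in> adjoin U t" for a b
  proof (rule le_mult_approx)
    fix d :: real assume d: "0 < d"
    obtain x where x: "x \<in> R a" "x < N a + d" using Napprox[OF ab(1), of "N a + d"] d by auto
    obtain y where y: "y \<in> R b" "y < N b + d" using Napprox[OF ab(2), of "N b + d"] d by auto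
    have "N (a * b) \<le> x * y" by (rule Nle[OF Rmult[OF x(1) y(1)]])
    also have "\<dots> \<le> (N a + d) * (N b + d)"
      using x y Rnn[OF x(1)] Rnn[OF y(1)] by (intro mult_mono) auto
    finally show "N (a * b) \<le> (N a + d) * (N b + d)" .
  qed
  have Na: "N (a + b) \<le> max (N a) (N b)" if ab: "a \<in> adjoin U t" "b \<in> adjoin U t" for a b
  proof (rule dense_ge)
    fix \<rho> assume \<rho>: "max (N a) (N b) < \<rho>"
    obtain x where x: "x \<in> R a" "x < \<rho>" using Napprox[OF ab(1), of \<rho>] \<rho> by auto
    obtain y where y: "y \<in> R b" "y < \<rho>" using Napprox[OF ab(2), of \<rho>] \<rho> by auto
    obtain z where "z \<in> R (a + b)" "z \<le> max x y" using Radd[OF x(1) y(1)] by blast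
    then show "N (a + b) \<le> \<rho>" using Nle[of z "a + b"] x y by simp
  qed
  have Nw: "N (m * a) = w m * N a" if m: "m \<in> U - P" and a: "a \<in> adjoin U t" for m a
  proof (rule antisym)
    have mA: "m \<in> adjoin U t" using m adjoin_base[of t] by blast
    have "G.gnorm [:m:] \<in> R m" using m zero_P by (intro R1 poly_over_const) auto
    then have mR: "w m \<in> R m" using m G.gnorm_const by simp
    have "N (m * a) / w m \<le> N a"
    proof (rule Nge[OF a])
      fix x assume "x \<in> R a"
      then have "N (m * a) \<le> w m * x" using Nle[OF Rmult[OF mR]] by blast
      then show "N (m * a) / w m \<le> x" using up[OF m] by (simp add: divide_simps mult.commute)
    qed
    then show "N (m * a) \<le> w m * N a" using up[OF m] by (simp add: divide_simps mult.commute)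
    show "w m * N a \<le> N (m * a)"
    proof (rule Nge)
      show "m * a \<in> adjoin U t" by (rule A.U(4)[OF mA a])
      fix x assume "x \<in> R (m * a)"
      then obtain q u where q: "x = G.gnorm q / w u" "q \<in> poly_over U" "u \<in> U - P" "u * (m * a) - poly q t \<in> P" unfolding R_def by blast
      have "u * m \<in> U - P" using q(3) m U(4) prime_P by blast
      moreover have "u * m * a - poly q t \<in> P" using q(4) by (simp add: mult.assoc)
      ultimately have "G.gnorm q / w (u * m) \<in> R a" unfolding R_def using q(2) by blast
      then have "N a \<le> G.gnorm q / w (u * m)" by (rule Nle)
      also have "\<dots> = x / w m" using q m by (simp add: val_mult)
      finally show "w m * N a \<le> x" using up[OF m] by (simp add: divide_simps mult.commute)
    qed
  qed
  \<comment> \<open>No fraction of norm below 1 represents 1: this is \<open>const\<close>, applied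
    to the denominator \<open>u\<close>.\<close>
  have N1: "N 1 = 1"
  proof (rule antisym)
    have "G.gnorm 1 \<in> R 1" using zero_P poly_over_1 by (intro R1) auto
    moreover have "G.gnorm 1 = 1" using G.gnorm_const[OF U(1)] val_one by (simp add: one_pCons)
    ultimately show "N 1 \<le> 1" using Nle by metis
    show "1 \<le> N 1"
    proof (rule Nge[OF A.U(1)])
      fix x assume "x \<in> R 1"
      then obtain q u where q: "x = G.gnorm q / w u" "q \<in> poly_over U" "u \<in> U - P" "u - poly q t \<in> P" unfolding R_def by auto
      then show "1 \<le> x" using const[of u q] up[OF q(3)] by simp
    qed
  qed
  have NwU: "N m = w m" if "m \<in> U - P" for m using Nw[OF that A.U(1)] N1 by simp
  interpret S: seminorm_below "adjoin U t" "U - P" N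
  proof
    show "U - P \<subseteq> adjoin U t" using adjoin_base[of t] by blast
    show "N (m * a) = N m * N a" if "m \<in> U - P" "a \<in> adjoin U t" for m a using Nw that NwU by simp
  qed (fact A.subring N1)+
  obtain w' where w': "\<And>a. a \<in> adjoin U t \<Longrightarrow> 0 \<le> w' a \<and> w' a \<le> N a" "w' 1 = 1" "\<And>m. m \<in> U - P \<Longrightarrow> w' m = N m"
    and w'2: "\<And>a b. a \<in> adjoin U t \<Longrightarrow> b \<in> adjoin U t \<Longrightarrow> w' (a * b) = w' a * w' b \<and> w' (a + b) \<le> max (w' a) (w' b)"
    using S.multiplicative_below[OF NP[OF A.U(2) zero_P] Nnn Nm Na] by blast
  have wP: "w' a = 0" if "a \<in> adjoin U t" "a \<in> P" for a using w'(1)[OF that(1)] NP[OF that] by simp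
  have wU: "w' a = w a" if a: "a \<in> U" for a
  proof (cases "a \<in> P")
    case True
    then show ?thesis using wP a adjoin_base[of t] val_eq_0[OF a] by auto
  next
    case False
    then show ?thesis using w'(3) NwU a by simp
  qed
  \<comment> \<open>An element of value 0 outside \<open>P\<close> would have a multiple congruent
    to some \<open>c\<close> in \<open>U - P\<close>, whose value \<open>w c\<close> is
    positive.\<close>
  have ker: "a \<in> P" if a: "a \<in> adjoin U t" "w' a = 0" for a
  proof (rule ccontr)
    assume "a \<notin> P"
    then obtain b c where b: "b \<in> adjoin U t" "c \<in> U - P" "a * b - c \<in> P"
      using algebraic_adjoin_inverse[OF t a(1)] by blast
    have cA: "c \<in> adjoin U t" using b adjoin_base[of t] by blast
    have "c - a * b \<in> P" using uminus_P[OF b(3)] by simp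
    moreover have ab: "a * b \<in> adjoin U t" by (rule A.U(4)[OF a(1) b(1)])
    moreover have d: "c - a * b \<in> adjoin U t" by (rule A.U(3)[OF cA ab])
    ultimately have "w' (c - a * b) = 0" by (intro wP)
    moreover have "w' (a * b) = 0" using w'2[OF a(1) b(1)] a by simp
    moreover have "w' (a * b + (c - a * b)) \<le> max (w' (a * b)) (w' (c - a * b))"
      using w'2[OF ab d] by blast
    ultimately have "w' c \<le> 0" by simp
    then show False using wU[of c] up[OF b(2)] b by simp
  qed
  have "val_on P (adjoin U t) w'" unfolding val_on_def using w' w'2 wP ker by blast
  then show ?thesis using wU by blast
qed

section \<open>Towers of adjunctions and algebraic independence modulo \<open>P\<close>\<close>

lemma val_on_subset: "val_on P U w \<Longrightarrow> V \<subseteq> U \<Longrightarrow> val_on P V w"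
  unfolding val_on_def by blast

lemma val_on_cong:
  assumes "val_on P U w" "subring_set U" "\<And>a. a \<in> U \<Longrightarrow> w' a = w a" shows "val_on P U w'"
  using assms subring_setD[OF assms(2)] unfolding val_on_def by simp

lemma poly_over_mono: "U \<subseteq> V \<Longrightarrow> poly_over U \<subseteq> poly_over V"
  by (auto simp: poly_over_def)

lemma adjoin_mono: "U \<subseteq> V \<Longrightarrow> adjoin U t \<subseteq> adjoin V t"
  unfolding adjoin_def using poly_over_mono[of U V] by blast

definition adjoin_list :: "'r::comm_ring_1 set \<Rightarrow> 'r list \<Rightarrow> 'r set" where
  "adjoin_list U ts = foldl adjoin U ts"

lemma adjoin_list_Nil [simp]: "adjoin_list U [] = U"
  and adjoin_list_snoc [simp]: "adjoin_list U (ts @ [t]) = adjoin (adjoin_list U ts) t"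
  by (simp_all add: adjoin_list_def)

lemma adjoin_list_mono: "U \<subseteq> V \<Longrightarrow> adjoin_list U ts \<subseteq> adjoin_list V ts"
  by (induction ts rule: rev_induct) (auto dest: adjoin_mono)

context prime_kernel begin

lemma subring_modI: "subring_set U \<Longrightarrow> subring_mod P U"
  by unfold_locales

lemma subring_adjoin_list: "subring_set (U :: 'r set) \<Longrightarrow> subring_set (adjoin_list U ts)"
proof (induction ts rule: rev_induct)
  case (snoc t ts)
  then show ?case using subring_mod.subring_adjoin[OF subring_modI] by simp
qed simp

lemma adjoin_list_base: "subring_set (U :: 'r set) \<Longrightarrow> U \<subseteq> adjoin_list U ts"
proof (induction ts rule: rev_induct)
  case (snoc t ts)
  then show ?case using subring_mod.adjoin_base[OF subring_modI[OF subring_adjoin_list[OF snoc(2), of ts]], of t] by simp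
qed simp

lemma adjoin_list_gen: "subring_set (U :: 'r set) \<Longrightarrow> set ts \<subseteq> adjoin_list U ts"
proof (induction ts rule: rev_induct)
  case (snoc t ts)
  interpret subring_mod P "adjoin_list U ts" by (rule subring_modI[OF subring_adjoin_list[OF snoc(2)]])
  show ?case using snoc adjoin_base[of t] adjoin_gen[of t] by auto
qed simp

lemma transcendental_mono: "U \<subseteq> V \<Longrightarrow> transcendental_over V t \<Longrightarrow> transcendental_over U t"
  unfolding transcendental_over_def using poly_over_mono[of U V] by blast

lemma transcendental_not_mem:
  assumes "subring_set U" "transcendental_over U t" shows "t \<notin> U"
proof
  interpret subring_mod P U by (rule subring_modI[OF assms(1)])
  assume "t \<in> U"
  then have "[:0, 1:] - [:t:] \<in> poly_over U"
    using poly_over_monom[of 1 1] U by (intro poly_over_diff poly_over_const) (auto simp: monom_altdef)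
  moreover have "poly ([:0, 1:] - [:t:]) t \<in> P" using zero_P by simp
  ultimately have "P_poly ([:0, 1:] - [:t:])" using assms(2) unfolding transcendental_over_def by blast
  then have "coeff ([:0, 1:] - [:t:]) 1 \<in> P" unfolding P_poly_def by blast
  then show False using one_P by simp
qed

text \<open>Algebraic independence modulo \<open>P\<close>, in the stepwise form in which Gauss
  norms are iterated.\<close>

definition independent_over where
  "independent_over U ts \<longleftrightarrow> (\<forall>i<length ts. transcendental_over (adjoin_list U (take i ts)) (ts ! i))"

lemma independent_snoc:
  "independent_over U (ts @ [t]) \<longleftrightarrow> independent_over U ts \<and> transcendental_over (adjoin_list U ts) t"
  by (auto simp: independent_over_def nth_append less_Suc_eq)

lemma independent_distinct:
  assumes "subring_set U" "independent_over U ts" shows "distinct ts"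
  using assms(2)
proof (induction ts rule: rev_induct)
  case (snoc t ts)
  then have "t \<notin> adjoin_list U ts"
    using transcendental_not_mem[OF subring_adjoin_list[OF assms(1)]] by (simp add: independent_snoc)
  then show ?case using snoc adjoin_list_gen[OF assms(1), of ts] by (auto simp: independent_snoc)
qed simp

text \<open>Independent lists are distinct, so the number of generators bounds their length and a
  longest extension exists. Over it every generator is algebraic, as it could be appended
  otherwise.\<close>

lemma independent_extend:
  assumes U: "subring_set U" and ts: "independent_over U ts" "set ts \<subseteq> set ss"
  shows "\<exists>us. independent_over U (ts @ us) \<and> set us \<subseteq> set ss \<and>
    (\<forall>s\<in>set ss. \<not> transcendental_over (adjoin_list U (ts @ us)) s)"
proof -
  let ?Q = "\<lambda>us. independent_over U (ts @ us) \<and> set us \<subseteq> set ss"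
  have bound: "length us < Suc (card (set ss))" if "?Q us" for us
  proof -
    have "distinct (ts @ us)" using independent_distinct[OF U] that by blast
    then have "length us = card (set us)" by (simp add: distinct_card)
    then show ?thesis using card_mono[of "set ss" "set us"] that by simp
  qed
  have "?Q []" using ts by simp
  then obtain us where us: "?Q us" and max: "\<And>vs. ?Q vs \<Longrightarrow> length vs \<le> length us"
    using ex_has_greatest_nat[of ?Q "[]" length "Suc (card (set ss))"] bound by (metis less_imp_le)
  have "\<not> transcendental_over (adjoin_list U (ts @ us)) s" if s: "s \<in> set ss" for s
  proof
    assume "transcendental_over (adjoin_list U (ts @ us)) s"
    then have "?Q (us @ [s])" using us s independent_snoc[of U "ts @ us" s] by simp
    then show False using max[of "us @ [s]"] by simp
  qed
  then show ?thesis using us by blast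
qed

lemma algebraic_list_extension:
  assumes sU: "subring_set U" and w: "val_on P U w" and ss: "\<forall>s\<in>set ss. \<not> transcendental_over U s"
  shows "\<exists>w'. val_on P (adjoin_list U ss) w' \<and> (\<forall>a\<in>U. w' a = w a)"
  using ss
proof (induction ss rule: rev_induct)
  case Nil
  then show ?case using w by auto
next
  case (snoc s ss)
  then obtain w1 where w1: "val_on P (adjoin_list U ss) w1" "\<forall>a\<in>U. w1 a = w a" by auto
  have b: "U \<subseteq> adjoin_list U ss" by (rule adjoin_list_base[OF sU])
  interpret valued_subring P "adjoin_list U ss" w1
    by unfold_locales (use w1 subring_adjoin_list[OF sU] in auto)
  have "\<not> transcendental_over (adjoin_list U ss) s" using snoc transcendental_mono[OF b] by auto
  then obtain w2 where "val_on P (adjoin (adjoin_list U ss) s) w2" "\<forall>a\<in>adjoin_list U ss. w2 a = w1 a"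
    using algebraic_extension by blast
  then show ?case using w1 b by (intro exI[of _ w2]) auto
qed

text \<open>Clears an element down the tower, one generator at a time. The consequence in use: a
  prime that contains \<open>P\<close> and is strictly larger on the big ring is strictly larger on
  \<open>U\<close> too.\<close>

lemma algebraic_list_inverse:
  assumes sU: "subring_set U" and ss: "\<forall>s\<in>set ss. \<not> transcendental_over U s"
    and a: "a \<in> adjoin_list U ss" "a \<notin> P"
  shows "\<exists>b. \<exists>c\<in>U - P. a * b - c \<in> P"
  using ss a
proof (induction ss arbitrary: a rule: rev_induct)
  case Nil
  then show ?case using zero_P by (intro exI[of _ 1] bexI[of _ a]) auto
next
  case (snoc s ss)
  interpret subring_mod P "adjoin_list U ss"
    by unfold_locales (use subring_adjoin_list[OF sU] in auto)
  have "\<not> transcendental_over (adjoin_list U ss) s"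
    using snoc transcendental_mono[OF adjoin_list_base[OF sU]] by auto
  then obtain b1 c1 where 1: "c1 \<in> adjoin_list U ss - P" "a * b1 - c1 \<in> P"
    using algebraic_adjoin_inverse snoc(3,4) by (metis adjoin_list_snoc)
  obtain b2 c2 where 2: "c2 \<in> U - P" "c1 * b2 - c2 \<in> P" using snoc(1)[of c1] snoc(2) 1 by auto
  have "a * (b1 * b2) - c2 = b2 * (a * b1 - c1) + (c1 * b2 - c2)" by (simp add: algebra_simps)
  also have "\<dots> \<in> P" by (intro add_P mult_P 1 2)
  finally show ?case using 2 by blast
qed

end

subsection \<open>Independent generators from a chain of primes\<close>

text \<open>A relation over \<open>U[ts]\<close> that holds modulo \<open>P'\<close> has
  coefficients in \<open>P'\<close> by independence, and by induction these already lie in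
  \<open>P\<close>. So the two primes agree on \<open>U[ts]\<close>, and independence carries over
  to the smaller one.\<close>

lemma independent_smaller_prime:
  assumes P: "prime_kernel P" "prime_kernel P'" "P \<subseteq> P'" and U: "subring_set U" "U \<inter> P' \<subseteq> P"
    and ts: "prime_kernel.independent_over P' U ts"
  shows "adjoin_list U ts \<inter> P' \<subseteq> P \<and> prime_kernel.independent_over P U ts"
  using ts
proof (induction ts rule: rev_induct)
  case Nil
  then show ?case using U P by (simp add: prime_kernel.independent_over_def)
next
  case (snoc t ts)
  let ?V = "adjoin_list U ts"
  interpret P: prime_kernel P by fact
  interpret P': prime_kernel P' by fact
  interpret V: subring_mod P ?V by (rule P.subring_modI[OF P.subring_adjoin_list[OF U(1)]])
  have IH: "?V \<inter> P' \<subseteq> P" "P.independent_over U ts" and t: "P'.transcendental_over ?V t"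
    using snoc by (auto simp: P'.independent_snoc)
  have coeffs: "P.P_poly q" if "q \<in> poly_over ?V" "poly q t \<in> P'" for q
  proof -
    have "P'.P_poly q" using t that by (auto simp: P'.transcendental_over_def)
    then show ?thesis using IH(1) that(1) by (auto simp: P.P_poly_def P'.P_poly_def poly_over_def)
  qed
  have "adjoin ?V t \<inter> P' \<subseteq> P" using coeffs V.P_poly_value by (auto simp: adjoin_def)
  moreover have "P.transcendental_over ?V t" using coeffs P(3) by (auto simp: P.transcendental_over_def)
  ultimately show ?case using IH by (simp add: P.independent_snoc)
qed

text \<open>The induction runs down the chain. Some element of the ring vanishes modulo
  \<open>pp (Suc i)\<close> but not modulo \<open>pp i\<close>. Were all generators algebraic modulo
  \<open>pp i\<close> over the part \<open>?V\<close> collected so far, it would divide, modulo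
  \<open>pp i\<close>, an element of \<open>?V\<close> outside \<open>pp i\<close>. That element
  lies in \<open>pp (Suc i)\<close>, yet the two primes agree on \<open>?V\<close>. Hence each step
  yields a new generator.\<close>

lemma independent_from_chain:
  assumes pp: "\<And>i. i \<le> d \<Longrightarrow> prime_kernel (pp i)"
    and sub: "\<And>i. i < d \<Longrightarrow> pp i \<subseteq> pp (Suc i)"
    and strict: "\<And>i. i < d \<Longrightarrow> \<exists>a\<in>adjoin_list U ss. a \<in> pp (Suc i) - pp i"
    and U: "subring_set U" "\<And>i. i < d \<Longrightarrow> U \<inter> pp (Suc i) \<subseteq> pp i"
  shows "\<exists>ts. set ts \<subseteq> set ss \<and> length ts = d \<and> prime_kernel.independent_over (pp 0) U ts"
proof -
  have "\<exists>ts. set ts \<subseteq> set ss \<and> length ts = k \<and> prime_kernel.independent_over (pp (d - k)) U ts" if "k \<le> d" for k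
    using that
  proof (induction k)
    case 0
    then show ?case using prime_kernel.independent_over_def[OF pp] by simp
  next
    case (Suc k)
    then obtain ts where ts: "set ts \<subseteq> set ss" "length ts = k" "prime_kernel.independent_over (pp (d - k)) U ts" by auto
    define i where "i = d - Suc k"
    have i: "d - k = Suc i" "i < d" using Suc by (auto simp: i_def)
    interpret P: prime_kernel "pp i" using pp i by simp
    interpret P': prime_kernel "pp (Suc i)" using pp i by simp
    let ?V = "adjoin_list U ts"
    have V: "?V \<inter> pp (Suc i) \<subseteq> pp i" and ind: "P.independent_over U ts"
      using independent_smaller_prime[OF P.prime_kernel_axioms P'.prime_kernel_axioms sub U(1) U(2)] ts i by auto
    have "\<exists>s\<in>set ss. P.transcendental_over ?V s"
    proof (rule ccontr)
      assume "\<not> ?thesis"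
      then have alg: "\<forall>s\<in>set ss. \<not> P.transcendental_over ?V s" by blast
      obtain a where a: "a \<in> adjoin_list U ss" "a \<in> pp (Suc i) - pp i" using strict i by blast
      have "a \<in> adjoin_list ?V ss" using a adjoin_list_mono[OF P.adjoin_list_base[OF U(1)]] by blast
      then obtain b c where c: "c \<in> ?V - pp i" "a * b - c \<in> pp i"
        using P.algebraic_list_inverse[OF P.subring_adjoin_list[OF U(1)] alg] a by blast
      have "a * b \<in> pp (Suc i)" using a P'.mult_P' by blast
      then have "c \<in> pp (Suc i)" using P'.diff_P_iff[of "a * b" c] c sub i by blast
      then show False using V c by blast
    qed
    then obtain s where "s \<in> set ss" "P.transcendental_over ?V s" by blast
    then show ?case using ts ind P.independent_snoc[of U ts s] unfolding i_def[symmetric]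
      by (intro exI[of _ "ts @ [s]"]) auto
  qed
  from this[of d] show ?thesis by simp
qed

subsection \<open>Families of valuations\<close>

lemma continuous_on_Max_image:
  fixes f :: "'i \<Rightarrow> 'a::topological_space \<Rightarrow> real"
  assumes "finite I" "I \<noteq> {}" "\<And>i. i \<in> I \<Longrightarrow> continuous_on S (f i)"
  shows "continuous_on S (\<lambda>x. Max ((\<lambda>i. f i x) ` I))"
  using assms
proof (induction I rule: finite_ne_induct)
  case (insert i I)
  then have "continuous_on S (\<lambda>x. max (f i x) (Max ((\<lambda>i. f i x) ` I)))"
    by (intro continuous_on_max) auto
  then show ?case using insert by simp
qed simp

text \<open>Coordinates from \<open>n\<close> on are unconstrained, so the weights for a longer list
  serve unchanged for each of its initial segments.\<close>

definition orthant :: "nat \<Rightarrow> (nat \<Rightarrow> real) set" where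
  "orthant n = {r. \<forall>i<n. 0 < r i}"

lemma continuous_on_coordinate: "continuous_on S (\<lambda>r::nat \<Rightarrow> real. r i)"
  by (rule continuous_on_subset[OF continuous_on_product_coordinates]) simp

context prime_kernel begin

lemma gauss_family:
  assumes U: "subring_set U" and w0: "val_on P U w0" and ts: "independent_over U ts"
  shows "\<exists>W :: (nat \<Rightarrow> real) \<Rightarrow> _. (\<forall>r\<in>orthant (length ts). val_on P (adjoin_list U ts) (W r) \<and>
      (\<forall>a\<in>U. W r a = w0 a) \<and> (\<forall>i<length ts. W r (ts ! i) = r i)) \<and>
    (\<forall>a\<in>adjoin_list U ts. continuous_on (orthant (length ts)) (\<lambda>r. W r a))"
  using ts
proof (induction ts rule: rev_induct)
  case Nil
  show ?case using w0 by (intro exI[of _ "\<lambda>_. w0"]) auto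
next
  case (snoc t ts)
  let ?V = "adjoin_list U ts" and ?n = "length ts"
  let ?A = "adjoin ?V t"
  have t: "transcendental_over ?V t" using snoc by (simp add: independent_snoc)
  have "independent_over U ts" using snoc by (simp add: independent_snoc)
  then obtain W where W: "\<And>r. r \<in> orthant ?n \<Longrightarrow> val_on P ?V (W r)"
      "\<And>r a. r \<in> orthant ?n \<Longrightarrow> a \<in> U \<Longrightarrow> W r a = w0 a"
      "\<And>r i. r \<in> orthant ?n \<Longrightarrow> i < ?n \<Longrightarrow> W r (ts ! i) = r i"
    and Wc: "\<And>a. a \<in> ?V \<Longrightarrow> continuous_on (orthant ?n) (\<lambda>r. W r a)"
    using snoc(1) by blast
  \<comment> \<open>The representing polynomial is chosen before \<open>r\<close>. Its Gauss norm is
    then a maximum of finitely many continuous functions of \<open>r\<close>.\<close>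
  define Q where "Q a = (SOME q. q \<in> poly_over ?V \<and> poly q t = a)" for a
  have Q: "Q a \<in> poly_over ?V" "poly (Q a) t = a" if "a \<in> ?A" for a
  proof -
    have "Q a \<in> poly_over ?V \<and> poly (Q a) t = a"
      unfolding Q_def by (rule someI_ex) (use that in \<open>auto simp: adjoin_def\<close>)
    then show "Q a \<in> poly_over ?V" "poly (Q a) t = a" by auto
  qed
  define W' where "W' r a = gauss_norm (W r) (r ?n) (Q a)" for r a
  interpret V: subring_mod P ?V by (rule subring_modI[OF subring_adjoin_list[OF U]])
  have sub: "orthant (Suc ?n) \<subseteq> orthant ?n" by (auto simp: orthant_def)
  have main: "val_on P ?A (W' r) \<and> (\<forall>q\<in>poly_over ?V. W' r (poly q t) = gauss_norm (W r) (r ?n) q)"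
    if r: "r \<in> orthant (Suc ?n)" for r
  proof -
    interpret G: gauss P ?V "W r" "r ?n"
      by unfold_locales (use r sub W(1) in \<open>auto simp: orthant_def\<close>)
    obtain w' where w': "val_on P ?A w'" "\<And>q. q \<in> poly_over ?V \<Longrightarrow> w' (poly q t) = gauss_norm (W r) (r ?n) q"
      using G.transcendental_extension[OF t] by blast
    have e: "W' r a = w' a" if "a \<in> ?A" for a using w'(2)[OF Q(1)[OF that]] Q(2)[OF that] by (simp add: W'_def)
    then have "val_on P ?A (W' r)" using val_on_cong[OF w'(1) V.subring_adjoin] by blast
    then show ?thesis using e w'(2) V.adjoinI by simp
  qed
  have base: "W' r a = W r a" if r: "r \<in> orthant (Suc ?n)" and a: "a \<in> ?V" for r a
  proof -
    have "W' r (poly [:a:] t) = gauss_norm (W r) (r ?n) [:a:]" using main[OF r] V.poly_over_const[OF a] by blast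
    then show ?thesis by (simp add: gauss_norm_def)
  qed
  have Wt: "W' r t = r ?n" if r: "r \<in> orthant (Suc ?n)" for r
  proof -
    have "[:0, 1:] \<in> poly_over ?V" using V.poly_over_monom[OF V.U(1), of 1] by (simp add: monom_altdef)
    then have "W' r (poly [:0, 1:] t) = gauss_norm (W r) (r ?n) [:0, 1:]" using main[OF r] by blast
    moreover have "val_on P ?V (W r)" using W(1) r sub by blast
    then have "W r 0 = 0" "W r 1 = 1" using V.U(2) zero_P by (auto simp: val_on_def)
    moreover have "{..Suc 0} = {0, Suc 0}" by auto
    moreover have "0 < r ?n" using r by (simp add: orthant_def)
    ultimately show ?thesis by (simp add: gauss_norm_def)
  qed
  have cont: "continuous_on (orthant (Suc ?n)) (\<lambda>r. W' r a)" if a: "a \<in> ?A" for a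
    unfolding W'_def gauss_norm_def
  proof (intro continuous_on_Max_image continuous_on_mult continuous_on_power continuous_on_coordinate)
    fix i
    have "coeff (Q a) i \<in> ?V" using Q(1)[OF a] by (simp add: poly_over_def)
    then show "continuous_on (orthant (Suc ?n)) (\<lambda>r. W r (coeff (Q a) i))"
      using continuous_on_subset[OF Wc sub] by blast
  qed auto
  show ?case
  proof (rule exI[of _ W'], intro conjI ballI allI impI)
    fix r i assume r: "r \<in> orthant (length (ts @ [t]))"
    then have r': "r \<in> orthant (Suc ?n)" by simp
    show "val_on P (adjoin_list U (ts @ [t])) (W' r)" using main[OF r'] by simp
    have rn: "r \<in> orthant ?n" using r' sub by blast
    show "W' r a = w0 a" if "a \<in> U" for a
    proof -
      have "a \<in> ?V" using that adjoin_list_base[OF U, of ts] by blast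
      then show ?thesis using base[OF r'] W(2)[OF rn that] by simp
    qed
    show "W' r ((ts @ [t]) ! i) = r i" if "i < length (ts @ [t])"
    proof (cases "i < ?n")
      case True
      then have "ts ! i \<in> ?V" using adjoin_list_gen[OF U, of ts] by auto
      then show ?thesis using base[OF r'] W(3)[OF rn True] True by (simp add: nth_append)
    next
      case False
      then have "i = ?n" using that by simp
      then show ?thesis using Wt[OF r'] by simp
    qed
  next
    fix a assume "a \<in> adjoin_list U (ts @ [t])"
    then show "continuous_on (orthant (length (ts @ [t]))) (\<lambda>r. W' r a)" using cont by simp
  qed
qed

end

lemma (in valued_subring) max_attained_twice:
  assumes "finite I" "\<And>i. i \<in> I \<Longrightarrow> f i \<in> U" "sum f I \<in> P" "i0 \<in> I" "f i0 \<notin> P"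
  shows "\<exists>i\<in>I. \<exists>j\<in>I. i \<noteq> j \<and> f i \<notin> P \<and> w (f j) = w (f i) \<and> (\<forall>k\<in>I. w (f k) \<le> w (f i))"
proof -
  have ne: "I \<noteq> {}" using assms by auto
  have "Max ((\<lambda>i. w (f i)) ` I) \<in> (\<lambda>i. w (f i)) ` I" using assms(1) ne by (intro Max_in) auto
  then obtain i where i: "i \<in> I" "w (f i) = Max ((\<lambda>i. w (f i)) ` I)" by auto
  have le: "w (f k) \<le> w (f i)" if "k \<in> I" for k using that assms(1) i by simp
  have "0 < w (f i0)" using val_nonneg[of "f i0"] val_eq_0[of "f i0"] assms by force
  then have pos: "0 < w (f i)" using le[OF assms(4)] by simp
  then have fi: "f i \<notin> P" using val_eq_0[of "f i"] assms(2) i by force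
  have "\<exists>j\<in>I. i \<noteq> j \<and> w (f j) = w (f i)"
  proof (rule ccontr)
    assume c: "\<not> ?thesis"
    have "w (sum f I) = w (f i)"
    proof (rule val_dominant_sum[OF assms(1,2) i(1)])
      fix j assume "j \<in> I" "j \<noteq> i"
      then show "w (f j) < w (f i)" using le[of j] c by force
    qed
    moreover have "w (sum f I) = 0" using val_eq_0[of "sum f I"] assms subring_set_sum[OF subring] by auto
    ultimately show False using pos by simp
  qed
  then show ?thesis using i fi le by blast
qed

text \<open>For a generator \<open>s\<close> outside \<open>P\<close>, two terms of its equation
  \<open>q s\<close> share the largest value. Comparing \<open>c_i s^i\<close> with
  \<open>c_j s^j\<close> gives \<open>w s\<close> as the root of order \<open>j - i\<close> of
  \<open>w c_i / w c_j\<close>. The coefficients lie in the part generated by \<open>ts\<close>,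
  where values are continuous in \<open>r\<close>, and there are finitely many pairs.\<close>

lemma (in prime_kernel) valuation_family:
  assumes U: "subring_set U" and w0: "val_on P U w0" and ts: "independent_over U ts" "set ts \<subseteq> set ss"
    and alg: "\<forall>s\<in>set ss. \<not> transcendental_over (adjoin_list U ts) s"
  shows "\<exists>H. (\<forall>s\<in>set ss. finite (H s) \<and> (\<forall>h\<in>H s. continuous_on (orthant (length ts)) h)) \<and>
    (\<forall>r\<in>orthant (length ts). \<exists>w. val_on P (adjoin_list U ss) w \<and> (\<forall>a\<in>U. w a = w0 a) \<and>
      (\<forall>i<length ts. w (ts ! i) = r i) \<and> (\<forall>s\<in>set ss. \<exists>h\<in>H s. w s = h r))"
proof -
  let ?V = "adjoin_list U ts" and ?n = "length ts"
  have V: "subring_set ?V" and UV: "U \<subseteq> ?V" and tV: "set ts \<subseteq> ?V"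
    using subring_adjoin_list[OF U] adjoin_list_base[OF U] adjoin_list_gen[OF U] by auto
  let ?R = "adjoin_list ?V ss"
  have VR: "?V \<subseteq> ?R" and sR: "set ss \<subseteq> ?R" using adjoin_list_base[OF V] adjoin_list_gen[OF V] by auto
  obtain W where W: "\<And>r. r \<in> orthant ?n \<Longrightarrow> val_on P ?V (W r)"
      "\<And>r a. r \<in> orthant ?n \<Longrightarrow> a \<in> U \<Longrightarrow> W r a = w0 a"
      "\<And>r i. r \<in> orthant ?n \<Longrightarrow> i < ?n \<Longrightarrow> W r (ts ! i) = r i"
    and Wc: "\<And>a. a \<in> ?V \<Longrightarrow> continuous_on (orthant ?n) (\<lambda>r. W r a)"
    using gauss_family[OF U w0 ts(1)] by blast
  have "\<forall>s\<in>set ss. \<exists>q\<in>poly_over ?V. poly q s \<in> P \<and> \<not> P_poly q" using alg by (auto simp: transcendental_over_def)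
  then obtain q where q: "\<And>s. s \<in> set ss \<Longrightarrow> q s \<in> poly_over ?V" "\<And>s. s \<in> set ss \<Longrightarrow> poly (q s) s \<in> P"
    "\<And>s. s \<in> set ss \<Longrightarrow> \<not> P_poly (q s)" by metis
  define h where "h s i j = (\<lambda>r. root (j - i) (W r (coeff (q s) i) / W r (coeff (q s) j)))" for s and i j :: nat
  \<comment> \<open>The constant 0 serves generators in \<open>P\<close>. Pairs with
    \<open>j \<le> i\<close> have \<open>j - i = 0\<close> and contribute the zero function as well,
    since \<open>root 0\<close> is 0.\<close>
  define H where "H s = insert (\<lambda>_. 0) ((\<lambda>(i,j). h s i j) `
    {(i,j). i \<le> degree (q s) \<and> j \<le> degree (q s) \<and> coeff (q s) j \<notin> P})" for s
  have "finite {(i,j). i \<le> degree (q s) \<and> j \<le> degree (q s) \<and> coeff (q s) j \<notin> P}" for s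
    by (rule finite_subset[of _ "{..degree (q s)} \<times> {..degree (q s)}"]) auto
  then have fin: "finite (H s)" for s by (simp add: H_def)
  have cont: "continuous_on (orthant ?n) g" if s: "s \<in> set ss" and g: "g \<in> H s" for s g
  proof -
    have c: "coeff (q s) i \<in> ?V" for i using q(1)[OF s] by (simp add: poly_over_def)
    have "continuous_on (orthant ?n) (h s i j)" if "coeff (q s) j \<notin> P" for i j
      unfolding h_def
    proof (intro continuous_on_real_root continuous_on_divide Wc c ballI)
      fix r assume "r \<in> orthant ?n"
      then show "W r (coeff (q s) j) \<noteq> 0" using W(1)[of r] c[of j] that by (auto simp: val_on_def)
    qed
    then show ?thesis using g by (auto simp: H_def)
  qed
  have "\<exists>w. val_on P (adjoin_list U ss) w \<and> (\<forall>a\<in>U. w a = w0 a) \<and>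
      (\<forall>i<?n. w (ts ! i) = r i) \<and> (\<forall>s\<in>set ss. \<exists>h\<in>H s. w s = h r)" if r: "r \<in> orthant ?n" for r
  proof -
    obtain w where w: "val_on P ?R w" "\<And>a. a \<in> ?V \<Longrightarrow> w a = W r a"
      using algebraic_list_extension[OF V W(1)[OF r] alg] by blast
    interpret R: valued_subring P ?R w
      by unfold_locales (use w(1) subring_adjoin_list[OF V] in auto)
    have "\<exists>g\<in>H s. w s = g r" if s: "s \<in> set ss" for s
    proof (cases "s \<in> P")
      case True
      then have "w s = 0" using R.val_eq_0 s sR by blast
      then show ?thesis by (auto simp: H_def)
    next
      case False
      let ?c = "coeff (q s)" and ?d = "degree (q s)"
      have sR': "s \<in> ?R" using s sR by blast
      have c: "?c i \<in> ?V" "?c i \<in> ?R" for i using q(1)[OF s] VR by (auto simp: poly_over_def)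
      have ws: "0 < w s" using R.val_nonneg[OF sR'] R.val_eq_0[OF sR'] False by simp
      obtain i0 where i0: "?c i0 \<notin> P" using q(3)[OF s] by (auto simp: P_poly_def)
      have "\<exists>i\<in>{..?d}. \<exists>j\<in>{..?d}. i \<noteq> j \<and> ?c i * s ^ i \<notin> P \<and> w (?c j * s ^ j) = w (?c i * s ^ i) \<and>
          (\<forall>k\<in>{..?d}. w (?c k * s ^ k) \<le> w (?c i * s ^ i))"
      proof (rule R.max_attained_twice)
        show "(\<Sum>i\<le>?d. ?c i * s ^ i) \<in> P" using q(2)[OF s] by (simp add: poly_altdef)
        show "i0 \<in> {..?d}" using i0 zero_P by (metis atMost_iff coeff_eq_0 not_le)
        show "?c i0 * s ^ i0 \<notin> P" using prime_P[of "?c i0" "s ^ i0"] prime_power[of s i0] i0 False by blast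
      qed (use c sR' R.U in auto)
      then obtain i j where ij: "i \<le> ?d" "j \<le> ?d" "i \<noteq> j" "?c i * s ^ i \<notin> P" "w (?c j * s ^ j) = w (?c i * s ^ i)"
        by auto
      have wi: "w (?c k * s ^ k) = w (?c k) * w s ^ k" for k
        using R.val_mult[OF c(2) R.U(7)[OF sR']] R.val_power[OF sR'] by simp
      have pos: "0 < w (?c i) * w s ^ i"
      proof -
        have "?c i * s ^ i \<in> ?R" by (rule R.U(4)[OF c(2) R.U(7)[OF sR']])
        then have "0 \<le> w (?c i * s ^ i)" "w (?c i * s ^ i) \<noteq> 0"
          using ij(4) R.val_nonneg R.val_eq_0 by auto
        then show ?thesis unfolding wi by linarith
      qed
      have *: "w s = h s i j r" if "i < j" "w (?c j) * w s ^ j = w (?c i) * w s ^ i" "0 < w (?c j)" for i j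
      proof -
        have "w s ^ j = w s ^ (j - i) * w s ^ i" using that by (simp add: power_add[symmetric])
        then have "w (?c j) * w s ^ (j - i) = w (?c i)" using that ws by simp
        then have "w (?c i) / w (?c j) = w s ^ (j - i)" using that(3) by (simp add: divide_simps mult.commute)
        then show ?thesis using that ws w(2) c(1) by (simp add: h_def real_root_power_cancel)
      qed
      have pc: "0 < w (?c i)" "0 < w (?c j)"
      proof -
        have sp: "0 < w s ^ k" for k using ws by simp
        show "0 < w (?c i)" by (rule zero_less_mult_pos2[OF pos sp])
        have "0 < w (?c j) * w s ^ j" using pos ij(5) unfolding wi by linarith
        then show "0 < w (?c j)" by (rule zero_less_mult_pos2[OF _ sp])
      qed
      then have nP: "?c i \<notin> P" "?c j \<notin> P" using R.val_eq_0[OF c(2)] by force+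
      show ?thesis
      proof (cases "i < j")
        case True
        then have "w s = h s i j r" using * ij pc unfolding wi by simp
        then show ?thesis using ij nP by (auto simp: H_def)
      next
        case False
        then have "w s = h s j i r" using *[of j i] ij pc unfolding wi by simp
        then show ?thesis using ij nP by (auto simp: H_def)
      qed
    qed
    moreover have "val_on P (adjoin_list U ss) w" using val_on_subset[OF w(1) adjoin_list_mono[OF UV]] .
    moreover have "w a = w0 a" if "a \<in> U" for a using w(2)[of a] W(2)[OF r that] that UV by auto
    moreover have "w (ts ! i) = r i" if "i < ?n" for i
    proof -
      have "ts ! i \<in> ?V" using that tV by auto
      then show ?thesis using w(2) W(3)[OF r that] by simp
    qed
    ultimately show ?thesis by blast
  qed
  then show ?thesis using fin cont by (intro exI[of _ H]) blast
qed

subsection \<open>Covering dimension of sets that contain a cube\<close>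

text \<open>The dimension \<open>e\<close> is a number and not a type, so boxes live in the space of
  all real sequences, with the coordinates from \<open>e\<close> on pinned to 0.\<close>

definition coord_box :: "nat \<Rightarrow> (nat \<Rightarrow> real) \<Rightarrow> (nat \<Rightarrow> real) \<Rightarrow> (nat \<Rightarrow> real) set" where
  "coord_box e a b = {x. (\<forall>i<e. a i \<le> x i \<and> x i \<le> b i) \<and> (\<forall>i\<ge>e. x i = 0)}"

lemma compact_coord_box: "compact (coord_box e a b)"
proof -
  have "coord_box e a b = PiE UNIV (\<lambda>i. if i < e then {a i..b i} else {0})"
    unfolding set_eq_iff coord_box_def PiE_UNIV_domain by (simp add: if_split_mem2 Pi_iff not_less) blast
  moreover have "compactin (product_topology (\<lambda>i. euclidean) UNIV) (PiE UNIV (\<lambda>i::nat. if i < e then {a i..b i} else {0}))"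
    unfolding compactin_PiE by auto
  ultimately show ?thesis by (simp add: euclidean_product_topology)
qed

text \<open>In the metric of the function space the first coordinates enter through twice their
  maximal distance, at most \<open>\<delta> / 4\<close>, and the rest through the tail
  \<open>(1/2) ^ N\<close>, below \<open>\<delta> / 2\<close>.\<close>

lemma dist_fun_small:
  fixes \<delta> :: real assumes "0 < \<delta>"
  shows "\<exists>\<eta>>0. \<forall>x y :: nat \<Rightarrow> real. (\<forall>j. \<bar>x j - y j\<bar> \<le> \<eta>) \<longrightarrow> dist x y < \<delta>"
proof -
  obtain N where N: "(1/2::real) ^ N < \<delta> / 2" using real_arch_pow_inv[of "\<delta>/2" "1/2"] assms by auto
  have "dist x y < \<delta>" if xy: "\<And>j. \<bar>x j - y j\<bar> \<le> \<delta> / 8" for x y :: "nat \<Rightarrow> real"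
  proof -
    let ?D = "{dist (x (from_nat n)) (y (from_nat n)) |n. n \<le> N}"
    have "?D = (\<lambda>n. dist (x (from_nat n)) (y (from_nat n))) ` {..N}" by auto
    then have "finite ?D" "?D \<noteq> {}" by auto
    then have "Max ?D \<le> \<delta> / 8" using xy by (subst Max_le_iff) (auto simp: dist_real_def)
    then show ?thesis using dist_fun_le_dist_first_terms[of x y N] N assms by linarith
  qed
  then show ?thesis using assms by (intro exI[of _ "\<delta>/8"]) auto
qed

text \<open>
  Lebesgue's covering theorem from Kuhn's lemma. A grid point gets the colour of a member of the
  cover around it, where the colour of a set is the first \<open>i\<close> such that it meets the face \<open>x\<^sub>i = b\<^sub>i\<close>.
  The members around the vertices of a cell with all \<open>e + 1\<close> colours are distinct and have a common point.
\<close>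

lemma lebesgue_covering_box:
  assumes ab: "\<And>i. i < e \<Longrightarrow> a i < b i"
    and op: "\<And>k. k \<in> I \<Longrightarrow> openin (top_of_set (coord_box e a b)) (V k)"
    and cov: "coord_box e a b \<subseteq> (\<Union>k\<in>I. V k)"
    and faces: "\<And>k i x y. k \<in> I \<Longrightarrow> i < e \<Longrightarrow> x \<in> V k \<Longrightarrow> y \<in> V k \<Longrightarrow> x i = a i \<Longrightarrow> y i = b i \<Longrightarrow> False"
  shows "\<exists>x\<in>coord_box e a b. \<exists>F\<subseteq>I. finite F \<and> e < card F \<and> (\<forall>k\<in>F. x \<in> V k)"
proof -
  let ?Q = "coord_box e a b"
  define C where "C = {B. open B \<and> (\<exists>k\<in>I. ?Q \<inter> B = V k)}"
  have "(\<lambda>i. if i < e then a i else 0) \<in> ?Q" using ab by (auto simp: coord_box_def intro: less_imp_le)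
  then have Qne: "?Q \<noteq> {}" by blast
  have QC: "?Q \<subseteq> \<Union>C"
  proof
    fix x assume x: "x \<in> ?Q"
    then obtain k where k: "k \<in> I" "x \<in> V k" using cov by auto
    then obtain B where "open B" "V k = ?Q \<inter> B" using op by (auto simp: openin_open)
    then show "x \<in> \<Union>C" using k unfolding C_def by blast
  qed
  then have Cne: "C \<noteq> {}" using Qne by auto
  have opC: "\<And>B. B \<in> C \<Longrightarrow> open B" by (simp add: C_def)
  obtain \<delta> where \<delta>: "0 < \<delta>" "\<And>T. T \<subseteq> ?Q \<Longrightarrow> diameter T < \<delta> \<Longrightarrow> \<exists>B\<in>C. T \<subseteq> B"
    using Lebesgue_number_lemma[OF compact_coord_box Cne QC opC] by metis
  obtain \<eta> where \<eta>: "0 < \<eta>" "\<And>x y :: nat \<Rightarrow> real. \<forall>j. \<bar>x j - y j\<bar> \<le> \<eta> \<Longrightarrow> dist x y < \<delta> / 2"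
    using dist_fun_small[of "\<delta> / 2"] \<delta>(1) by auto
  \<comment> \<open>Every \<open>z\<close> is assigned a member of the cover that contains all
    points of the box within \<open>\<eta> / 2\<close> of \<open>z\<close> in each coordinate. The
    grid will have mesh at most \<open>\<eta> / 2\<close>, so each vertex of a cell lies in the
    members assigned to all the others.\<close>
  have "\<exists>k\<in>I. \<forall>y\<in>?Q. (\<forall>j. \<bar>y j - z j\<bar> \<le> \<eta> / 2) \<longrightarrow> y \<in> V k" for z :: "nat \<Rightarrow> real"
  proof -
    let ?T = "{y \<in> ?Q. \<forall>j. \<bar>y j - z j\<bar> \<le> \<eta> / 2}"
    have d: "dist x y \<le> \<delta> / 2" if "x \<in> ?T" "y \<in> ?T" for x y
    proof -
      have "\<bar>x j - y j\<bar> \<le> \<eta>" for j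
      proof -
        have "\<bar>x j - z j\<bar> \<le> \<eta> / 2" "\<bar>y j - z j\<bar> \<le> \<eta> / 2" using that by auto
        then show ?thesis by linarith
      qed
      then have "dist x y < \<delta> / 2" using \<eta>(2) by blast
      then show ?thesis by simp
    qed
    have "diameter ?T \<le> \<delta> / 2"
    proof (cases "?T = {}")
      case True
      then show ?thesis using \<delta>(1) by (simp only: diameter_empty)
    next
      case False
      have "(SUP (x,y)\<in>?T \<times> ?T. dist x y) \<le> \<delta> / 2"
      proof (rule cSUP_least)
        show "?T \<times> ?T \<noteq> {}" using False by blast
        fix z assume "z \<in> ?T \<times> ?T"
        then obtain x y where "z = (x, y)" "x \<in> ?T" "y \<in> ?T" by blast
        then show "(case z of (x, y) \<Rightarrow> dist x y) \<le> \<delta> / 2" using d[of x y] by simp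
      qed
      then show ?thesis unfolding diameter_def if_not_P[OF False] .
    qed
    then obtain B where "B \<in> C" "?T \<subseteq> B" using \<delta>(1) \<delta>(2)[of ?T] by auto
    then show ?thesis unfolding C_def by blast
  qed
  then obtain \<phi> where \<phi>: "\<And>z. \<phi> z \<in> I" "\<And>z y. y \<in> ?Q \<Longrightarrow> \<forall>j. \<bar>y j - z j\<bar> \<le> \<eta> / 2 \<Longrightarrow> y \<in> V (\<phi> z)"
    by metis
  define L where "L = (\<Sum>j<e. b j - a j)"
  obtain p0 :: nat where p0: "L / (\<eta> / 2) < real p0" using reals_Archimedean2 by blast
  define p where "p = Suc p0"
  have p: "0 < p" "L / real p \<le> \<eta> / 2"
  proof -
    have "L / (\<eta> / 2) \<le> real p" using p0 by (simp add: p_def)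
    then show "L / real p \<le> \<eta> / 2" using \<eta>(1) by (simp add: field_simps p_def)
  qed (simp add: p_def)
  have mesh: "(b j - a j) / p \<le> \<eta> / 2" if "j < e" for j
  proof -
    have "b j - a j \<le> L" unfolding L_def using that ab by (intro member_le_sum) (auto intro: less_imp_le)
    then have "(b j - a j) / p \<le> L / p" using p by (simp add: divide_right_mono)
    then show ?thesis using p by linarith
  qed
  define G where "G q = (\<lambda>j. if j < e then a j + (b j - a j) * (real (q j) / p) else 0)" for q :: "nat \<Rightarrow> nat"
  have GQ: "G q \<in> ?Q" if "\<forall>j<e. q j \<le> p" for q
  proof -
    have "a j \<le> G q j \<and> G q j \<le> b j" if j: "j < e" for j
    proof -
      have s: "0 \<le> real (q j) / p" "real (q j) / p \<le> 1" using j \<open>\<forall>j<e. q j \<le> p\<close> p by auto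
      have d: "0 \<le> b j - a j" using ab[OF j] by simp
      show ?thesis using mult_nonneg_nonneg[OF d s(1)] mult_left_mono[OF s(2) d] j by (simp add: G_def)
    qed
    then show ?thesis by (simp add: coord_box_def) (simp add: G_def)
  qed
  have GV: "G q \<in> V (\<phi> (G q))" if "\<forall>j<e. q j \<le> p" for q
    using \<phi>(2)[OF GQ[OF that], of "G q"] \<eta> by simp
  \<comment> \<open>The value \<open>e\<close> is the colour of sets that miss all upper faces; with
    it there are \<open>e + 1\<close> colours.\<close>
  define \<kappa> where "\<kappa> k = (LEAST i. i = e \<or> i < e \<and> (\<exists>x\<in>V k. x i = b i))" for k
  have \<kappa>: "\<kappa> k = e \<or> \<kappa> k < e \<and> (\<exists>x\<in>V k. x (\<kappa> k) = b (\<kappa> k))" for k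
    unfolding \<kappa>_def by (rule LeastI[of _ e]) simp
  have \<kappa>_le: "\<kappa> k \<le> i" if "i < e" "x \<in> V k" "x i = b i" for k i x
    unfolding \<kappa>_def by (rule Least_le) (use that in blast)
  have \<kappa>_e: "\<kappa> k \<le> e" for k using \<kappa>[of k] by auto
  let ?c = "\<lambda>q. \<kappa> (\<phi> (G q))"
  \<comment> \<open>Kuhn's lemma wants label 0 on the lower and label 1 on the upper face of each
    coordinate, and it counts by the first index with a nonzero label. That index is the colour;
    behind it the labels are free and are chosen to obey the two boundary conditions.\<close>
  define lab where "lab q i = (if i < ?c q then 0 else if i = ?c q \<or> q i \<noteq> 0 then 1 else 0 :: nat)" for q i
  have red: "reduced e (lab q) = ?c q" for q
    by (rule reduced_labelling_unique) (auto simp: lab_def \<kappa>_e)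
  have "odd (card {s. ksimplex p e s \<and> (reduced e \<circ> lab) ` s = {..e}})"
  proof (rule kuhn_combinatorial[OF p(1)])
    show "\<forall>q j. (\<forall>j. q j \<le> p) \<and> j < e \<and> q j = 0 \<longrightarrow> lab q j = 0"
    proof (intro allI impI, elim conjE)
      fix q j assume q: "\<forall>j. q j \<le> p" "j < e" "q j = 0"
      have "j \<noteq> ?c q"
      proof
        assume j: "j = ?c q"
        then obtain y where "y \<in> V (\<phi> (G q))" "y j = b j" using \<kappa>[of "\<phi> (G q)"] q by auto
        moreover have "G q j = a j" using q by (simp add: G_def)
        ultimately show False using faces[OF \<phi>(1) q(2) GV] q by blast
      qed
      then show "lab q j = 0" using q by (simp add: lab_def)
    qed
    show "\<forall>q j. (\<forall>j. q j \<le> p) \<and> j < e \<and> q j = p \<longrightarrow> lab q j = 1"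
    proof (intro allI impI, elim conjE)
      fix q j assume q: "\<forall>j. q j \<le> p" "j < e" "q j = p"
      have "G q j = b j" using q p by (simp add: G_def)
      then have "?c q \<le> j" using \<kappa>_le[OF q(2) GV] q by blast
      then show "lab q j = 1" using q p by (auto simp: lab_def)
    qed
  qed
  then have "{s. ksimplex p e s \<and> (reduced e \<circ> lab) ` s = {..e}} \<noteq> {}" by (rule odd_card_imp_not_empty)
  then obtain s where s: "ksimplex p e s" "(\<lambda>q. reduced e (lab q)) ` s = {..e}" by (auto simp: o_def)
  then have col: "?c ` s = {..e}" by (simp add: red)
  then obtain u0 where u0: "u0 \<in> s" by blast
  obtain base upd where "kuhn_simplex p e base upd s" using s(1) by (auto elim: ksimplex.cases)
  then interpret kuhn_simplex p e base upd s .
  have fin: "finite s" using ksimplex_card[OF s(1)] card.infinite by fastforce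
  have le: "\<forall>j<e. u j \<le> p" if "u \<in> s" for u using s_space that by (auto simp: Pi_iff)
  have "G u0 \<in> V (\<phi> (G u))" if u: "u \<in> s" for u
  proof (rule \<phi>(2)[OF GQ[OF le[OF u0]]], rule allI)
    fix j show "\<bar>G u0 j - G u j\<bar> \<le> \<eta> / 2"
    proof (cases "j < e")
      case True
      have "base j \<le> v j \<and> v j \<le> base j + 1" if "v \<in> s" for v
        using base_le[OF that] le_Suc_base[OF that] by auto
      from this[OF u] this[OF u0] have "\<bar>real (u0 j) - real (u j)\<bar> \<le> 1" by linarith
      moreover have "G u0 j - G u j = (b j - a j) / p * (real (u0 j) - real (u j))"
        using True p by (simp add: G_def field_simps)
      moreover have "0 \<le> (b j - a j) / p" using ab[OF True] by simp
      ultimately have "\<bar>G u0 j - G u j\<bar> \<le> (b j - a j) / p"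
        by (simp only: abs_mult abs_of_nonneg) (metis mult.right_neutral mult_left_mono)
      then show ?thesis using mesh[OF True] by linarith
    qed (use \<eta> in \<open>simp add: G_def\<close>)
  qed
  moreover have "card {..e} \<le> card ((\<lambda>u. \<phi> (G u)) ` s)"
    using col card_image_le[of "(\<lambda>u. \<phi> (G u)) ` s" \<kappa>] fin by (simp add: image_image)
  ultimately show ?thesis
    using GQ[OF le[OF u0]] \<phi>(1) fin by (intro bexI[of _ "G u0"] exI[of _ "(\<lambda>u. \<phi> (G u)) ` s"]) auto
qed

text \<open>A cover of \<open>X\<close> by sets none of which meets two opposite faces is refined,
  and the refinement is pulled back along the section \<open>h\<close> to the box, where Lebesgue's
  theorem finds a point in more than \<open>e\<close> members. This avoids any comparison of the
  dimensions of \<open>X\<close> and of its subspaces.\<close>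

lemma covering_dim_le_section:
  assumes ab: "\<And>i. i < e \<Longrightarrow> a i < b i"
    and h: "continuous_map (top_of_set (coord_box e a b)) X h"
    and \<pi>: "\<And>i. i < e \<Longrightarrow> continuous_map X euclideanreal (\<pi> i)"
    and sect: "\<And>i x. i < e \<Longrightarrow> x \<in> coord_box e a b \<Longrightarrow> \<pi> i (h x) = x i"
    and dim: "covering_dim_le X n"
  shows "int e \<le> n"
proof -
  let ?Q = "coord_box e a b"
  \<comment> \<open>\<open>U \<epsilon>\<close> stays off the face at \<open>a i\<close> for
    \<open>i\<close> in \<open>\<epsilon>\<close> and off the face at \<open>b i\<close> for the
    other \<open>i\<close>, so no subset of it meets both.\<close>
  define u where "u \<epsilon> i = {y \<in> topspace X. \<pi> i y \<in> (if i \<in> \<epsilon> then {a i<..} else {..<b i})}" for \<epsilon> i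
  define U where "U \<epsilon> = (\<Inter>i<e. u \<epsilon> i) \<inter> topspace X" for \<epsilon>
  define \<U> where "\<U> = U ` Pow {..<e}"
  have openU: "openin X (U \<epsilon>)" for \<epsilon>
    unfolding U_def
  proof (rule openin_INT)
    fix i assume "i \<in> {..<e}"
    then show "openin X (u \<epsilon> i)" unfolding u_def
      by (intro openin_continuous_map_preimage[OF \<pi>]) auto
  qed simp
  have cov: "\<Union>\<U> = topspace X"
  proof
    show "topspace X \<subseteq> \<Union>\<U>"
    proof
      fix y assume y: "y \<in> topspace X"
      have "y \<in> U {i. i < e \<and> a i < \<pi> i y}" using y ab by (force simp: U_def u_def)
      moreover have "U {i. i < e \<and> a i < \<pi> i y} \<in> \<U>" unfolding \<U>_def by (rule imageI) auto
      ultimately show "y \<in> \<Union>\<U>" by (rule UnionI[rotated])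
    qed
    show "\<Union>\<U> \<subseteq> topspace X" unfolding \<U>_def U_def by blast
  qed
  have "finite \<U>" "\<forall>V\<in>\<U>. openin X V" using openU by (simp_all add: \<U>_def)
  then have "finite \<U> \<and> (\<forall>V\<in>\<U>. openin X V) \<and> \<Union>\<U> = topspace X" using cov by blast
  from dim[unfolded covering_dim_le_def, THEN spec, THEN mp, OF this]
  obtain \<V> where V: "\<forall>V\<in>\<V>. openin X V" "\<Union>\<V> = topspace X" "\<forall>V\<in>\<V>. \<exists>U\<in>\<U>. V \<subseteq> U"
    "\<forall>p\<in>topspace X. finite {V\<in>\<V>. p \<in> V} \<and> int (card {V\<in>\<V>. p \<in> V}) \<le> n + 1"
    by (elim exE conjE) (rule that)
  have hX: "h x \<in> topspace X" if "x \<in> ?Q" for x using h that by (auto simp: continuous_map_def)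
  have "\<exists>x\<in>?Q. \<exists>F\<subseteq>\<V>. finite F \<and> e < card F \<and> (\<forall>V\<in>F. x \<in> {x \<in> ?Q. h x \<in> V})"
  proof (rule lebesgue_covering_box[OF ab])
    show "openin (top_of_set ?Q) {x \<in> ?Q. h x \<in> V}" if "V \<in> \<V>" for V
    proof -
      have "openin (top_of_set ?Q) {x \<in> topspace (top_of_set ?Q). h x \<in> V}"
        by (rule openin_continuous_map_preimage[OF h]) (use V(1) that in blast)
      then show ?thesis by simp
    qed
    show "?Q \<subseteq> (\<Union>V\<in>\<V>. {x \<in> ?Q. h x \<in> V})"
    proof
      fix x assume x: "x \<in> ?Q"
      then have "h x \<in> \<Union>\<V>" using hX V(2) by simp
      then show "x \<in> (\<Union>V\<in>\<V>. {x \<in> ?Q. h x \<in> V})" using x by auto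
    qed
    fix V i x y assume A: "V \<in> \<V>" "i < e" "x \<in> {x \<in> ?Q. h x \<in> V}" "y \<in> {x \<in> ?Q. h x \<in> V}" "x i = a i" "y i = b i"
    obtain \<epsilon> where "V \<subseteq> U \<epsilon>" using V(3) A(1) unfolding \<U>_def by blast
    then have "h x \<in> u \<epsilon> i" "h y \<in> u \<epsilon> i" using A(2,3,4) by (auto simp: U_def)
    then show False using A sect[of i x] sect[of i y] by (simp add: u_def split: if_splits)
  qed
  then obtain x F where F: "x \<in> ?Q" "F \<subseteq> \<V>" "e < card F" "\<forall>V\<in>F. h x \<in> V" by auto
  have "F \<subseteq> {V\<in>\<V>. h x \<in> V}" using F by auto
  then have "card F \<le> card {V\<in>\<V>. h x \<in> V}" using V(4) hX[OF F(1)] by (intro card_mono) auto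
  moreover have "int (card {V\<in>\<V>. h x \<in> V}) \<le> n + 1" using V(4) hX[OF F(1)] by blast
  ultimately show ?thesis using F(3) by linarith
qed

text \<open>A finite form of Baire's theorem: near a point of the box outside one closed set there
  is a smaller box that avoids this set, and the induction goes on with the remaining sets.\<close>

lemma coord_box_closed_cover:
  assumes "finite I" "\<And>k. k \<in> I \<Longrightarrow> closed (B k)" "coord_box e a b \<subseteq> (\<Union>k\<in>I. B k)" "\<And>i. i < e \<Longrightarrow> a i < b i"
  shows "\<exists>k\<in>I. \<exists>a' b'. (\<forall>i<e. a i \<le> a' i \<and> a' i < b' i \<and> b' i \<le> b i) \<and> coord_box e a' b' \<subseteq> B k"
  using assms
proof (induction I arbitrary: a b rule: finite_induct)
  case empty
  have "(\<lambda>i. if i < e then a i else 0) \<in> coord_box e a b" using empty by (auto simp: coord_box_def intro: less_imp_le)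
  then show ?case using empty by auto
next
  case (insert k I)
  show ?case
  proof (cases "coord_box e a b \<subseteq> B k")
    case True
    then show ?thesis using insert by (intro bexI[of _ k] exI[of _ a] exI[of _ b]) auto
  next
    case False
    then obtain r where r: "r \<in> coord_box e a b" "r \<notin> B k" by auto
    have "open (- B k)" using insert by auto
    then obtain \<delta> where \<delta>: "0 < \<delta>" "ball r \<delta> \<subseteq> - B k" using r(2) open_contains_ball by (metis ComplI)
    obtain \<eta> where \<eta>: "0 < \<eta>" "\<And>x y :: nat \<Rightarrow> real. \<forall>j. \<bar>x j - y j\<bar> \<le> \<eta> \<Longrightarrow> dist x y < \<delta>"
      using dist_fun_small[OF \<delta>(1)] by auto
    define a' where "a' i = max (a i) (r i - \<eta>)" for i
    define b' where "b' i = min (b i) (r i + \<eta>)" for i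
    have ab': "a i \<le> a' i \<and> a' i < b' i \<and> b' i \<le> b i" if "i < e" for i
      using insert(6)[OF that] r(1) \<eta>(1) that by (auto simp: a'_def b'_def coord_box_def)
    have sub: "coord_box e a' b' \<subseteq> coord_box e a b"
      using ab' by (fastforce simp: coord_box_def)
    have "coord_box e a' b' \<inter> B k = {}"
    proof -
      have "x \<notin> B k" if x: "x \<in> coord_box e a' b'" for x
      proof -
        have "\<bar>r j - x j\<bar> \<le> \<eta>" for j
          using x r(1) \<eta>(1) by (cases "j < e") (auto simp: coord_box_def a'_def b'_def abs_le_iff)
        then have "dist r x < \<delta>" using \<eta>(2) by blast
        then show ?thesis using \<delta>(2) by auto
      qed
      then show ?thesis by auto
    qed
    then have "coord_box e a' b' \<subseteq> (\<Union>k\<in>I. B k)" using sub insert(5) by blast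
    then obtain j a'' b'' where j: "j \<in> I" "\<forall>i<e. a' i \<le> a'' i \<and> a'' i < b'' i \<and> b'' i \<le> b' i"
      "coord_box e a'' b'' \<subseteq> B j"
      using insert(3)[of a' b'] insert(4) ab' by auto
    have "a i \<le> a'' i \<and> a'' i < b'' i \<and> b'' i \<le> b i" if "i < e" for i
      using ab'[OF that] j(2)[rule_format, OF that] by linarith
    then show ?thesis using j(1,3) by (intro bexI[of _ j] exI[of _ a''] exI[of _ b'']) auto
  qed
qed

subsection \<open>Tropical null sums and valuations\<close>

text \<open>The maximum disappears: every term is 0 or bounded by another term. For a fixed sum this
  is a finite combination of weak inequalities and so a closed condition on \<open>y\<close>.
  Removing only one copy of \<open>a\<close> accounts for repeated elements.\<close>

lemma tropical_null_iff:
  assumes "\<And>a. a \<in># M \<Longrightarrow> 0 \<le> y a"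
  shows "fsum tropical (image_mset y M) \<in> nullset tropical \<longleftrightarrow>
    (\<forall>a\<in>#M. y a = 0 \<or> (\<exists>b\<in>#M - {#a#}. y a \<le> y b))"
proof -
  let ?L = "filter_mset (\<lambda>c. c \<noteq> 0) (image_mset y M)"
  have L: "fsum tropical (image_mset y M) = ?L" by (simp add: fsum_def tropical_def)
  have pos: "set_mset ?L \<subseteq> {0<..}" using assms by (auto simp: less_le)
  have diff: "image_mset y (M - {#a#}) = image_mset y M - {#y a#}" if "a \<in># M" for a
    using that by (simp add: image_mset_Diff)
  have twice: "c \<in># N - {#c#} \<longleftrightarrow> 2 \<le> count N c" for c :: real and N
    by (auto simp: in_diff_count)
  show ?thesis unfolding L
  proof
    assume n: "?L \<in> nullset tropical"
    show "\<forall>a\<in>#M. y a = 0 \<or> (\<exists>b\<in>#M - {#a#}. y a \<le> y b)"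
    proof (intro ballI, rule disjCI, rule ccontr)
      fix a assume a: "a \<in># M" "y a \<noteq> 0" and no: "\<not> (\<exists>b\<in>#M - {#a#}. y a \<le> y b)"
      let ?m = "Max (set_mset ?L)"
      have aL: "y a \<in># ?L" using a by auto
      then have 2: "2 \<le> count ?L ?m" using n by (auto simp: tropical_def)
      have le: "y a \<le> ?m" using aL by (intro Max_ge) auto
      have "count ?L ?m \<le> count (image_mset y M) ?m" by (simp add: count_filter_mset)
      then have c2: "2 \<le> count (image_mset y M) ?m" using 2 by linarith
      moreover have "count {#y a#} ?m \<le> 1" by simp
      ultimately have "?m \<in># image_mset y M - {#y a#}" unfolding in_diff_count by linarith
      then have "?m \<in># image_mset y (M - {#a#})" by (simp only: diff[OF a(1)])
      then obtain b where "b \<in># M - {#a#}" "?m = y b" unfolding in_image_mset by blast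
      then show False using le no by auto
    qed
  next
    assume r: "\<forall>a\<in>#M. y a = 0 \<or> (\<exists>b\<in>#M - {#a#}. y a \<le> y b)"
    have "2 \<le> count ?L (Max (set_mset ?L))" if ne: "?L \<noteq> {#}"
    proof -
      let ?m = "Max (set_mset ?L)"
      have m: "?m \<in># ?L" using ne by (intro Max_in) auto
      then obtain a where a: "a \<in># M" "?m = y a" "y a \<noteq> 0" by auto
      then obtain b where b: "b \<in># M - {#a#}" "y a \<le> y b" using r by blast
      have "b \<in># M" using b(1) by (rule in_diffD)
      moreover have "0 < y a" using a assms[of a] by simp
      ultimately have "y b \<in># ?L" using b by auto
      then have "y b \<le> ?m" by (intro Max_ge) auto
      then have "y b = y a" using b a by simp
      then have "y a \<in># image_mset y (M - {#a#})" using b(1) by (metis image_eqI in_image_mset)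
      then have "2 \<le> count (image_mset y M) (y a)" unfolding diff[OF a(1)] twice .
      then show ?thesis using a by (simp add: count_filter_mset)
    qed
    moreover have "X \<in> nullset tropical \<longleftrightarrow> set_mset X \<subseteq> {0<..} \<and> (X = {#} \<or> 2 \<le> count X (Max (set_mset X)))" for X
      by (simp add: tropical_def)
    ultimately show "?L \<in> nullset tropical" using pos by blast
  qed
qed

lemma (in valued_subring) val_sum_mset_less:
  assumes "\<And>b. b \<in># M \<Longrightarrow> m b \<in> U" "\<And>b. b \<in># M \<Longrightarrow> w (m b) < B" "0 < B"
  shows "(\<Sum>b\<in>#M. m b) \<in> U \<and> w (\<Sum>b\<in>#M. m b) < B"
  using assms
proof (induction M)
  case (add b M)
  then have IH: "(\<Sum>b\<in>#M. m b) \<in> U" "w (\<Sum>b\<in>#M. m b) < B" and b: "m b \<in> U" "w (m b) < B" by auto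
  have "w (m b + (\<Sum>b\<in>#M. m b)) \<le> max (w (m b)) (w (\<Sum>b\<in>#M. m b))" by (rule val_add[OF b(1) IH(1)])
  also have "\<dots> < B" using IH b by simp
  finally show ?case using IH b U by simp
qed (use val_0 U in auto)

text \<open>Modulo \<open>P\<close> each term is minus the sum of the others, so it cannot be
  strictly larger than all of them.\<close>

lemma (in valued_subring) val_null_sum:
  assumes M: "\<And>b. b \<in># M \<Longrightarrow> m b \<in> U" and P: "(\<Sum>b\<in>#M. m b) \<in> P"
  shows "fsum tropical (image_mset (\<lambda>b. w (m b)) M) \<in> nullset tropical"
proof (subst tropical_null_iff)
  show "\<forall>a\<in>#M. w (m a) = 0 \<or> (\<exists>b\<in>#M - {#a#}. w (m a) \<le> w (m b))"
  proof (intro ballI disjCI, rule ccontr)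
    fix a assume a: "a \<in># M" and no: "\<not> (\<exists>b\<in>#M - {#a#}. w (m a) \<le> w (m b))" and nz: "w (m a) \<noteq> 0"
    let ?s = "\<Sum>b\<in>#M - {#a#}. m b"
    have "0 < w (m a)" using nz val_nonneg[OF M[OF a]] by simp
    then have s: "?s \<in> U" "w ?s < w (m a)"
      using val_sum_mset_less[of "M - {#a#}" m "w (m a)"] M no by (force dest: in_diffD)+
    have "M = add_mset a (M - {#a#})" using a by simp
    then have "(\<Sum>b\<in>#M. m b) = m a + ?s" by (metis image_mset_add_mset sum_mset.add_mset)
    then have "m a - (- ?s) \<in> P" using P by simp
    then have "w (m a) = w (- ?s)" by (rule val_cong[OF M[OF a] U(5)[OF s(1)]])
    then show False using val_minus[OF s(1)] s(2) by simp
  qed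
qed (use M val_nonneg in auto)

lemma valuationD:
  assumes v: "valuation v"
  shows "0 \<le> v a" "v 0 = 0" "v 1 = 1" "v (a * b) = v a * v b" "v a = 0 \<longleftrightarrow> a = 0" "v (a + b) \<le> max (v a) (v b)"
proof -
  have h: "v \<in> band_hom ring_band tropical" using v by (simp add: valuation_def)
  show nn: "0 \<le> v a" for a using h by (auto simp: band_hom_def PiE_iff ring_band_def tropical_def)
  show 0: "v 0 = 0" and 1: "v 1 = 1" and m: "\<And>a b. v (a * b) = v a * v b"
    using h by (auto simp: band_hom_def ring_band_def tropical_def)
  show z: "v a = 0 \<longleftrightarrow> a = 0" for a
  proof
    assume "v a = 0"
    then have "v (a * inverse a) = 0" using m by simp
    then show "a = 0" using 1 by (cases "a = 0") auto
  qed (simp add: 0)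
  have null: "fsum tropical (image_mset v M) \<in> nullset tropical" if "0 \<notin># M" "\<Sum>\<^sub># M = 0" for M
    using h that by (auto simp: band_hom_def ring_band_def)
  have "v (- 1) * v (- 1) = 1" using m[of "- 1" "- 1"] 1 by simp
  then have "v (- 1) = 1" using nn[of "- 1"] by (metis abs_of_nonneg abs_1 abs_mult_self_eq real_sqrt_abs2 real_sqrt_one)
  then have neg: "v (- a) = v a" for a using m[of "- 1" a] by simp
  show "v (a + b) \<le> max (v a) (v b)"
  proof (cases "a = 0 \<or> b = 0 \<or> a + b = 0")
    case True
    then show ?thesis using nn 0 by (auto simp: max_def)
  next
    case False
    \<comment> \<open>The null sum that encodes the ultrametric inequality. Formal sums in a nullset
      have no zero terms, whence the case distinction.\<close>
    let ?M = "{#- (a + b), a, b#}"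
    have "fsum tropical (image_mset v ?M) \<in> nullset tropical" using False by (intro null) auto
    then have "v (- (a + b)) = 0 \<or> (\<exists>c\<in>#?M - {#- (a + b)#}. v (- (a + b)) \<le> v c)"
      by (subst (asm) tropical_null_iff) (auto simp: nn)
    then show ?thesis using False unfolding neg z by auto
  qed
qed

subsection \<open>Presenting the coordinate ring of a fiber by polynomials\<close>

text \<open>Polynomials in the variables \<open>'b\<close> are finitely supported functions on multisets of variables.\<close>

context pointed_monoid begin

text \<open>Variables outside the carrier evaluate to 1. This makes evaluation total, and
  multiplicative on all multisets of the type.\<close>

definition monomial_val :: "'a multiset \<Rightarrow> 'a" where
  "monomial_val M = finprod A (\<lambda>s. (if s \<in> carrier A then s else \<one>) [^] count M s) (set_mset M)"

lemma monomial_val_closed: "monomial_val M \<in> carrier A"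
  unfolding monomial_val_def by (intro finprod_closed) auto

lemma monomial_val_superset:
  assumes "finite F" "set_mset M \<subseteq> F"
  shows "monomial_val M = finprod A (\<lambda>s. (if s \<in> carrier A then s else \<one>) [^] count M s) F"
  unfolding monomial_val_def
  by (rule finprod_mono_neutral_cong_left) (use assms in \<open>auto simp: not_in_iff\<close>)

lemma monomial_val_add: "monomial_val (M + N) = monomial_val M \<otimes> monomial_val N"
proof -
  let ?F = "set_mset M \<union> set_mset N"
  let ?b = "\<lambda>s. if s \<in> carrier A then s else \<one>"
  have "monomial_val (M + N) = finprod A (\<lambda>s. ?b s [^] count M s \<otimes> ?b s [^] count N s) ?F"
    by (subst monomial_val_superset[where F = ?F]) (auto simp: nat_pow_mult)
  also have "\<dots> = finprod A (\<lambda>s. ?b s [^] count M s) ?F \<otimes> finprod A (\<lambda>s. ?b s [^] count N s) ?F"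
    by (rule finprod_multf) auto
  also have "\<dots> = monomial_val M \<otimes> monomial_val N"
    using monomial_val_superset[of ?F M] monomial_val_superset[of ?F N] by simp
  finally show ?thesis .
qed

lemma monomial_val_empty: "monomial_val {#} = \<one>" by (simp add: monomial_val_def)

lemma monomial_val_single: "s \<in> carrier A \<Longrightarrow> monomial_val {#s#} = s" by (simp add: monomial_val_def)

definition poly_val :: "('a multiset \<Rightarrow>\<^sub>0 'k::field) \<Rightarrow> ('a \<Rightarrow>\<^sub>0 'k)" where
  "poly_val p = (\<Sum>M\<in>pm_keys p. alg_monom A (pm_lookup p M) (monomial_val M))"

lemma poly_val_superset:
  "finite F \<Longrightarrow> pm_keys p \<subseteq> F \<Longrightarrow> poly_val p = (\<Sum>M\<in>F. alg_monom A (pm_lookup p M) (monomial_val M))"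
  unfolding poly_val_def by (rule sum.mono_neutral_left) (auto simp: in_keys_iff)

lemma poly_val_add: "poly_val (p + q) = poly_val p + poly_val q"
proof -
  let ?F = "pm_keys p \<union> pm_keys q"
  have "pm_keys (p + q) \<subseteq> ?F" by (rule keys_add)
  then show ?thesis
    using poly_val_superset[of ?F p] poly_val_superset[of ?F q] poly_val_superset[of ?F "p + q"]
    by (simp add: lookup_add alg_monom_add sum.distrib)
qed

lemma poly_val_0: "poly_val 0 = 0" by (simp add: poly_val_def)

lemma poly_val_sum: "poly_val (sum f I) = (\<Sum>i\<in>I. poly_val (f i))"
  by (induction I rule: infinite_finite_induct) (auto simp: poly_val_0 poly_val_add)

lemma poly_val_single: "poly_val (Poly_Mapping.single M c) = alg_monom A c (monomial_val M)"
  by (subst poly_val_superset[where F = "{M}"]) auto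

lemma poly_val_closed: "poly_val p \<in> alg_carrier"
  unfolding poly_val_def by (intro alg_carrier_sum alg_carrier_mon monomial_val_closed)

lemma poly_mapping_decomp: "p = (\<Sum>M\<in>pm_keys p. Poly_Mapping.single M (pm_lookup p M))"
proof (rule poly_mapping_eqI)
  fix k show "pm_lookup p k = pm_lookup (\<Sum>M\<in>pm_keys p. Poly_Mapping.single M (pm_lookup p M)) k"
    by (cases "k \<in> pm_keys p") (auto simp: lookup_sum lookup_single when_def in_keys_iff sum.delta)
qed

lemma poly_val_mult: "poly_val (p * q) = alg_mult A (poly_val p) (poly_val q)"
proof -
  let ?s = "\<lambda>p M. Poly_Mapping.single M (pm_lookup p M)"
  have "poly_val (p * q) = poly_val ((\<Sum>M\<in>pm_keys p. ?s p M) * (\<Sum>N\<in>pm_keys q. ?s q N))"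
    using poly_mapping_decomp[of p] poly_mapping_decomp[of q] by simp
  also have "\<dots> = (\<Sum>M\<in>pm_keys p. \<Sum>N\<in>pm_keys q. alg_mult A (poly_val (?s p M)) (poly_val (?s q N)))"
    by (simp add: sum_product poly_val_sum mult_single poly_val_single alg_mult_mon monomial_val_closed monomial_val_add)
  also have "\<dots> = alg_mult A (poly_val (\<Sum>M\<in>pm_keys p. ?s p M)) (poly_val (\<Sum>N\<in>pm_keys q. ?s q N))"
    by (simp add: poly_val_sum alg_mult_suml alg_mult_sumr) (rule sum.swap)
  also have "\<dots> = alg_mult A (poly_val p) (poly_val q)"
    using poly_mapping_decomp[of p] poly_mapping_decomp[of q] by simp
  finally show ?thesis .
qed

lemma poly_val_1: "poly_val 1 = alg_monom A 1 \<one>"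
  using poly_val_single[of 0 1] by (simp add: monomial_val_empty)

lemma generated_by_monomials:
  assumes "generates A S" "b \<in> carrier A"
  shows "\<exists>M. set_mset M \<subseteq> S \<and> monomial_val M = b"
proof -
  let ?H = "monomial_val ` {M. set_mset M \<subseteq> S}"
  have "submonoid ?H A"
  proof
    show "?H \<subseteq> carrier A" using monomial_val_closed by auto
    show "\<one> \<in> ?H" using monomial_val_empty by (metis (mono_tags, lifting) empty_subsetI imageI mem_Collect_eq set_mset_empty)
    fix x y assume "x \<in> ?H" "y \<in> ?H"
    then obtain M N where "set_mset M \<subseteq> S" "x = monomial_val M" "set_mset N \<subseteq> S" "y = monomial_val N" by auto
    then show "x \<otimes> y \<in> ?H" by (intro image_eqI[of _ _ "M + N"]) (auto simp: monomial_val_add)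
  qed
  moreover have "S \<subseteq> ?H"
  proof
    fix s assume "s \<in> S"
    moreover have "s \<in> carrier A" using assms(1) \<open>s \<in> S\<close> by (auto simp: generates_def)
    ultimately show "s \<in> ?H" by (intro image_eqI[of _ _ "{#s#}"]) (auto simp: monomial_val_single)
  qed
  ultimately have "?H = carrier A" using assms(1) unfolding generates_def by blast
  then have "b \<in> ?H" using assms(2) by simp
  then show ?thesis by auto
qed

end

locale band_fiber = B2: band B2
  for B1 :: "('a, 'm) band_scheme" and B2 :: "('b, 'n) band_scheme" and f :: "'a \<Rightarrow> 'b"
    and x :: "'a \<Rightarrow> 'k::field" +
  assumes f: "f \<in> band_hom B1 B2" and x: "x \<in> band_hom B1 ring_band"
begin

abbreviation "FA \<equiv> fiber_algebra B1 B2 f x"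
abbreviation "cls \<equiv> fiber_class B1 B2 f x"
abbreviation "amon \<equiv> alg_monom B2 :: 'k \<Rightarrow> _"

lemma f_closed: "b \<in> carrier B1 \<Longrightarrow> f b \<in> carrier B2"
  using f by (auto simp: band_hom_def)

text \<open>The two layers of cosets are opened here once; from now on the coordinate ring is known
  only through these five facts.\<close>

lemma fiber_class_props:
  shows fiber_cring: "cring FA"
    and fiber_hom: "cls \<in> ring_hom (monoid_algebra B2) FA"
    and fiber_surj: "X \<in> carrier FA \<Longrightarrow> \<exists>p\<in>B2.alg_carrier. X = cls p"
    and fiber_null: "M \<in> nullset B2 \<Longrightarrow> cls (\<Sum>b\<in>#M. amon 1 b) = \<zero>\<^bsub>FA\<^esub>"
    and fiber_rel: "b \<in> carrier B1 \<Longrightarrow> cls (amon 1 (f b)) = cls (amon (x b) \<one>\<^bsub>B2\<^esub>)"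
proof -
  let ?R = "monoid_algebra B2 :: ('b \<Rightarrow>\<^sub>0 'k) ring"
  let ?I = "null_ideal B2 :: ('b \<Rightarrow>\<^sub>0 'k) set"
  let ?Q = "band_algebra B2 :: ('b \<Rightarrow>\<^sub>0 'k) set ring"
  let ?J = "fiber_ideal B1 B2 f x"
  let ?q = "\<lambda>p. ?I +>\<^bsub>?R\<^esub> p"
  let ?s = "\<lambda>M. \<Sum>b\<in>#M. amon 1 b"
  let ?g = "\<lambda>b. amon 1 (f b) - amon (x b) \<one>\<^bsub>B2\<^esub>"
  have cR: "carrier ?R = B2.alg_carrier" by (simp add: B2.monoid_algebra_eq)
  interpret R: cring ?R by (rule B2.cring_monoid_algebra)
  have nc: "b \<in> carrier B2" if "M \<in> nullset B2" "b \<in># M" for M b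
    using B2.nullset_ideal that by (auto simp: fsum_ideal_def fsums_def)
  have car_s: "?s M \<in> B2.alg_carrier" if "\<And>b. b \<in># M \<Longrightarrow> b \<in> carrier B2" for M
    using that by (induction M) (auto simp: B2.alg_carrier_0 B2.alg_carrier_add B2.alg_carrier_mon)
  have g: "?g b \<in> B2.alg_carrier" if "b \<in> carrier B1" for b
  proof -
    have "- (amon (x b) \<one>\<^bsub>B2\<^esub>) = amon (- x b) \<one>\<^bsub>B2\<^esub>" by (simp add: alg_monom_def single_uminus)
    then have "?g b = amon 1 (f b) + amon (- x b) \<one>\<^bsub>B2\<^esub>" by (metis diff_conv_add_uminus)
    also have "\<dots> \<in> B2.alg_carrier"
      using f_closed[OF that] by (intro B2.alg_carrier_add B2.alg_carrier_mon) auto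
    finally show ?thesis .
  qed
  have G1: "?s ` nullset B2 \<subseteq> carrier ?R" using car_s nc by (auto simp: cR)
  interpret I: ideal ?I ?R unfolding null_ideal_def by (rule R.genideal_ideal[OF G1])
  interpret Q: cring ?Q unfolding band_algebra_def by (rule I.quotient_is_cring[OF R.cring_axioms])
  have q: "?q \<in> ring_hom ?R ?Q" unfolding band_algebra_def by (rule I.rcos_ring_hom)
  have G2: "(\<lambda>b. ?q (?g b)) ` carrier B1 \<subseteq> carrier ?Q"
    using g ring_hom_closed[OF q] by (auto simp: cR)
  interpret J: ideal ?J ?Q unfolding fiber_ideal_def by (rule Q.genideal_ideal[OF G2])
  show F: "cring FA" unfolding fiber_algebra_def by (rule J.quotient_is_cring[OF Q.cring_axioms])
  interpret F: cring FA by (rule F)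
  have qJ: "(\<lambda>X. ?J +>\<^bsub>?Q\<^esub> X) \<in> ring_hom ?Q FA" unfolding fiber_algebra_def by (rule J.rcos_ring_hom)
  show c: "cls \<in> ring_hom ?R FA"
    using ring_hom_trans[OF q qJ] by (simp add: o_def fiber_class_def[abs_def])
  show "\<exists>p\<in>B2.alg_carrier. X = cls p" if X: "X \<in> carrier FA"
  proof -
    obtain Y where Y: "Y \<in> carrier ?Q" "X = ?J +>\<^bsub>?Q\<^esub> Y"
      using X by (auto simp: fiber_algebra_def FactRing_def A_RCOSETS_def')
    obtain p where "p \<in> carrier ?R" "Y = ?q p"
      using Y(1) unfolding band_algebra_def by (auto simp: FactRing_def A_RCOSETS_def')
    then show ?thesis using Y by (auto simp: cR fiber_class_def)
  qed
  have inJ: "cls p = \<zero>\<^bsub>FA\<^esub>" if "?q p \<in> ?J" for p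
    using that by (simp add: fiber_class_def J.a_rcos_const fiber_algebra_def FactRing_def)
  show "cls (?s M) = \<zero>\<^bsub>FA\<^esub>" if M: "M \<in> nullset B2"
  proof (rule inJ)
    have "?s M \<in> ?I" using M R.genideal_self[OF G1] by (auto simp: null_ideal_def)
    then have "?q (?s M) = \<zero>\<^bsub>?Q\<^esub>" by (simp add: I.a_rcos_const band_algebra_def FactRing_def)
    then show "?q (?s M) \<in> ?J" by simp
  qed
  show "cls (amon 1 (f b)) = cls (amon (x b) \<one>\<^bsub>B2\<^esub>)" if b: "b \<in> carrier B1"
  proof -
    have "?q (?g b) \<in> ?J" using b Q.genideal_self[OF G2] unfolding fiber_ideal_def by auto
    then have z: "cls (?g b) = \<zero>\<^bsub>FA\<^esub>" by (rule inJ)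
    have m: "amon (x b) \<one>\<^bsub>B2\<^esub> \<in> B2.alg_carrier" by (simp add: B2.alg_carrier_mon)
    have "cls (?g b + amon (x b) \<one>\<^bsub>B2\<^esub>) = cls (?g b) \<oplus>\<^bsub>FA\<^esub> cls (amon (x b) \<one>\<^bsub>B2\<^esub>)"
      using ring_hom_add[OF c, of "?g b" "amon (x b) \<one>\<^bsub>B2\<^esub>"] g[OF b] m by (simp add: B2.monoid_algebra_eq)
    moreover have "cls (amon (x b) \<one>\<^bsub>B2\<^esub>) \<in> carrier FA" using ring_hom_closed[OF c] m cR by blast
    ultimately show ?thesis using z by simp
  qed
qed

text \<open>A homomorphism from polynomials, a ring that is a type, onto the coordinate ring. Primes
  are pulled back along it, which turns a chain of ideals of the quotient into sets to which
  \<open>prime_kernel\<close> applies.\<close>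

definition \<Phi> where "\<Phi> p = cls (B2.poly_val p)"

lemma \<Phi>_closed: "\<Phi> p \<in> carrier FA"
  using ring_hom_closed[OF fiber_hom] unfolding \<Phi>_def by (simp add: B2.poly_val_closed B2.monoid_algebra_eq)

lemma \<Phi>_add: "\<Phi> (p + q) = \<Phi> p \<oplus>\<^bsub>FA\<^esub> \<Phi> q"
  using ring_hom_add[OF fiber_hom] unfolding \<Phi>_def by (simp add: B2.poly_val_closed B2.monoid_algebra_eq B2.poly_val_add)

lemma \<Phi>_mult: "\<Phi> (p * q) = \<Phi> p \<otimes>\<^bsub>FA\<^esub> \<Phi> q"
  using ring_hom_mult[OF fiber_hom] unfolding \<Phi>_def by (simp add: B2.poly_val_closed B2.monoid_algebra_eq B2.poly_val_mult)

lemma \<Phi>_one: "\<Phi> 1 = \<one>\<^bsub>FA\<^esub>"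
  using ring_hom_one[OF fiber_hom] unfolding \<Phi>_def by (simp add: B2.monoid_algebra_eq B2.poly_val_1)

lemma \<Phi>_zero: "\<Phi> 0 = \<zero>\<^bsub>FA\<^esub>"
proof -
  interpret cring FA by (rule fiber_cring)
  have "\<Phi> 0 = \<Phi> 0 \<oplus>\<^bsub>FA\<^esub> \<Phi> 0" using \<Phi>_add[of 0 0] by simp
  then show ?thesis using \<Phi>_closed[of 0] by (metis add.r_cancel_one')
qed

lemma \<Phi>_minus: "\<Phi> (- p) = \<ominus>\<^bsub>FA\<^esub> \<Phi> p"
proof -
  interpret cring FA by (rule fiber_cring)
  have "\<Phi> (- p) \<oplus>\<^bsub>FA\<^esub> \<Phi> p = \<zero>\<^bsub>FA\<^esub>" using \<Phi>_add[of "- p" p] \<Phi>_zero by simp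
  then show ?thesis using minus_equality[OF _ \<Phi>_closed \<Phi>_closed] by simp
qed

lemma \<Phi>_monomial: "\<Phi> (Poly_Mapping.single M c) = cls (amon c (B2.monomial_val M))"
  by (simp add: \<Phi>_def B2.poly_val_single)

definition pullback where "pullback \<pp> = {p. \<Phi> p \<in> \<pp>}"

lemma prime_pullback:
  assumes "primeideal \<pp> FA" shows "prime_kernel (pullback \<pp>)"
proof
  interpret p: primeideal \<pp> FA by fact
  show "0 \<in> pullback \<pp>" by (simp add: pullback_def \<Phi>_zero)
  show "a + b \<in> pullback \<pp>" if "a \<in> pullback \<pp>" "b \<in> pullback \<pp>" for a b
    using that by (simp add: pullback_def \<Phi>_add)
  show "a * b \<in> pullback \<pp>" if "b \<in> pullback \<pp>" for a b
    using that p.I_l_closed[OF _ \<Phi>_closed] by (simp add: pullback_def \<Phi>_mult)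
  show "1 \<notin> pullback \<pp>"
    using p.one_imp_carrier p.I_notcarr by (auto simp: pullback_def \<Phi>_one)
  show "a \<in> pullback \<pp> \<or> b \<in> pullback \<pp>" if "a * b \<in> pullback \<pp>" for a b
    using that p.I_prime[OF \<Phi>_closed \<Phi>_closed] by (simp add: pullback_def \<Phi>_mult)
qed

lemma pullback_cong:
  assumes "primeideal \<pp> FA" "\<Phi> p = \<Phi> q" shows "p - q \<in> pullback \<pp>"
proof -
  interpret p: primeideal \<pp> FA by fact
  have "\<Phi> (p - q) = \<zero>\<^bsub>FA\<^esub>"
    using \<Phi>_add[of p "- q"] assms(2) \<Phi>_minus[of q] \<Phi>_closed[of q] p.r_neg by simp
  then show ?thesis by (simp add: pullback_def)
qed

definition consts_ring :: "('b multiset \<Rightarrow>\<^sub>0 'k) set" where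
  "consts_ring = range (Poly_Mapping.single 0)"

lemma subring_consts: "subring_set consts_ring"
  unfolding subring_set_def consts_ring_def
proof (intro conjI ballI)
  show "1 \<in> range (Poly_Mapping.single 0)" by (rule image_eqI[of _ _ 1]) simp_all
  fix a b :: "'b multiset \<Rightarrow>\<^sub>0 'k" assume "a \<in> range (Poly_Mapping.single 0)" "b \<in> range (Poly_Mapping.single 0)"
  then obtain c d where cd: "a = Poly_Mapping.single 0 c" "b = Poly_Mapping.single 0 d" by auto
  show "a - b \<in> range (Poly_Mapping.single 0)" by (rule image_eqI[of _ _ "c - d"]) (simp_all add: cd single_diff)
  show "a * b \<in> range (Poly_Mapping.single 0)" by (rule image_eqI[of _ _ "c * d"]) (simp_all add: cd mult_single)
qed

lemma consts_prime:
  assumes "prime_kernel P" shows "Poly_Mapping.single 0 (c::'k) \<in> P \<longleftrightarrow> c = 0"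
proof
  interpret prime_kernel P by fact
  assume "Poly_Mapping.single 0 c \<in> P"
  then have "Poly_Mapping.single 0 (inverse c) * Poly_Mapping.single 0 c \<in> P" by (rule mult_P)
  then show "c = 0" using one_P by (cases "c = 0") (simp_all add: mult_single)
qed (use assms prime_kernel.zero_P in auto)

lemma val_consts:
  assumes P: "prime_kernel P" and v: "valuation v"
  shows "val_on P consts_ring (\<lambda>p. v (pm_lookup p 0))"
  unfolding val_on_def consts_ring_def
  using valuationD[OF v] consts_prime[OF P] by (auto simp: lookup_one mult_single lookup_add)

definition var :: "'b \<Rightarrow> ('b multiset \<Rightarrow>\<^sub>0 'k)" where "var s = Poly_Mapping.single {#s#} 1"

lemma monomial_in_adjoin:
  assumes P: "prime_kernel (P :: ('b multiset \<Rightarrow>\<^sub>0 'k) set)" and ss: "var ` set_mset M \<subseteq> set ss"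
  shows "Poly_Mapping.single M c \<in> adjoin_list consts_ring ss"
  using ss
proof (induction M)
  interpret prime_kernel P by fact
  case empty
  have "Poly_Mapping.single {#} c \<in> consts_ring" unfolding consts_ring_def zero_multiset_def[symmetric] by simp
  then show ?case using adjoin_list_base[OF subring_consts] by blast
next
  interpret prime_kernel P by fact
  case (add s M)
  have "Poly_Mapping.single (add_mset s M) c = var s * Poly_Mapping.single M c"
    by (simp add: var_def mult_single)
  moreover have "var s \<in> adjoin_list consts_ring ss" using add adjoin_list_gen[OF subring_consts, of ss] by auto
  ultimately show ?case using add subring_setD(4)[OF subring_adjoin_list[OF subring_consts]] by auto
qed

text \<open>Every element of \<open>B2\<close> is a monomial in the generators, so the variables
  from \<open>S\<close> suffice. Thus valuations can be built on a finitely generated part of a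
  polynomial ring that has a variable for every element of the type.\<close>

lemma lift_to_adjoin:
  assumes P: "prime_kernel (P :: ('b multiset \<Rightarrow>\<^sub>0 'k) set)" and S: "generates B2 S" and ss: "var ` S \<subseteq> set ss" and X: "X \<in> carrier FA"
  shows "\<exists>p\<in>adjoin_list consts_ring ss. \<Phi> p = X"
proof -
  interpret prime_kernel P by fact
  obtain p where p: "p \<in> B2.alg_carrier" "X = cls p" using fiber_surj[OF X] by blast
  obtain m where m: "\<And>b. b \<in> carrier B2 \<Longrightarrow> set_mset (m b) \<subseteq> S \<and> B2.monomial_val (m b) = b"
    using B2.generated_by_monomials[OF S] by metis
  have k: "b \<in> carrier B2" if "b \<in> pm_keys p" for b using p that by (auto simp: B2.alg_carrier_def)
  let ?l = "\<Sum>b\<in>pm_keys p. Poly_Mapping.single (m b) (pm_lookup p b)"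
  have "B2.poly_val ?l = (\<Sum>b\<in>pm_keys p. amon (pm_lookup p b) b)"
    by (simp add: B2.poly_val_sum B2.poly_val_single m k)
  then have "\<Phi> ?l = X" using B2.decomp[OF p(1)] p(2) by (simp add: \<Phi>_def)
  moreover have "?l \<in> adjoin_list consts_ring ss"
  proof (rule subring_set_sum[OF subring_adjoin_list[OF subring_consts]])
    fix b assume "b \<in> pm_keys p"
    then show "Poly_Mapping.single (m b) (pm_lookup p b) \<in> adjoin_list consts_ring ss"
      using m[OF k] ss by (intro monomial_in_adjoin[OF P]) blast
  qed
  ultimately show ?thesis by blast
qed

end

section \<open>Closedness of the tropical fiber\<close>

lemma hom_fiber_tropicalI:
  assumes "band B2" and y: "y \<in> extensional (carrier B2)" "\<And>b. b \<in> carrier B2 \<Longrightarrow> 0 \<le> y b"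
    "y (pzero B2) = 0" "y \<one>\<^bsub>B2\<^esub> = 1"
    "\<And>a b. a \<in> carrier B2 \<Longrightarrow> b \<in> carrier B2 \<Longrightarrow> y (a \<otimes>\<^bsub>B2\<^esub> b) = y a * y b"
    "\<And>M. M \<in> nullset B2 \<Longrightarrow> fsum tropical (image_mset y M) \<in> nullset tropical"
    and fib: "\<And>a. a \<in> carrier B1 \<Longrightarrow> y (f a) = z a"
  shows "y \<in> hom_fiber B1 B2 tropical f (restrict z (carrier B1))"
proof -
  have "y \<in> band_hom B2 tropical"
    unfolding band_hom_def using y by (auto simp: PiE_iff tropical_def)
  moreover have "precomp B1 f y = restrict z (carrier B1)"
    using fib by (auto simp: precomp_def compose_def restrict_def)
  ultimately show ?thesis by (simp add: hom_fiber_def)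
qed

lemma closed_Collect_on:
  assumes "closed Q"
  shows closed_on_le: "continuous_on Q g \<Longrightarrow> continuous_on Q h \<Longrightarrow> closed {r\<in>Q. g r \<le> (h r :: real)}"
    and closed_on_eq: "continuous_on Q g \<Longrightarrow> continuous_on Q h \<Longrightarrow> closed {r\<in>Q. g r = (h r :: real)}"
    and closed_on_conj: "closed {r\<in>Q. R r} \<Longrightarrow> closed {r\<in>Q. R' r} \<Longrightarrow> closed {r\<in>Q. R r \<and> R' r}"
    and closed_on_disj: "closed {r\<in>Q. R r} \<Longrightarrow> closed {r\<in>Q. R' r} \<Longrightarrow> closed {r\<in>Q. R r \<or> R' r}"
    and closed_on_ball: "(\<And>i. i \<in> I \<Longrightarrow> closed {r\<in>Q. S i r}) \<Longrightarrow> closed {r\<in>Q. \<forall>i\<in>I. S i r}"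
    and closed_on_bex: "finite I \<Longrightarrow> (\<And>i. i \<in> I \<Longrightarrow> closed {r\<in>Q. S i r}) \<Longrightarrow> closed {r\<in>Q. \<exists>i\<in>I. S i r}"
proof -
  show le: "closed {r\<in>Q. g r \<le> (h r :: real)}" if "continuous_on Q g" "continuous_on Q h" for g h
    using that assms by (rule continuous_on_closed_Collect_le)
  show conj: "closed {r\<in>Q. R r \<and> R' r}" if "closed {r\<in>Q. R r}" "closed {r\<in>Q. R' r}" for R R'
  proof -
    have "{r\<in>Q. R r \<and> R' r} = {r\<in>Q. R r} \<inter> {r\<in>Q. R' r}" by auto
    then show ?thesis using that by (simp only: closed_Int)
  qed
  show "closed {r\<in>Q. g r = (h r :: real)}" if "continuous_on Q g" "continuous_on Q h" for g h
    using conj[OF le[OF that] le[OF that(2,1)]] by (simp add: eq_iff)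
  show "closed {r\<in>Q. R r \<or> R' r}" if "closed {r\<in>Q. R r}" "closed {r\<in>Q. R' r}" for R R'
  proof -
    have "{r\<in>Q. R r \<or> R' r} = {r\<in>Q. R r} \<union> {r\<in>Q. R' r}" by auto
    then show ?thesis using that by (simp only: closed_Un)
  qed
  show "closed {r\<in>Q. \<forall>i\<in>I. S i r}" if "\<And>i. i \<in> I \<Longrightarrow> closed {r\<in>Q. S i r}"
  proof -
    have "{r\<in>Q. \<forall>i\<in>I. S i r} = Q \<inter> (\<Inter>i\<in>I. {r\<in>Q. S i r})" by auto
    moreover have "closed (\<Inter>i\<in>I. {r\<in>Q. S i r})" using that by (intro closed_INT) auto
    ultimately show ?thesis using assms by (simp only: closed_Int)
  qed
  show "closed {r\<in>Q. \<exists>i\<in>I. S i r}" if "finite I" "\<And>i. i \<in> I \<Longrightarrow> closed {r\<in>Q. S i r}"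
  proof -
    have "{r\<in>Q. \<exists>i\<in>I. S i r} = (\<Union>i\<in>I. {r\<in>Q. S i r})" by auto
    moreover have "closed (\<Union>i\<in>I. {r\<in>Q. S i r})" using that by (intro closed_UN) auto
    ultimately show ?thesis by simp
  qed
qed

text \<open>The conditions on a point of the fiber are equalities and weak inequalities between
  continuous functions of \<open>r\<close>. Infinitely many may be imposed at once, but each
  disjunction is finite, since a formal sum has finitely many terms.\<close>

lemma closed_hom_fiber:
  fixes Y :: "'r::topological_space \<Rightarrow> 'b \<Rightarrow> real"
  assumes B2: "band B2" and f: "\<And>a. a \<in> carrier B1 \<Longrightarrow> f a \<in> carrier B2"
    and Q: "closed Q" and Y: "\<And>b. b \<in> carrier B2 \<Longrightarrow> continuous_on Q (\<lambda>r. Y r b)"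
  shows "closed {r\<in>Q. restrict (Y r) (carrier B2) \<in> hom_fiber B1 B2 tropical f (restrict z (carrier B1))}"
proof -
  interpret band B2 by fact
  have nc: "b \<in> carrier B2" if "M \<in> nullset B2" "b \<in># M" for M b
    using nullset_ideal that by (auto simp: fsum_ideal_def fsums_def)
  let ?R = "\<lambda>r. (\<forall>b\<in>carrier B2. 0 \<le> Y r b) \<and> Y r (pzero B2) = 0 \<and> Y r \<one>\<^bsub>B2\<^esub> = 1 \<and>
    (\<forall>a\<in>carrier B2. \<forall>b\<in>carrier B2. Y r (a \<otimes>\<^bsub>B2\<^esub> b) = Y r a * Y r b) \<and>
    (\<forall>M\<in>nullset B2. \<forall>a\<in>set_mset M. Y r a = 0 \<or> (\<exists>b\<in>set_mset (M - {#a#}). Y r a \<le> Y r b)) \<and>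
    (\<forall>a\<in>carrier B1. Y r (f a) = z a)"
  have "restrict (Y r) (carrier B2) \<in> hom_fiber B1 B2 tropical f (restrict z (carrier B1)) \<longleftrightarrow> ?R r" for r
  proof
    let ?y = "restrict (Y r) (carrier B2)"
    have im: "image_mset ?y M = image_mset (Y r) M" if "M \<in> nullset B2" for M
      by (rule image_mset_cong) (use nc[OF that] in auto)
    {
      assume h: "?y \<in> hom_fiber B1 B2 tropical f (restrict z (carrier B1))"
      then have b: "?y \<in> band_hom B2 tropical" and p: "precomp B1 f ?y = restrict z (carrier B1)"
        by (auto simp: hom_fiber_def)
      have nn: "\<forall>b\<in>carrier B2. 0 \<le> Y r b" using b by (auto simp: band_hom_def PiE_iff tropical_def)
      have "Y r (f a) = z a" if "a \<in> carrier B1" for a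
        using fun_cong[OF p, of a] that f[OF that] by (simp add: precomp_def compose_def)
      moreover have "\<forall>a\<in>set_mset M. Y r a = 0 \<or> (\<exists>b\<in>set_mset (M - {#a#}). Y r a \<le> Y r b)" if "M \<in> nullset B2" for M
      proof -
        have "fsum tropical (image_mset (Y r) M) \<in> nullset tropical"
          using b that im[OF that] by (auto simp: band_hom_def)
        then show ?thesis using tropical_null_iff[of M "Y r"] nn nc[OF that] by blast
      qed
      moreover have "Y r (pzero B2) = 0" "Y r \<one>\<^bsub>B2\<^esub> = 1" using b pzero_closed by (auto simp: band_hom_def tropical_def)
      moreover have "Y r (a \<otimes>\<^bsub>B2\<^esub> b) = Y r a * Y r b" if "a \<in> carrier B2" "b \<in> carrier B2" for a b
        using b that by (auto simp: band_hom_def tropical_def)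
      ultimately show "?R r" using nn by blast
    }
    assume R: "?R r"
    show "?y \<in> hom_fiber B1 B2 tropical f (restrict z (carrier B1))"
    proof (rule hom_fiber_tropicalI[OF B2])
      fix M assume M: "M \<in> nullset B2"
      show "fsum tropical (image_mset ?y M) \<in> nullset tropical"
        unfolding im[OF M] using tropical_null_iff[of M "Y r"] R nc[OF M] M by blast
    qed (use R pzero_closed f in auto)
  qed
  then have "{r\<in>Q. restrict (Y r) (carrier B2) \<in> hom_fiber B1 B2 tropical f (restrict z (carrier B1))} = {r\<in>Q. ?R r}"
    by simp
  moreover have "closed {r\<in>Q. ?R r}"
    by (intro closed_on_conj closed_on_disj closed_on_ball closed_on_bex closed_on_le closed_on_eq Q
        continuous_on_const continuous_on_mult Y)
      (auto simp: pzero_closed f nc dest: in_diffD)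
  ultimately show ?thesis by simp
qed

section \<open>The dimension inequality\<close>

theorem (in band_fiber) field_fiber_dim_le_tropical:
  assumes v: "valuation v" and S: "finite S" "generates B2 S"
  shows "field_fiber_dim B1 B2 f x \<le> tropical_dim S (hom_fiber B1 B2 tropical f (compose (carrier B1) v x))"
proof -
  let ?z = "\<lambda>a. v (x a)"
  let ?Y = "hom_fiber B1 B2 tropical f (restrict ?z (carrier B1))"
  have z: "compose (carrier B1) v x = restrict ?z (carrier B1)" by (simp add: compose_def restrict_def)
  let ?X = "tropical_space S ?Y"
  have SB: "S \<subseteq> carrier B2" using S by (auto simp: generates_def)
  have main: "int n \<le> m"
    if pp: "\<And>i. i \<le> n \<Longrightarrow> primeideal (\<pp> i) FA" "\<And>i. i < n \<Longrightarrow> \<pp> i \<subset> \<pp> (Suc i)" and dim: "covering_dim_le ?X m"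
    for n \<pp> m
  proof -
    obtain Sl where Sl: "set Sl = S" using S(1) finite_list by auto
    define ss where "ss = map var Sl"
    have ss: "set ss = var ` S" by (simp add: ss_def Sl)
    let ?U = "consts_ring :: ('b multiset \<Rightarrow>\<^sub>0 'k) set"
    let ?R = "adjoin_list ?U ss"
    have pk: "prime_kernel (pullback (\<pp> i))" if "i \<le> n" for i using prime_pullback pp(1) that by simp
    define P where "P = pullback (\<pp> 0)"
    have p0: "primeideal (\<pp> 0) FA" using pp by simp
    interpret P: prime_kernel P unfolding P_def using pk by simp
    have "\<exists>ts. set ts \<subseteq> set ss \<and> length ts = n \<and> prime_kernel.independent_over (pullback (\<pp> 0)) ?U ts"
    proof (rule independent_from_chain[where pp = "\<lambda>i. pullback (\<pp> i)"])
      show "pullback (\<pp> i) \<subseteq> pullback (\<pp> (Suc i))" if "i < n" for i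
        using pp(2)[OF that] by (auto simp: pullback_def)
      show "\<exists>a\<in>?R. a \<in> pullback (\<pp> (Suc i)) - pullback (\<pp> i)" if i: "i < n" for i
      proof -
        interpret q: primeideal "\<pp> (Suc i)" FA using pp(1) i by simp
        obtain X where X: "X \<in> \<pp> (Suc i)" "X \<notin> \<pp> i" using pp(2)[OF i] by auto
        then have "X \<in> carrier FA" using q.a_subset by blast
        then obtain p where "p \<in> ?R" "\<Phi> p = X"
          using lift_to_adjoin[OF P.prime_kernel_axioms S(2), of ss X] ss by auto
        then show ?thesis using X by (auto simp: pullback_def)
      qed
      show "?U \<inter> pullback (\<pp> (Suc i)) \<subseteq> pullback (\<pp> i)" if i: "i < n" for i
        using consts_prime[OF pk[of "Suc i"]] consts_prime[OF pk[of i]] i by (auto simp: consts_ring_def)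
    qed (use pk subring_consts in auto)
    then obtain ts0 where ts0: "set ts0 \<subseteq> set ss" "length ts0 = n" "P.independent_over ?U ts0" by (auto simp: P_def)
    obtain us where us: "P.independent_over ?U (ts0 @ us)" "set us \<subseteq> set ss"
      "\<forall>s\<in>set ss. \<not> P.transcendental_over (adjoin_list ?U (ts0 @ us)) s"
      using P.independent_extend[OF subring_consts ts0(3,1)] by blast
    define ts where "ts = ts0 @ us"
    define e where "e = length ts"
    have ts: "set ts \<subseteq> var ` S" using ts0 us ss by (auto simp: ts_def)
    have ind: "P.independent_over ?U ts" and sub: "set ts \<subseteq> set ss"
      and alg: "\<forall>s\<in>set ss. \<not> P.transcendental_over (adjoin_list ?U ts) s"
      using us ts0 by (auto simp: ts_def)
    from P.valuation_family[OF subring_consts val_consts[OF P.prime_kernel_axioms v] ind sub alg]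
    obtain H where Hc: "\<forall>s\<in>set ss. finite (H s) \<and> (\<forall>h\<in>H s. continuous_on (orthant (length ts)) h)"
      and fam: "\<forall>r\<in>orthant (length ts). \<exists>w. val_on P ?R w \<and> (\<forall>a\<in>?U. w a = v (pm_lookup a 0)) \<and>
        (\<forall>i<length ts. w (ts ! i) = r i) \<and> (\<forall>s\<in>set ss. \<exists>h\<in>H s. w s = h r)"
      by (elim exE conjE) (rule that)
    have H: "\<And>s. s \<in> S \<Longrightarrow> finite (H (var s))"
        "\<And>s h. s \<in> S \<Longrightarrow> h \<in> H (var s) \<Longrightarrow> continuous_on (orthant e) h"
      using Hc ss by (auto simp: e_def)
    have "\<exists>s\<in>S. ts ! i = var s" if "i < e" for i
    proof -
      have "ts ! i \<in> set ts" using that by (simp add: e_def)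
      then show ?thesis using ts by blast
    qed
    then obtain \<sigma> where \<sigma>: "\<And>i. i < e \<Longrightarrow> \<sigma> i \<in> S" "\<And>i. i < e \<Longrightarrow> ts ! i = var (\<sigma> i)" by metis
    obtain Mb where Mb: "\<And>b. b \<in> carrier B2 \<Longrightarrow> set_mset (Mb b) \<subseteq> S" "\<And>b. b \<in> carrier B2 \<Longrightarrow> B2.monomial_val (Mb b) = b"
      using B2.generated_by_monomials[OF S(2)] by metis
    \<comment> \<open>The candidate point for a choice \<open>g\<close> of branches: values on the
      generators, extended by one fixed monomial \<open>Mb b\<close> for every \<open>b\<close>.
      Whether it is a homomorphism depends on \<open>r\<close>.\<close>
    define Yv where "Yv g r b = (\<Prod>s\<in>S. g s r ^ count (Mb b) s)" for g :: "'b \<Rightarrow> (nat \<Rightarrow> real) \<Rightarrow> real" and r b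
    let ?G = "PiE S (\<lambda>s. H (var s))"
    have finG: "finite ?G" using H(1) S by (intro finite_PiE) auto
    let ?one = "\<lambda>i::nat. 1::real" and ?two = "\<lambda>i::nat. 2::real"
    let ?Q = "coord_box e ?one ?two"
    have Qo: "?Q \<subseteq> orthant e" by (auto simp: coord_box_def orthant_def intro: less_le_trans[OF zero_less_one])
    have Qcl: "closed ?Q" using compact_coord_box by (rule compact_imp_closed)
    have gc: "continuous_on ?Q (g s)" if "g \<in> ?G" "s \<in> S" for g s
    proof -
      have "g s \<in> H (var s)" using that by auto
      then show ?thesis using continuous_on_subset[OF H(2)[OF that(2)] Qo] by blast
    qed
    have Yc: "continuous_on ?Q (\<lambda>r. Yv g r b)" if "g \<in> ?G" for g b
      unfolding Yv_def by (intro continuous_on_prod continuous_on_power gc[OF that])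
    \<comment> \<open>The monomial \<open>Mb s\<close> of a generator need not be \<open>s\<close>
      itself, so agreement with \<open>g\<close> on \<open>S\<close> is imposed. The last condition
      says that evaluation at the generators \<open>\<sigma> i\<close> recovers \<open>r\<close>,
      which makes the candidate a section.\<close>
    define Bs where "Bs g = {r\<in>?Q. restrict (Yv g r) (carrier B2) \<in> ?Y \<and> (\<forall>s\<in>S. Yv g r s = g s r) \<and> (\<forall>i\<in>{..<e}. g (\<sigma> i) r = r i)}" for g
    have "closed (Bs g)" if g: "g \<in> ?G" for g
      unfolding Bs_def
      by (intro closed_on_conj closed_on_ball closed_on_eq Qcl closed_hom_fiber[OF B2.band_axioms] f_closed Yc[OF g] gc[OF g] continuous_on_coordinate)
        (use \<sigma> in auto)
    \<comment> \<open>At a single \<open>r\<close> the valuation \<open>w\<close> selects a branch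
      for each generator, and its values on monomials form the candidate point for this
      choice.\<close>
    moreover have "?Q \<subseteq> (\<Union>g\<in>?G. Bs g)"
    proof
      fix r assume r: "r \<in> ?Q"
      obtain w where w: "val_on P ?R w" "\<And>a. a \<in> ?U \<Longrightarrow> w a = v (pm_lookup a 0)"
        "\<And>i. i < e \<Longrightarrow> w (ts ! i) = r i" "\<And>s. s \<in> set ss \<Longrightarrow> \<exists>h\<in>H s. w s = h r"
      proof -
        have "r \<in> orthant (length ts)" using r Qo by (auto simp: e_def)
        from fam[rule_format, OF this] show ?thesis
          using that unfolding e_def[symmetric] by (elim exE conjE) simp
      qed
      interpret R: valued_subring P ?R w
        by unfold_locales (use w(1) P.subring_adjoin_list[OF subring_consts] in auto)
      have "\<forall>s\<in>S. \<exists>h\<in>H (var s). w (var s) = h r" using w(4) ss by auto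
      then obtain g0 where g0: "\<And>s. s \<in> S \<Longrightarrow> g0 s \<in> H (var s)" "\<And>s. s \<in> S \<Longrightarrow> w (var s) = g0 s r" by metis
      define g where "g = restrict g0 S"
      have g: "g \<in> ?G" "\<And>s. s \<in> S \<Longrightarrow> g s r = w (var s)" using g0 by (auto simp: g_def)
      have varR: "var s \<in> ?R" if "s \<in> S" for s
        using that ss P.adjoin_list_gen[OF subring_consts, of ss] by auto
      define m where "m b = Poly_Mapping.single (Mb b) (1::'k)" for b
      have mR: "Poly_Mapping.single M (c::'k) \<in> ?R" if "set_mset M \<subseteq> S" for M c
        using monomial_in_adjoin[OF P.prime_kernel_axioms, of M ss] that ss by blast
      have mbR: "m b \<in> ?R" if "b \<in> carrier B2" for b using mR Mb(1)[OF that] by (simp add: m_def)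
      have wmon: "w (Poly_Mapping.single M 1) = (\<Prod>s\<in>S. w (var s) ^ count M s)" if "set_mset M \<subseteq> S" for M
        using that
      proof (induction M)
        case empty
        then show ?case using R.val_one unfolding zero_multiset_def[symmetric] by simp
      next
        case (add s M)
        then have s: "s \<in> S" "set_mset M \<subseteq> S" by auto
        have "w (var s * Poly_Mapping.single M 1) = w (var s) * w (Poly_Mapping.single M 1)"
          by (intro R.val_mult varR mR s)
        moreover have "(\<Prod>t\<in>S. w (var t) ^ count (add_mset s M) t) = w (var s) * (\<Prod>t\<in>S. w (var t) ^ count M t)"
        proof -
          have "(\<Prod>t\<in>S. w (var t) ^ count (add_mset s M) t) = (\<Prod>t\<in>S. (if t = s then w (var s) else 1) * w (var t) ^ count M t)"
            by (intro prod.cong) auto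
          also have "\<dots> = w (var s) * (\<Prod>t\<in>S. w (var t) ^ count M t)"
            using s S(1) by (simp add: prod.distrib prod.delta)
          finally show ?thesis .
        qed
        ultimately show ?case using add.IH s by (simp add: var_def mult_single)
      qed
      have Yw: "Yv g r b = w (m b)" if "b \<in> carrier B2" for b
        using wmon[OF Mb(1)[OF that]] g(2) by (simp add: Yv_def m_def)
      have \<Phi>m: "\<Phi> (m b) = cls (amon 1 b)" if "b \<in> carrier B2" for b
        using Mb(2)[OF that] by (simp add: m_def \<Phi>_monomial)
      \<comment> \<open>Elements with the same image in the coordinate ring differ by an element of
        \<open>P\<close>, so the relations of the band and of the fiber become equalities of
        values.\<close>
      have cong: "w p = w q" if "\<Phi> p = \<Phi> q" "p \<in> ?R" "q \<in> ?R" for p q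
        using R.val_cong[OF that(2,3)] pullback_cong[OF p0 that(1)] by (simp add: P_def)
      have constR: "Poly_Mapping.single {#} c \<in> ?R" for c :: 'k using mR[of "{#}" c] by simp
      have wconst: "w (Poly_Mapping.single {#} c) = v c" for c
      proof -
        have "Poly_Mapping.single {#} c \<in> ?U" unfolding consts_ring_def zero_multiset_def[symmetric] by simp
        then show ?thesis using w(2) by (simp add: zero_multiset_def[symmetric])
      qed
      have "restrict (Yv g r) (carrier B2) \<in> ?Y"
      proof (rule hom_fiber_tropicalI[OF B2.band_axioms])
        fix b assume "b \<in> carrier B2"
        then show "0 \<le> restrict (Yv g r) (carrier B2) b" using Yw R.val_nonneg mbR by simp
      next
        have "\<Phi> (m (pzero B2)) = \<Phi> 0"
          using \<Phi>m[OF B2.pzero_closed] by (simp add: alg_monom_def \<Phi>_def B2.poly_val_0)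
        then have "w (m (pzero B2)) = w 0" using cong mbR[OF B2.pzero_closed] R.U(2) by blast
        then show "restrict (Yv g r) (carrier B2) (pzero B2) = 0" using Yw B2.pzero_closed R.val_0 by simp
      next
        have "\<Phi> (m \<one>\<^bsub>B2\<^esub>) = \<Phi> 1" using \<Phi>m[OF B2.one_closed] by (simp add: \<Phi>_def B2.poly_val_1)
        then have "w (m \<one>\<^bsub>B2\<^esub>) = w 1" using cong mbR[OF B2.one_closed] R.U(1) by blast
        then show "restrict (Yv g r) (carrier B2) \<one>\<^bsub>B2\<^esub> = 1" using Yw R.val_one by simp
      next
        fix a b assume ab: "a \<in> carrier B2" "b \<in> carrier B2"
        have "\<Phi> (m (a \<otimes>\<^bsub>B2\<^esub> b)) = \<Phi> (m a * m b)"
          using Mb(2)[OF ab(1)] Mb(2)[OF ab(2)] Mb(2)[of "a \<otimes>\<^bsub>B2\<^esub> b"] ab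
          by (simp add: m_def mult_single \<Phi>_monomial B2.monomial_val_add)
        moreover have "m a * m b \<in> ?R" by (intro R.U(4) mbR ab)
        moreover have "m (a \<otimes>\<^bsub>B2\<^esub> b) \<in> ?R" using ab by (intro mbR) simp
        ultimately have "w (m (a \<otimes>\<^bsub>B2\<^esub> b)) = w (m a * m b)" using cong by blast
        then show "restrict (Yv g r) (carrier B2) (a \<otimes>\<^bsub>B2\<^esub> b) = restrict (Yv g r) (carrier B2) a * restrict (Yv g r) (carrier B2) b"
          using Yw ab R.val_mult mbR by simp
      next
        fix M assume M: "M \<in> nullset B2"
        have nc: "b \<in> carrier B2" if "b \<in># M" for b
          using B2.nullset_ideal that M by (auto simp: fsum_ideal_def fsums_def)
        have im: "image_mset (restrict (Yv g r) (carrier B2)) M = image_mset (\<lambda>b. w (m b)) M"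
          by (rule image_mset_cong) (use nc Yw in auto)
        have "B2.poly_val (\<Sum>b\<in>#M. m b) = (\<Sum>b\<in>#M. amon 1 b)" using nc
          by (induction M) (auto simp: B2.poly_val_0 B2.poly_val_add m_def B2.poly_val_single Mb(2))
        then have "\<Phi> (\<Sum>b\<in>#M. m b) = \<Phi> 0" using fiber_null[OF M] by (simp add: \<Phi>_def[of "\<Sum>b\<in>#M. m b"] \<Phi>_zero)
        then have "(\<Sum>b\<in>#M. m b) - 0 \<in> P" unfolding P_def by (rule pullback_cong[OF p0])
        then show "fsum tropical (image_mset (restrict (Yv g r) (carrier B2)) M) \<in> nullset tropical"
          unfolding im using nc mbR by (intro R.val_null_sum) auto
      next
        fix a assume a: "a \<in> carrier B1"
        have "\<Phi> (m (f a)) = \<Phi> (Poly_Mapping.single {#} (x a))"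
          using fiber_rel[OF a] \<Phi>m[OF f_closed[OF a]] by (simp add: \<Phi>_monomial B2.monomial_val_empty)
        then have "w (m (f a)) = w (Poly_Mapping.single {#} (x a))" using cong mbR[OF f_closed[OF a]] constR by blast
        then show "restrict (Yv g r) (carrier B2) (f a) = v (x a)" using Yw f_closed[OF a] wconst by simp
      qed simp
      moreover have Ys: "Yv g r s = g s r" if s: "s \<in> S" for s
      proof -
        have sB: "s \<in> carrier B2" using s SB by blast
        have "\<Phi> (m s) = \<Phi> (var s)" using \<Phi>m[OF sB] by (simp add: var_def \<Phi>_monomial B2.monomial_val_single sB)
        then have "w (m s) = w (var s)" using cong mbR[OF sB] varR[OF s] by blast
        then show ?thesis using Yw[OF sB] g(2)[OF s] by simp
      qed
      moreover have "g (\<sigma> i) r = r i" if "i < e" for i using g(2) \<sigma>[OF that] w(3)[OF that] by simp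
      ultimately show "r \<in> (\<Union>g\<in>?G. Bs g)" using r g(1) by (auto simp: Bs_def)
    qed
    ultimately have "\<exists>g\<in>?G. \<exists>a b. (\<forall>i<e. 1 \<le> a i \<and> a i < b i \<and> b i \<le> 2) \<and> coord_box e a b \<subseteq> Bs g"
      using finG by (intro coord_box_closed_cover) auto
    \<comment> \<open>One choice of branches works on a whole box, and on it the candidate point
      depends continuously on \<open>r\<close>.\<close>
    then obtain g a b where g: "g \<in> ?G" and ab: "\<And>i. i < e \<Longrightarrow> a i < b i" and sub: "coord_box e a b \<subseteq> Bs g" by blast
    let ?h = "\<lambda>r. restrict (restrict (Yv g r) (carrier B2)) S"
    have hY: "?h r \<in> (\<lambda>y. restrict y S) ` ?Y" and hs: "\<And>s. s \<in> S \<Longrightarrow> ?h r s = g s r"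
      and nn: "\<And>s. s \<in> S \<Longrightarrow> 0 \<le> ?h r s" if "r \<in> coord_box e a b" for r
    proof -
      have r: "restrict (Yv g r) (carrier B2) \<in> ?Y" "\<forall>s\<in>S. Yv g r s = g s r" using sub that by (auto simp: Bs_def)
      show "?h r \<in> (\<lambda>y. restrict y S) ` ?Y" using r(1) by blast
      show "?h r s = g s r" if "s \<in> S" for s using r(2) that SB by auto
      show "0 \<le> ?h r s" if s: "s \<in> S" for s
      proof -
        have "restrict (Yv g r) (carrier B2) s \<in> carrier tropical"
          using r(1) s SB by (auto simp: hom_fiber_def band_hom_def PiE_iff)
        then show ?thesis using s by (simp add: tropical_def)
      qed
    qed
    have subQ: "coord_box e a b \<subseteq> ?Q" using sub by (auto simp: Bs_def)
    have "int e \<le> m"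
    proof (rule covering_dim_le_section[OF ab _ _ _ dim, where h = ?h and \<pi> = "\<lambda>i y. y (\<sigma> i)"])
      show "continuous_map (top_of_set (coord_box e a b)) ?X ?h"
        unfolding tropical_space_def
      proof (subst continuous_map_in_subtopology, rule conjI)
        show "continuous_map (top_of_set (coord_box e a b)) (product_topology (\<lambda>_. top_of_set {0..}) S) ?h"
          unfolding continuous_map_componentwise
        proof (intro conjI ballI)
          show "?h ` topspace (top_of_set (coord_box e a b)) \<subseteq> extensional S" by auto
          fix s assume s: "s \<in> S"
          have "continuous_on (coord_box e a b) (\<lambda>r. ?h r s)"
            using continuous_on_subset[OF gc[OF g s] subQ] hs s by (simp cong: continuous_on_cong)
          then show "continuous_map (top_of_set (coord_box e a b)) (top_of_set {0..}) (\<lambda>r. ?h r s)"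
            unfolding continuous_map_in_subtopology using nn s by auto
        qed
        show "?h \<in> topspace (top_of_set (coord_box e a b)) \<rightarrow> (\<lambda>y. restrict y S) ` ?Y" using hY by auto
      qed
      show "continuous_map ?X euclideanreal (\<lambda>y. y (\<sigma> i))" if "i < e" for i
      proof -
        have "continuous_map (product_topology (\<lambda>_. top_of_set {0..}) S) (top_of_set {0..}) (\<lambda>y. y (\<sigma> i) :: real)"
          by (rule continuous_map_product_projection[OF \<sigma>(1)[OF that]])
        then show ?thesis unfolding tropical_space_def
          by (intro continuous_map_from_subtopology) (simp add: continuous_map_in_subtopology)
      qed
      show "?h r (\<sigma> i) = r i" if "i < e" "r \<in> coord_box e a b" for i r
        using hs[OF that(2) \<sigma>(1)[OF that(1)]] sub that by (auto simp: Bs_def)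
    qed
    moreover have "n \<le> e" using ts0 by (simp add: e_def ts_def)
    ultimately show ?thesis by simp
  qed
  show ?thesis
    unfolding field_fiber_dim_def krull_dim_def tropical_dim_def covering_dim_def z
  proof (rule SUP_least, rule INF_greatest)
    fix n m assume "n \<in> {n. \<exists>\<pp>. (\<forall>i\<le>n. primeideal (\<pp> i) FA) \<and> (\<forall>i<n. \<pp> i \<subset> \<pp> (Suc i))}"
      and m: "m \<in> {n. - 1 \<le> n \<and> covering_dim_le ?X n}"
    then obtain \<pp> where "\<forall>i\<le>n. primeideal (\<pp> i) FA" "\<forall>i<n. \<pp> i \<subset> \<pp> (Suc i)" by blast
    then have "int n \<le> m" using main[of n \<pp> m] m by blast
    then show "ereal (real n) \<le> ereal (real_of_int m)" by simp
  qed
qed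

subsection \<open>Bases of matroids\<close>

context matroid begin

lemma finite_indep: "indep M X \<Longrightarrow> finite X"
  using indep_subset_ground ground_finite finite_subset by blast

lemma indep_card_le_rank: assumes "indep M X" shows "card X \<le> rank M"
proof -
  have "finite {X. indep M X}"
    by (rule finite_subset[of _ "Pow (ground M)"]) (use indep_subset_ground ground_finite in auto)
  then show ?thesis unfolding rank_def using assms by (intro Max_ge) auto
qed

lemma ex_indep_rank: "\<exists>X. indep M X \<and> card X = rank M"
proof -
  have "finite {X. indep M X}"
    by (rule finite_subset[of _ "Pow (ground M)"]) (use indep_subset_ground ground_finite in auto)
  then have "rank M \<in> card ` {X. indep M X}" unfolding rank_def
    using indep_empty by (intro Max_in) auto
  then show ?thesis by auto
qed

lemma indep_extend:
  assumes "indep M X" "indep M Y" "card X \<le> card Y"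
  shows "\<exists>W\<subseteq>Y. indep M (X \<union> W) \<and> card (X \<union> W) = card Y"
  using assms
proof (induction "card Y - card X" arbitrary: X)
  case 0
  then show ?case by (intro exI[of _ "{}"]) auto
next
  case (Suc k)
  then have "card X < card Y" by simp
  then obtain e where e: "e \<in> Y - X" "indep M (insert e X)" using indep_augment Suc by blast
  have c: "card (insert e X) = Suc (card X)" using e finite_indep[OF Suc(3)] by simp
  have d: "k = card Y - card (insert e X)" "card (insert e X) \<le> card Y"
    using c Suc(2) \<open>card X < card Y\<close> by auto
  obtain W where "W \<subseteq> Y" "indep M (insert e X \<union> W)" "card (insert e X \<union> W) = card Y"
    using Suc(1)[OF d(1) e(2) Suc(4) d(2)] by auto
  then show ?case using e by (intro exI[of _ "insert e W"]) auto
qed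

lemma basis_iff: "basis M X \<longleftrightarrow> indep M X \<and> card X = rank M"
proof
  assume b: "basis M X"
  then have X: "indep M X" and max: "\<And>Y. X \<subseteq> Y \<Longrightarrow> indep M Y \<Longrightarrow> Y = X"
    using indep_subset_ground by (auto simp: basis_def basis_in_def)
  obtain Y where Y: "indep M Y" "card Y = rank M" using ex_indep_rank by blast
  obtain W where "indep M (X \<union> W)" "card (X \<union> W) = rank M"
    using indep_extend[OF X Y(1)] indep_card_le_rank[OF X] Y(2) by auto
  then show "indep M X \<and> card X = rank M" using max[of "X \<union> W"] X by auto
next
  assume X: "indep M X \<and> card X = rank M"
  have "Y = X" if "X \<subseteq> Y" "indep M Y" for Y
    using card_seteq[OF finite_indep[OF that(2)] that(1)] indep_card_le_rank[OF that(2)] X by simp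
  then show "basis M X" using X indep_subset_ground by (auto simp: basis_def basis_in_def)
qed

text \<open>\<open>Z\<close> consists of the elements of \<open>B0\<close> in the closure of
  \<open>B - {y}\<close>. Since \<open>y\<close> is not in that closure, \<open>Z\<close> together
  with \<open>y\<close> is independent, and its completion by elements of \<open>B0\<close> omits
  some \<open>x\<close> of \<open>B0\<close>. As \<open>x\<close> is outside \<open>Z\<close>, it
  can also replace \<open>y\<close> in \<open>B\<close>.\<close>

lemma symmetric_exchange:
  assumes B0: "basis M B0" and B: "basis M B" and ne: "B \<noteq> B0"
  shows "\<exists>y\<in>B - B0. \<exists>x\<in>B0 - B. basis M (insert y (B0 - {x})) \<and> basis M (insert x (B - {y}))"
proof -
  have i: "indep M B0" "indep M B" "card B0 = rank M" "card B = rank M" using B0 B by (auto simp: basis_iff)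
  have fin: "finite B0" "finite B" using i finite_indep by auto
  have "\<not> B \<subseteq> B0"
  proof
    assume "B \<subseteq> B0"
    then have "B = B0" using card_seteq[OF fin(1), of B] i(3,4) by simp
    then show False using ne by simp
  qed
  then obtain y where y: "y \<in> B - B0" by auto
  let ?I = "B - {y}"
  have I: "indep M ?I" "Suc (card ?I) = rank M"
    using indep_subset[OF i(2), of ?I] y fin i(4) card_Suc_Diff1[of B y] by auto
  define Z where "Z = {x \<in> B0. x \<in> ?I \<or> \<not> indep M (insert x ?I)}"
  have Z: "indep M Z" using indep_subset[OF i(1)] by (auto simp: Z_def)
  have cZ: "card Z \<le> card B" using card_mono[OF fin(1), of Z] i by (auto simp: Z_def)
  obtain W where W: "W \<subseteq> B" "indep M (Z \<union> W)" "card (Z \<union> W) = card B"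
    using indep_extend[OF Z i(2) cZ] by auto
  \<comment> \<open>Otherwise \<open>Z \<union> W\<close> would be an independent set larger than
    \<open>B - {y}\<close>, none of whose elements enlarges \<open>B - {y}\<close> to an independent
    set.\<close>
  have "y \<in> W"
  proof (rule ccontr)
    assume "y \<notin> W"
    then have WI: "W \<subseteq> ?I" using W by auto
    have "card ?I < card (Z \<union> W)" using I W i by simp
    then obtain e where "e \<in> (Z \<union> W) - ?I" "indep M (insert e ?I)" using indep_augment[OF I(1) W(2)] by blast
    then show False using WI by (auto simp: Z_def)
  qed
  then have Zy: "indep M (insert y Z)" using indep_subset[OF W(2)] by auto
  have "card (insert y Z) \<le> card B0" using indep_card_le_rank[OF Zy] i by simp
  then obtain V where V: "V \<subseteq> B0" "indep M (insert y Z \<union> V)" "card (insert y Z \<union> V) = card B0"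
    using indep_extend[OF Zy i(1)] by auto
  let ?B' = "insert y Z \<union> V"
  have sub: "?B' \<subseteq> insert y B0" using V by (auto simp: Z_def)
  have "\<not> B0 \<subseteq> ?B'"
  proof
    assume "B0 \<subseteq> ?B'"
    then have "insert y B0 = ?B'" using sub by auto
    moreover have "card (insert y B0) = Suc (card B0)" using y fin by simp
    ultimately show False using V(3) by simp
  qed
  then obtain x where x: "x \<in> B0" "x \<notin> ?B'" by auto
  have "?B' \<subseteq> insert y (B0 - {x})" using sub x by auto
  moreover have "card (insert y (B0 - {x})) = card B0"
    using x y fin card_Suc_Diff1[of B0 x] by (subst card_insert_disjoint) auto
  ultimately have "?B' = insert y (B0 - {x})"
    using V(3) fin by (intro card_subset_eq) auto
  then have 1: "basis M (insert y (B0 - {x}))" using V i by (simp add: basis_iff)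
  have "x \<notin> Z" using x by auto
  then have xI: "x \<notin> ?I" "indep M (insert x ?I)" using x by (auto simp: Z_def)
  have "x \<notin> B" using xI x y by auto
  moreover have "basis M (insert x ?I)" using xI I fin by (simp add: basis_iff)
  ultimately show ?thesis using 1 x y by blast
qed

text \<open>Coindependence provides a basis that avoids \<open>D\<close>. Completing
  \<open>C\<close> within it reaches the rank of \<open>M\<close> by elements outside
  \<open>D\<close>, so deletion costs no rank.\<close>

lemma rank_minor:
  assumes C: "indep M C" and D: "coindep M D" and disj: "C \<inter> D = {}"
  shows "rank (delete (contract M C) D) = rank M - card C"
proof -
  let ?N = "delete (contract M C) D"
  have bC: "basis_in M C J \<longleftrightarrow> J = C" for J
    using C indep_subset_ground by (auto simp: basis_in_def)
  have N: "indep ?N X \<longleftrightarrow> X \<subseteq> ground M - C - D \<and> indep M (X \<union> C)" for X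
    by (auto simp: delete_def contract_def bC)
  obtain B where B: "basis M B" "D \<subseteq> ground M - B" using D by (auto simp: coindep_def)
  have iB: "indep M B" "card B = rank M" using B by (auto simp: basis_iff)
  obtain W where W: "W \<subseteq> B" "indep M (C \<union> W)" "card (C \<union> W) = rank M"
    using indep_extend[OF C iB(1)] indep_card_le_rank[OF C] iB by auto
  have fin: "finite C" "finite W" using finite_indep C W indep_subset[OF W(2), of W] by auto
  have "W - C \<subseteq> ground M - C - D" using W B indep_subset_ground[OF iB(1)] by auto
  moreover have "W - C \<union> C = C \<union> W" by auto
  ultimately have iN: "indep ?N (W - C)" using N W by simp
  have "C \<union> (W - C) = C \<union> W" by auto
  then have cW: "card (W - C) = rank M - card C"
    using card_Un_disjoint[of C "W - C"] fin W by auto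
  have le: "card X \<le> rank M - card C" if "indep ?N X" for X
  proof -
    have X: "X \<inter> C = {}" "indep M (X \<union> C)" using that N by auto
    have "card (X \<union> C) = card X + card C"
      using X finite_indep[OF X(2)] by (intro card_Un_disjoint) auto
    then show ?thesis using indep_card_le_rank[OF X(2)] by simp
  qed
  have "{X. indep ?N X} \<subseteq> Pow (ground M)" using N by auto
  then have "finite {X. indep ?N X}" using ground_finite finite_subset by blast
  then show ?thesis unfolding rank_def[of ?N]
  proof (intro Max_eqI)
    show "rank M - card C \<in> card ` {X. indep ?N X}" using iN cW by (intro image_eqI[of _ _ "W - C"]) auto
  qed (use le in auto)
qed

end

subsection \<open>Spanning forests\<close>

text \<open>
  Among the sets of edges on which every function is a coboundary, a maximal one spans: an edge between
  different components could be added, since a potential may be rescaled on one component.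
\<close>

lemma spanning_forest:
  fixes Eg :: "('v \<times> 'v) set"
  assumes fin: "finite Eg"
  shows "\<exists>T\<subseteq>Eg. (\<forall>g :: 'v \<times> 'v \<Rightarrow> 'l::field. (\<forall>e. g e \<noteq> 0) \<longrightarrow>
      (\<exists>t. (\<forall>v. t v \<noteq> 0) \<and> (\<forall>(x,y)\<in>T. t y = g (x,y) * t x))) \<and> Eg \<subseteq> (T \<union> T\<inverse>)\<^sup>*"
proof -
  define Fr where "Fr T \<longleftrightarrow> (\<forall>g :: 'v \<times> 'v \<Rightarrow> 'l. (\<forall>e. g e \<noteq> 0) \<longrightarrow>
      (\<exists>t. (\<forall>v. t v \<noteq> 0) \<and> (\<forall>(x,y)\<in>T. t y = g (x,y) * t x)))" for T
  have "finite {T. T \<subseteq> Eg \<and> Fr T}" using fin by simp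
  moreover have "{} \<in> {T. T \<subseteq> Eg \<and> Fr T}" by (auto simp: Fr_def intro!: exI[of _ "\<lambda>_. 1"])
  ultimately obtain T where T: "T \<subseteq> Eg" "Fr T" and max: "\<And>T'. T' \<subseteq> Eg \<Longrightarrow> Fr T' \<Longrightarrow> T \<subseteq> T' \<Longrightarrow> T' = T"
    using finite_has_maximal[of "{T. T \<subseteq> Eg \<and> Fr T}"] by (metis (mono_tags, lifting) empty_iff mem_Collect_eq)
  let ?C = "(T \<union> T\<inverse>)\<^sup>*"
  have "e \<in> ?C" if e: "e \<in> Eg" for e
  proof (rule ccontr)
    assume n: "e \<notin> ?C"
    obtain x y where xy: "e = (x, y)" by fastforce
    have "Fr (insert e T)" unfolding Fr_def
    proof (intro allI impI)
      fix g :: "'v \<times> 'v \<Rightarrow> 'l" assume g: "\<forall>e. g e \<noteq> 0"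
      then obtain t where t: "\<forall>v. t v \<noteq> 0" "\<forall>(x,y)\<in>T. t y = g (x,y) * t x" using T(2) unfolding Fr_def by blast
      \<comment> \<open>The factor by which the potential on the component of \<open>y\<close> has
        to change so that the new edge is satisfied; \<open>x\<close> lies in another component and
        keeps its value.\<close>
      define k where "k = g (x,y) * t x / t y"
      define t' where "t' v = (if (y, v) \<in> ?C then k * t v else t v)" for v
      have k: "k \<noteq> 0" using g t by (simp add: k_def)
      have "(x, x) \<in> ?C" by simp
      have ny: "(y, x) \<notin> ?C"
      proof
        assume "(y, x) \<in> ?C"
        then have "(x, y) \<in> ?C\<inverse>" by simp
        also have "?C\<inverse> = ?C" by (simp add: rtrancl_converse[symmetric] converse_Un Un_commute)
        finally show False using n xy by simp
      qed
      have 1: "t' v = g (u, v) * t' u" if uv: "(u, v) \<in> T" for u v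
      proof -
        have "(u, v) \<in> ?C" "(v, u) \<in> ?C" using uv by auto
        then have "(y, u) \<in> ?C \<longleftrightarrow> (y, v) \<in> ?C" by (meson rtrancl_trans)
        then show ?thesis using t(2) uv by (auto simp: t'_def)
      qed
      have 2: "t' y = g (x, y) * t' x" using ny t by (simp add: t'_def k_def)
      have "\<forall>(x,y)\<in>insert e T. t' y = g (x,y) * t' x" using 1 2 xy by blast
      moreover have "\<forall>v. t' v \<noteq> 0" using k t by (simp add: t'_def)
      ultimately show "\<exists>t. (\<forall>v. t v \<noteq> 0) \<and> (\<forall>(x,y)\<in>insert e T. t y = g (x,y) * t x)"
        by blast
    qed
    then have "insert e T = T" using max[of "insert e T"] T e by blast
    then have "e \<in> T" by auto
    then show False using n by auto
  qed
  then show ?thesis using T unfolding Fr_def by blast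
qed

subsection \<open>Rescaling over fields and over the tropical hyperfield\<close>

lemma neg_ring_band: "neg ring_band a = - (a :: 'k::comm_ring_1)"
  unfolding neg_def
  by (rule the_equality) (auto simp: ring_band_def fsum_def eq_neg_iff_add_eq_0 add.commute split: if_splits)

lemma neg_tropical: assumes "0 \<le> a" shows "neg tropical a = a"
proof -
  interpret band tropical by (rule band_tropical)
  have "\<exists>!b. b \<in> carrier tropical \<and> fsum tropical {#a, b#} \<in> nullset tropical"
    using assms by (intro ex1_neg) (simp add: tropical_def)
  moreover have "a \<in> carrier tropical \<and> fsum tropical {#a, a#} \<in> nullset tropical"
    using assms by (auto simp: tropical_def fsum_def)
  ultimately show ?thesis unfolding neg_def by (rule the1_equality)
qed

lemma finprod_ring_band: "finite I \<Longrightarrow> finprod ring_band f I = (\<Prod>i\<in>I. f i :: 'k::comm_ring_1)"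
proof (induction I rule: finite_induct)
  interpret band "ring_band :: 'k band" by (rule band_ring_band)
  have c: "carrier (ring_band :: 'k band) = UNIV" by (simp add: ring_band_def)
  { case empty show ?case by (simp only: finprod_empty) (simp add: ring_band_def) }
  { case (insert i I) then show ?case using finprod_insert[of I i f] c by (simp add: ring_band_def) }
qed

lemma finprod_tropical:
  "finite I \<Longrightarrow> (\<And>i. i \<in> I \<Longrightarrow> 0 \<le> f i) \<Longrightarrow> finprod tropical f I = (\<Prod>i\<in>I. f i)"
proof (induction I rule: finite_induct)
  interpret band tropical by (rule band_tropical)
  { case empty show ?case by (simp only: finprod_empty) (simp add: tropical_def) }
  { case (insert i I)
    then have "f \<in> I \<rightarrow> carrier tropical" "f i \<in> carrier tropical" by (auto simp: tropical_def)
    then have "finprod tropical f (insert i I) = f i \<otimes>\<^bsub>tropical\<^esub> finprod tropical f I"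
      using insert by (intro finprod_insert) auto
    then show ?case using insert by (simp add: tropical_def) }
qed

text \<open>Treats both bands at once: \<open>G\<close> is the set of nonzero elements, which for
  the tropical hyperfield is \<open>{0<..}\<close> inside the field of reals with its usual
  product.\<close>

definition rescaled :: "'a::field set \<Rightarrow> 'e set \<Rightarrow> nat \<Rightarrow> ('e list \<Rightarrow> 'a) \<Rightarrow> ('e list \<Rightarrow> 'a) \<Rightarrow> bool" where
  "rescaled G E n \<Delta> \<Delta>' \<longleftrightarrow> (\<exists>c\<in>G. \<exists>t\<in>E \<rightarrow> G. \<forall>xs\<in>tuples E n. \<Delta>' xs = c * (\<Prod>i<n. t (xs ! i)) * \<Delta> xs)"

lemma tuples_nth: "xs \<in> tuples E n \<Longrightarrow> i < n \<Longrightarrow> xs ! i \<in> E"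
  by (auto simp: tuples_def)

lemma rescaling_field_iff:
  "(\<Delta>, \<Delta>') \<in> rescaling M (ring_band :: 'l::field band) \<longleftrightarrow>
    \<Delta> \<in> weak_reps M ring_band \<and> \<Delta>' \<in> weak_reps M ring_band \<and> rescaled (- {0}) (ground M) (rank M) \<Delta> \<Delta>'"
proof -
  have "carrier ring_band - {pzero ring_band} = (- {0} :: 'l set)" "(\<otimes>\<^bsub>ring_band\<^esub>) = ((*) :: 'l \<Rightarrow> _)"
    by (auto simp: ring_band_def)
  then show ?thesis unfolding rescaling_def rescaled_def by (simp add: finprod_ring_band)
qed

lemma rescaling_tropical_iff:
  "(\<Delta>, \<Delta>') \<in> rescaling M tropical \<longleftrightarrow>
    \<Delta> \<in> weak_reps M tropical \<and> \<Delta>' \<in> weak_reps M tropical \<and> rescaled {0<..} (ground M) (rank M) \<Delta> \<Delta>'"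
proof -
  have c: "carrier tropical - {pzero tropical} = {0<..}" "(\<otimes>\<^bsub>tropical\<^esub>) = (*)"
    by (auto simp: tropical_def)
  have "finprod tropical (\<lambda>i. t (xs ! i)) {..<rank M} = (\<Prod>i<rank M. t (xs ! i))"
    if "t \<in> ground M \<rightarrow> {0<..}" "xs \<in> tuples (ground M) (rank M)" for t xs
    using that tuples_nth[OF that(2)] by (intro finprod_tropical) (auto intro!: less_imp_le)
  then show ?thesis unfolding rescaling_def rescaled_def c by (auto cong: bex_cong ball_cong)
qed

lemma rescaled_refl: "1 \<in> G \<Longrightarrow> rescaled G E n \<Delta> \<Delta>"
  unfolding rescaled_def by (rule bexI[of _ 1], rule bexI[of _ "\<lambda>_. 1"]) auto

lemma rescaled_sym:
  assumes G: "\<And>x. x \<in> G \<Longrightarrow> inverse x \<in> G" "0 \<notin> G" and r: "rescaled G E n \<Delta> \<Delta>'"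
  shows "rescaled G E n \<Delta>' \<Delta>"
proof -
  obtain c t where c: "c \<in> G" and t: "t \<in> E \<rightarrow> G" and e: "\<And>xs. xs \<in> tuples E n \<Longrightarrow> \<Delta>' xs = c * (\<Prod>i<n. t (xs ! i)) * \<Delta> xs"
    using r unfolding rescaled_def by blast
  have "\<Delta> xs = inverse c * (\<Prod>i<n. inverse (t (xs ! i))) * \<Delta>' xs" if xs: "xs \<in> tuples E n" for xs
  proof -
    have "t (xs ! i) \<noteq> 0" if "i < n" for i using tuples_nth[OF xs that] t G(2) by (metis Pi_mem)
    then have p: "(\<Prod>i<n. t (xs ! i)) \<noteq> 0" by simp
    have c0: "c \<noteq> 0" using c G(2) by auto
    have inv: "(\<Prod>i<n. inverse (t (xs ! i))) = inverse (\<Prod>i<n. t (xs ! i))"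
      using prod_inversef[of "\<lambda>i. t (xs ! i)" "{..<n}"] by (simp add: o_def)
    have "inverse c * inverse q * (c * q * d) = d" if "q \<noteq> 0" for q d using c0 that by (simp add: field_simps)
    from this[OF p] show ?thesis unfolding e[OF xs] inv by simp
  qed
  moreover have "(\<lambda>e. inverse (t e)) \<in> E \<rightarrow> G" using t G(1) by auto
  ultimately show ?thesis unfolding rescaled_def using G(1)[OF c]
    by (intro bexI[of _ "inverse c"] bexI[of _ "\<lambda>e. inverse (t e)"] ballI)
qed

lemma rescaled_trans:
  assumes G: "\<And>x y. x \<in> G \<Longrightarrow> y \<in> G \<Longrightarrow> x * y \<in> G" and r: "rescaled G E n \<Delta> \<Delta>'" "rescaled G E n \<Delta>' \<Delta>''"
  shows "rescaled G E n \<Delta> \<Delta>''"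
proof -
  obtain c t where c: "c \<in> G" and t: "t \<in> E \<rightarrow> G" and e: "\<And>xs. xs \<in> tuples E n \<Longrightarrow> \<Delta>' xs = c * (\<Prod>i<n. t (xs ! i)) * \<Delta> xs"
    using r(1) unfolding rescaled_def by blast
  obtain c' t' where c': "c' \<in> G" and t': "t' \<in> E \<rightarrow> G" and e': "\<And>xs. xs \<in> tuples E n \<Longrightarrow> \<Delta>'' xs = c' * (\<Prod>i<n. t' (xs ! i)) * \<Delta>' xs"
    using r(2) unfolding rescaled_def by blast
  have "\<Delta>'' xs = (c' * c) * (\<Prod>i<n. t' (xs ! i) * t (xs ! i)) * \<Delta> xs" if "xs \<in> tuples E n" for xs
    unfolding e'[OF that] e[OF that] by (simp add: prod.distrib mult_ac)
  moreover have "(\<lambda>e. t' e * t e) \<in> E \<rightarrow> G" using t t' G by auto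
  ultimately show ?thesis unfolding rescaled_def using G[OF c' c]
    by (intro bexI[of _ "c' * c"] bexI[of _ "\<lambda>e. t' e * t e"] ballI)
qed

lemma equiv_rescaling_field: "equiv (weak_reps M ring_band) (rescaling M (ring_band :: 'l::field band))"
  by (rule equivI) (auto simp: refl_on_def sym_def trans_def rescaling_field_iff
      intro: rescaled_refl elim: rescaled_sym[rotated 2] rescaled_trans[rotated])

lemma equiv_rescaling_tropical: "equiv (weak_reps M tropical) (rescaling M tropical)"
  by (rule equivI) (auto simp: refl_on_def sym_def trans_def rescaling_tropical_iff
      intro: rescaled_refl elim: rescaled_sym[rotated 2] rescaled_trans[rotated])

lemma weak_reps_field_iff:
  "\<Delta> \<in> weak_reps M (ring_band :: 'l::field band) \<longleftrightarrow> \<Delta> \<in> extensional (tuples (ground M) (rank M)) \<and>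
     (\<forall>xs\<in>tuples (ground M) (rank M). \<forall>\<sigma>. \<sigma> permutes {..<rank M} \<longrightarrow>
        \<Delta> (permute_list \<sigma> xs) = (if evenperm \<sigma> then 1 else - 1) * \<Delta> xs) \<and>
     (\<forall>xs\<in>tuples (ground M) (rank M). \<Delta> xs \<noteq> 0 \<longleftrightarrow> basis M (set xs)) \<and>
     (\<forall>xs a b c d. xs @ [a, b] \<in> tuples (ground M) (rank M) \<and> c \<in> ground M \<and> d \<in> ground M \<longrightarrow>
        \<Delta> (xs @ [a, b]) * \<Delta> (xs @ [c, d]) - \<Delta> (xs @ [a, c]) * \<Delta> (xs @ [b, d]) + \<Delta> (xs @ [a, d]) * \<Delta> (xs @ [b, c]) = 0)"
proof -
  have rb: "carrier (ring_band :: 'l band) = UNIV" "(\<otimes>\<^bsub>ring_band\<^esub>) = ((*) :: 'l \<Rightarrow> _)" "\<one>\<^bsub>ring_band\<^esub> = (1::'l)" "pzero ring_band = (0::'l)"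
    by (auto simp: ring_band_def)
  have "\<Sum>\<^sub># (filter_mset (\<lambda>a. a \<noteq> 0) M) = \<Sum>\<^sub># M" for M :: "'l multiset" by (induction M) auto
  then have null: "fsum ring_band {#a, - b, c#} \<in> nullset ring_band \<longleftrightarrow> a - b + c = (0::'l)" for a b c
    by (auto simp: fsum_def ring_band_def algebra_simps)
  show ?thesis
    unfolding weak_reps_def sgn_in_def rb neg_ring_band null by (auto simp: PiE_iff)
qed

lemma permute_tuple: "\<sigma> permutes {..<n} \<Longrightarrow> xs \<in> tuples E n \<Longrightarrow> permute_list \<sigma> xs \<in> tuples E n"
  by (auto simp: tuples_def)

lemma prod_permute_tuple:
  assumes "\<sigma> permutes {..<n}" "length xs = n"
  shows "(\<Prod>i<n. t (permute_list \<sigma> xs ! i)) = (\<Prod>i<n. t (xs ! i) :: 'a::comm_monoid_mult)"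
proof -
  have "(\<Prod>i<n. t (permute_list \<sigma> xs ! i)) = (\<Prod>i<n. t (xs ! \<sigma> i))"
    using assms by (intro prod.cong) (auto simp: permute_list_nth)
  also have "\<dots> = (\<Prod>i<n. t (xs ! i))" using prod.permute[OF assms(1), of "\<lambda>i. t (xs ! i)"] by (simp add: o_def)
  finally show ?thesis .
qed

text \<open>The three products of a Plucker relation use the same elements with the same
  multiplicities, so rescaling multiplies the whole relation by one factor.\<close>

lemma rescaled_weak_rep:
  assumes \<Delta>: "\<Delta> \<in> weak_reps M (ring_band :: 'l::field band)"
    and ext: "\<Delta>' \<in> extensional (tuples (ground M) (rank M))"
    and r: "rescaled (- {0}) (ground M) (rank M) \<Delta> \<Delta>'"
  shows "\<Delta>' \<in> weak_reps M ring_band"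
proof -
  let ?n = "rank M" and ?T = "tuples (ground M) (rank M)"
  obtain c t where c: "c \<noteq> 0" and t: "t \<in> ground M \<rightarrow> - {0}"
    and e: "\<And>xs. xs \<in> ?T \<Longrightarrow> \<Delta>' xs = c * (\<Prod>i<?n. t (xs ! i)) * \<Delta> xs"
    using r unfolding rescaled_def by blast
  have D: "\<And>xs \<sigma>. xs \<in> ?T \<Longrightarrow> \<sigma> permutes {..<?n} \<Longrightarrow> \<Delta> (permute_list \<sigma> xs) = (if evenperm \<sigma> then 1 else - 1) * \<Delta> xs"
      "\<And>xs. xs \<in> ?T \<Longrightarrow> \<Delta> xs \<noteq> 0 \<longleftrightarrow> basis M (set xs)"
      "\<And>xs a b c d. xs @ [a, b] \<in> ?T \<Longrightarrow> c \<in> ground M \<Longrightarrow> d \<in> ground M \<Longrightarrow>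
        \<Delta> (xs @ [a, b]) * \<Delta> (xs @ [c, d]) - \<Delta> (xs @ [a, c]) * \<Delta> (xs @ [b, d]) + \<Delta> (xs @ [a, d]) * \<Delta> (xs @ [b, c]) = 0"
    using \<Delta> unfolding weak_reps_field_iff by blast+
  show ?thesis unfolding weak_reps_field_iff
  proof (intro conjI ballI allI impI ext)
    fix xs \<sigma> assume xs: "xs \<in> ?T" and \<sigma>: "\<sigma> permutes {..<?n}"
    have "length xs = ?n" using xs by (simp add: tuples_def)
    then show "\<Delta>' (permute_list \<sigma> xs) = (if evenperm \<sigma> then 1 else - 1) * \<Delta>' xs"
      unfolding e[OF permute_tuple[OF \<sigma> xs]] e[OF xs] prod_permute_tuple[OF \<sigma> \<open>length xs = ?n\<close>] D(1)[OF xs \<sigma>] by simp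
  next
    fix xs assume xs: "xs \<in> ?T"
    have "t (xs ! i) \<noteq> 0" if "i < ?n" for i using tuples_nth[OF xs that] t by auto
    then have "(\<Prod>i<?n. t (xs ! i)) \<noteq> 0" by simp
    then show "\<Delta>' xs \<noteq> 0 \<longleftrightarrow> basis M (set xs)" unfolding e[OF xs] using c D(2)[OF xs] by simp
  next
    fix xs a b c' d assume A: "xs @ [a, b] \<in> ?T \<and> c' \<in> ground M \<and> d \<in> ground M"
    then have n: "?n = Suc (Suc (length xs))" and ab: "a \<in> ground M" "b \<in> ground M" "set xs \<subseteq> ground M"
      by (auto simp: tuples_def)
    let ?p = "\<Prod>i<length xs. t (xs ! i)"
    have f: "\<Delta>' (xs @ [u, v]) = c * (?p * t u * t v) * \<Delta> (xs @ [u, v])" if "u \<in> ground M" "v \<in> ground M" for u v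
    proof -
      have "xs @ [u, v] \<in> ?T" using that ab n by (simp add: tuples_def)
      then show ?thesis by (simp add: e n nth_append)
    qed
    have "\<Delta>' (xs @ [a, b]) * \<Delta>' (xs @ [c', d]) - \<Delta>' (xs @ [a, c']) * \<Delta>' (xs @ [b, d]) + \<Delta>' (xs @ [a, d]) * \<Delta>' (xs @ [b, c'])
      = (c * c * ?p * ?p * t a * t b * t c' * t d) *
        (\<Delta> (xs @ [a, b]) * \<Delta> (xs @ [c', d]) - \<Delta> (xs @ [a, c']) * \<Delta> (xs @ [b, d]) + \<Delta> (xs @ [a, d]) * \<Delta> (xs @ [b, c']))"
      using A ab by (simp add: f) (simp add: algebra_simps)
    then show "\<Delta>' (xs @ [a, b]) * \<Delta>' (xs @ [c', d]) - \<Delta>' (xs @ [a, c']) * \<Delta>' (xs @ [b, d]) + \<Delta>' (xs @ [a, d]) * \<Delta>' (xs @ [b, c']) = 0"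
      using D(3)[of xs a b c' d] A by simp
  qed
qed

text \<open>The factors of the contracted entries \<open>cs\<close> are the same for all tuples and
  are absorbed into the constant.\<close>

lemma rescaled_minor:
  assumes r: "rescaled G (ground M) (rank M) \<Delta> \<Delta>'"
    and G: "\<And>x y. x \<in> G \<Longrightarrow> y \<in> G \<Longrightarrow> x * y \<in> G"
    and cs: "set cs \<subseteq> ground M" "length cs \<le> rank M"
    and E: "E = ground M - (set cs \<union> D)" "n = rank M - length cs"
  shows "rescaled G E n (minor_rep M cs D \<Delta>) (minor_rep M cs D \<Delta>')"
proof -
  obtain c t where c: "c \<in> G" and t: "t \<in> ground M \<rightarrow> G"
    and e: "\<And>xs. xs \<in> tuples (ground M) (rank M) \<Longrightarrow> \<Delta>' xs = c * (\<Prod>i<rank M. t (xs ! i)) * \<Delta> xs"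
    using r unfolding rescaled_def by blast
  have split: "(\<Prod>i<length ys + k. t ((ys @ cs) ! i)) = (\<Prod>i<length ys. t (ys ! i)) * (\<Prod>i<k. t (cs ! i))" for ys k
    by (induction k) (simp_all add: nth_append mult.assoc)
  have "c * (\<Prod>i<k. t (cs ! i)) \<in> G" if "k \<le> length cs" for k
    using that
  proof (induction k)
    case (Suc k)
    then have "cs ! k \<in> ground M" using cs(1) nth_mem[of k cs] by auto
    then have 1: "t (cs ! k) \<in> G" using t by (rule Pi_mem[rotated])
    have 2: "c * (\<Prod>i<k. t (cs ! i)) \<in> G" using Suc by simp
    show ?case using G[OF 2 1] by (simp add: mult.assoc)
  qed (use c in simp)
  then have c': "c * (\<Prod>i<length cs. t (cs ! i)) \<in> G" by simp
  have "minor_rep M cs D \<Delta>' ys = (c * (\<Prod>i<length cs. t (cs ! i))) * (\<Prod>i<n. t (ys ! i)) * minor_rep M cs D \<Delta> ys"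
    if ys: "ys \<in> tuples E n" for ys
  proof -
    have l: "length ys = n" "rank M = n + length cs" using ys cs E by (auto simp: tuples_def)
    have "ys @ cs \<in> tuples (ground M) (rank M)" using ys cs E by (auto simp: tuples_def)
    from e[OF this] have "\<Delta>' (ys @ cs) = c * ((\<Prod>i<n. t (ys ! i)) * (\<Prod>i<length cs. t (cs ! i))) * \<Delta> (ys @ cs)"
      using split[of ys "length cs"] l by simp
    then show ?thesis using ys E by (simp add: minor_rep_def mult_ac)
  qed
  moreover have "t \<in> E \<rightarrow> G" using t E by auto
  ultimately show ?thesis unfolding rescaled_def using c'
    by (intro bexI[of _ "c * (\<Prod>i<length cs. t (cs ! i))"] bexI[of _ t] ballI)
qed

subsection \<open>Normal forms of representations\<close>

text \<open>Replacement in place keeps positions, so that no sign enters the normalization.\<close>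

definition exch :: "'e list \<Rightarrow> 'e \<times> 'e \<Rightarrow> 'e list" where
  "exch b p = map (\<lambda>z. if z = fst p then snd p else z) b"

lemma prod_tuple: "distinct xs \<Longrightarrow> (\<Prod>i<length xs. t (xs ! i)) = (\<Prod>z\<in>set xs. t z :: 'a::comm_monoid_mult)"
  using prod.reindex_bij_betw[OF bij_betw_nth[of xs, OF _ refl refl], of t] by simp

locale based_matroid = matroid M for M :: "'e matroid" +
  fixes b0 :: "'e list"
  assumes b0: "distinct b0" "basis M (set b0)"
begin

text \<open>The fundamental graph of the basis \<open>b0\<close>, with edges directed out of the
  basis.\<close>

definition exchange_edges :: "('e \<times> 'e) set" where
  "exchange_edges = {(x, y). x \<in> set b0 \<and> y \<in> ground M - set b0 \<and> basis M (insert y (set b0 - {x}))}"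

lemma length_b0: "length b0 = rank M"
  using b0 by (simp add: basis_iff distinct_card)

lemma basis_ground: "basis M X \<Longrightarrow> X \<subseteq> ground M"
  using indep_subset_ground by (simp add: basis_iff)

lemma b0_tuple: "b0 \<in> tuples (ground M) (rank M)"
  using basis_ground[OF b0(2)] length_b0 by (simp add: tuples_def)

lemma finite_exchange_edges: "finite exchange_edges"
  by (rule finite_subset[of _ "ground M \<times> ground M"]) (use basis_ground[OF b0(2)] ground_finite in \<open>auto simp: exchange_edges_def\<close>)

lemma basis_tuple_distinct: "xs \<in> tuples (ground M) (rank M) \<Longrightarrow> basis M (set xs) \<Longrightarrow> distinct xs"
  by (rule card_distinct) (simp add: tuples_def basis_iff)

lemma exch_props:
  assumes "(x, y) \<in> exchange_edges"
  shows exch_tuple: "exch b0 (x, y) \<in> tuples (ground M) (rank M)"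
    and exch_basis: "basis M (set (exch b0 (x, y)))"
    and exch_prod: "t x \<noteq> 0 \<Longrightarrow> (\<Prod>i<rank M. t (exch b0 (x, y) ! i)) = t y / t x * (\<Prod>i<rank M. t (b0 ! i) :: 'a::field)"
proof -
  have xy: "x \<in> set b0" "y \<in> ground M" "y \<notin> set b0" "basis M (insert y (set b0 - {x}))"
    using assms by (auto simp: exchange_edges_def)
  have s: "set (exch b0 (x, y)) = insert y (set b0 - {x})" using xy by (auto simp: exch_def)
  then show bs: "basis M (set (exch b0 (x, y)))" using xy by simp
  show T: "exch b0 (x, y) \<in> tuples (ground M) (rank M)"
    using basis_ground[OF bs] length_b0 by (simp add: tuples_def exch_def)
  have l: "length (exch b0 (x, y)) = rank M" using T by (simp add: tuples_def)
  assume tx: "t x \<noteq> 0"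
  have "(\<Prod>i<rank M. t (exch b0 (x, y) ! i)) = (\<Prod>z\<in>insert y (set b0 - {x}). t z)"
    using prod_tuple[OF basis_tuple_distinct[OF T bs], of t] s l by simp
  also have "\<dots> = t y * (\<Prod>z\<in>set b0 - {x}. t z)" using xy by simp
  also have "(\<Prod>z\<in>set b0. t z) = t x * (\<Prod>z\<in>set b0 - {x}. t z)" using xy by (intro prod.remove) auto
  then have "t y * (\<Prod>z\<in>set b0 - {x}. t z) = t y / t x * (\<Prod>z\<in>set b0. t z)" using tx by simp
  also have "(\<Prod>z\<in>set b0. t z) = (\<Prod>i<rank M. t (b0 ! i))" using prod_tuple[OF b0(1), of t] length_b0 by simp
  finally show "(\<Prod>i<rank M. t (exch b0 (x, y) ! i)) = t y / t x * (\<Prod>i<rank M. t (b0 ! i))" .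
qed

text \<open>For a matrix \<open>[I | A]\<close> with identity block at \<open>b0\<close>, the
  exchanged coordinates are entries of \<open>A\<close>. Setting them to 1 along a spanning forest
  \<open>T\<close> of the fundamental graph is the usual normal form up to row and column
  scaling.\<close>

definition normal_on where
  "normal_on T \<Delta> \<longleftrightarrow> \<Delta> b0 = 1 \<and> (\<forall>p\<in>T. \<Delta> (exch b0 p) = 1)"

lemma normalize_field:
  assumes T: "T \<subseteq> exchange_edges"
    and free: "\<forall>g :: 'e \<times> 'e \<Rightarrow> 'l::field. (\<forall>e. g e \<noteq> 0) \<longrightarrow>
      (\<exists>t. (\<forall>v. t v \<noteq> 0) \<and> (\<forall>(x,y)\<in>T. t y = g (x,y) * t x))"
    and \<Delta>: "\<Delta> \<in> weak_reps M (ring_band :: 'l band)"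
  shows "\<exists>\<Delta>'. (\<Delta>, \<Delta>') \<in> rescaling M ring_band \<and> normal_on T \<Delta>'"
proof -
  have nz: "\<Delta> xs \<noteq> 0" if "xs \<in> tuples (ground M) (rank M)" "basis M (set xs)" for xs
    using \<Delta> that by (simp add: weak_reps_field_iff)
  have nb: "\<Delta> b0 \<noteq> 0" using nz b0_tuple b0 by blast
  \<comment> \<open>The ratio \<open>t y / t x\<close> that moves the exchanged coordinate to the
    one at \<open>b0\<close>. The default 1 keeps \<open>g\<close> nowhere zero.\<close>
  define g where "g p = (if \<Delta> (exch b0 p) = 0 then 1 else \<Delta> b0 / \<Delta> (exch b0 p))" for p
  have "\<forall>e. g e \<noteq> 0" using nb by (simp add: g_def)
  then obtain t where t: "\<forall>v. t v \<noteq> 0" "\<forall>(x,y)\<in>T. t y = g (x,y) * t x" using free by blast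
  let ?p = "\<Prod>i<rank M. t (b0 ! i)"
  have p: "?p \<noteq> 0" using t by simp
  define c where "c = inverse (?p * \<Delta> b0)"
  define \<Delta>' where "\<Delta>' = (\<lambda>xs\<in>tuples (ground M) (rank M). c * (\<Prod>i<rank M. t (xs ! i)) * \<Delta> xs)"
  have "c \<noteq> 0" unfolding c_def using p nb by (metis inverse_nonzero_iff_nonzero mult_eq_0_iff)
  then have r: "rescaled (- {0}) (ground M) (rank M) \<Delta> \<Delta>'"
    unfolding rescaled_def \<Delta>'_def using t by (intro bexI[of _ c] bexI[of _ t]) auto
  have "\<Delta>' \<in> weak_reps M ring_band"
    by (rule rescaled_weak_rep[OF \<Delta> _ r]) (simp add: \<Delta>'_def)
  then have 1: "(\<Delta>, \<Delta>') \<in> rescaling M ring_band" using \<Delta> r by (simp add: rescaling_field_iff)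
  have inv: "c * q * d = 1" if "q * d = ?p * \<Delta> b0" for q d
  proof -
    have "?p * \<Delta> b0 \<noteq> 0" using p nb by (metis mult_eq_0_iff)
    then have "c * (?p * \<Delta> b0) = 1" unfolding c_def by (rule left_inverse)
    then show ?thesis using that by (simp add: mult.assoc)
  qed
  have "\<Delta>' b0 = 1" using b0_tuple inv by (simp add: \<Delta>'_def)
  moreover have "\<Delta>' (exch b0 e) = 1" if e: "e \<in> T" for e
  proof -
    obtain x y where xy: "e = (x, y)" "(x, y) \<in> exchange_edges" "(x, y) \<in> T" using e T by (cases e) auto
    have n: "\<Delta> (exch b0 (x, y)) \<noteq> 0" using nz exch_tuple[OF xy(2)] exch_basis[OF xy(2)] by blast
    have "t y = g (x, y) * t x" using t(2) xy(3) by auto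
    then have "t y / t x = \<Delta> b0 / \<Delta> (exch b0 (x, y))" using t(1) n by (simp add: g_def)
    then have "(\<Prod>i<rank M. t (exch b0 (x, y) ! i)) * \<Delta> (exch b0 (x, y)) = ?p * \<Delta> b0"
      using exch_prod[OF xy(2), of t] t(1) n by simp
    then show ?thesis using exch_tuple[OF xy(2)] inv xy(1) by (simp add: \<Delta>'_def)
  qed
  ultimately show ?thesis using 1 unfolding normal_on_def by blast
qed

text \<open>Normalization makes \<open>t\<close> agree at the ends of each edge of \<open>T\<close>,
  hence of every edge of the fundamental graph. By symmetric exchange each basis is then reached
  from \<open>b0\<close> without changing the product of \<open>t\<close>, so the rescaling factor
  is 1 on all bases.\<close>

lemma normal_form_unique:
  assumes T: "T \<subseteq> exchange_edges" "exchange_edges \<subseteq> (T \<union> T\<inverse>)\<^sup>*"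
    and r: "(\<Delta>, \<Delta>') \<in> rescaling M tropical" and n: "normal_on T \<Delta>" "normal_on T \<Delta>'"
  shows "\<Delta> = \<Delta>'"
proof -
  have W: "\<Delta> \<in> weak_reps M tropical" "\<Delta>' \<in> weak_reps M tropical" and "rescaled {0<..} (ground M) (rank M) \<Delta> \<Delta>'"
    using r by (auto simp: rescaling_tropical_iff)
  then obtain c t where c: "0 < c" and t: "t \<in> ground M \<rightarrow> {0<..}"
    and e: "\<And>xs. xs \<in> tuples (ground M) (rank M) \<Longrightarrow> \<Delta>' xs = c * (\<Prod>i<rank M. t (xs ! i)) * \<Delta> xs"
    unfolding rescaled_def by auto
  let ?p = "\<Prod>i<rank M. t (b0 ! i)"
  have cp: "c * ?p = 1" using e[OF b0_tuple] n by (simp add: normal_on_def)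
  have edge: "t x = t y" if "(x, y) \<in> T" for x y
  proof -
    have xy: "(x, y) \<in> exchange_edges" using that T by auto
    then have "x \<in> ground M" using basis_ground[OF b0(2)] by (auto simp: exchange_edges_def)
    then have tx: "0 < t x" using t by auto
    have d: "\<Delta> (exch b0 (x, y)) = 1" "\<Delta>' (exch b0 (x, y)) = 1" using n that by (auto simp: normal_on_def)
    have tx0: "t x \<noteq> 0" using tx by simp
    have "1 = c * (t y / t x * ?p)"
      using e[OF exch_tuple[OF xy]] unfolding d exch_prod[OF xy, of t, OF tx0] by (simp only: mult_1_right)
    also have "\<dots> = (t y / t x) * (c * ?p)" by (simp only: mult_ac)
    also have "\<dots> = t y / t x" unfolding cp by simp
    finally show ?thesis using tx by simp
  qed
  have conn: "t u = t v" if "(u, v) \<in> (T \<union> T\<inverse>)\<^sup>*" for u v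
    using that by (induction rule: rtrancl_induct) (auto dest: edge)
  have bases: "prod t B = prod t (set b0)" if "basis M B" for B
    using that
  proof (induction "card (B - set b0)" arbitrary: B rule: less_induct)
    case less
    show ?case
    proof (cases "B = set b0")
      case False
      then obtain x y where xy: "y \<in> B - set b0" "x \<in> set b0 - B" "basis M (insert y (set b0 - {x}))" "basis M (insert x (B - {y}))"
        using symmetric_exchange[OF b0(2) less(2)] by blast
      have "(x, y) \<in> exchange_edges" using xy basis_ground[OF less(2)] by (auto simp: exchange_edges_def)
      then have txy: "t x = t y" using conn T by blast
      have fin: "finite B" using less(2) finite_indep by (simp add: basis_iff)
      have "insert x (B - {y}) - set b0 \<subset> B - set b0" using xy by auto
      then have "card (insert x (B - {y}) - set b0) < card (B - set b0)" using fin by (intro psubset_card_mono) auto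
      then have "prod t (insert x (B - {y})) = prod t (set b0)" using less(1) xy(4) by blast
      moreover have "prod t (insert x (B - {y})) = t x * prod t (B - {y})" using xy fin by simp
      moreover have "prod t B = t y * prod t (B - {y})" using xy fin by (intro prod.remove) auto
      ultimately show ?thesis using txy by simp
    qed simp
  qed
  have "\<Delta> xs = \<Delta>' xs" if xs: "xs \<in> tuples (ground M) (rank M)" for xs
  proof (cases "basis M (set xs)")
    case True
    have l: "length xs = rank M" using xs by (simp add: tuples_def)
    have "(\<Prod>i<rank M. t (xs ! i)) = prod t (set xs)"
      using prod_tuple[OF basis_tuple_distinct[OF xs True], of t] l by simp
    also have "\<dots> = ?p" using bases[OF True] prod_tuple[OF b0(1), of t] length_b0 by simp
    finally show ?thesis using e[OF xs] cp by simp
  next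
    case False
    then show ?thesis using W xs by (auto simp: weak_reps_def tropical_def)
  qed
  moreover have "\<Delta> \<in> extensional (tuples (ground M) (rank M))" "\<Delta>' \<in> extensional (tuples (ground M) (rank M))"
    using W by (auto simp: weak_reps_def PiE_iff)
  ultimately show ?thesis by (intro extensionalityI)
qed

end

subsection \<open>Generic members of an infinite family\<close>

text \<open>
  A sequence of points is a point over the ring of sequences. A prime ideal that contains no
  sequence with finitely many zeros yields a generic point, where each coordinate with
  distinct values is transcendental over the constants.
\<close>

lemma generic_prime:
  "\<exists>P :: (nat \<Rightarrow> 'l::field) set. prime_kernel P \<and> (\<forall>a. finite {j. a j = 0} \<longrightarrow> a \<notin> P)"
proof -
  \<comment> \<open>The trivial norm on sequences modulo those of finite support. It is 1 on
    sequences with finitely many zeros, and a seminorm below it that keeps these values has none of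
    them in its kernel.\<close>
  define N :: "(nat \<Rightarrow> 'l) \<Rightarrow> real" where "N a = (if finite {j. a j \<noteq> 0} then 0 else 1)" for a
  let ?M = "{a :: nat \<Rightarrow> 'l. finite {j. a j = 0}}"
  have NM: "N (m * a) = N m * N a" "N m = 1" if "m \<in> ?M" for m a
  proof -
    have f: "finite {j. m j = 0}" using that by simp
    have "{j. m j \<noteq> 0} = - {j. m j = 0}" by auto
    then have "infinite {j. m j \<noteq> 0}" using finite_compl[of "{j. m j = 0}"] f by auto
    then show m: "N m = 1" by (simp add: N_def)
    have "finite {j. (m * a) j \<noteq> 0} \<longleftrightarrow> finite {j. a j \<noteq> 0}"
    proof
      assume "finite {j. (m * a) j \<noteq> 0}"
      then have "finite ({j. (m * a) j \<noteq> 0} \<union> {j. m j = 0})" using f by simp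
      then show "finite {j. a j \<noteq> 0}" by (rule finite_subset[rotated]) auto
    next
      assume "finite {j. a j \<noteq> 0}"
      then show "finite {j. (m * a) j \<noteq> 0}" by (rule finite_subset[rotated]) auto
    qed
    then show "N (m * a) = N m * N a" using m by (simp add: N_def)
  qed
  interpret S: seminorm_below UNIV ?M N
  proof
    show "subring_set (UNIV :: (nat \<Rightarrow> 'l) set)" by (simp add: subring_set_def)
    have "{j::nat. (1 :: nat \<Rightarrow> 'l) j \<noteq> 0} = UNIV" by auto
    then show "N 1 = 1" by (simp add: N_def)
  qed (use NM in auto)
  have "N (a * b) \<le> N a * N b" for a b
  proof -
    have "finite {j. a j \<noteq> 0} \<or> finite {j. b j \<noteq> 0} \<Longrightarrow> finite {j. (a * b) j \<noteq> 0}"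
      by (elim disjE) (erule finite_subset[rotated]; auto)+
    then show ?thesis by (auto simp: N_def)
  qed
  moreover have "N (a + b) \<le> max (N a) (N b)" for a b
  proof -
    have "finite {j. (a + b) j \<noteq> 0}" if "finite {j. a j \<noteq> 0}" "finite {j. b j \<noteq> 0}"
      by (rule finite_subset[of _ "{j. a j \<noteq> 0} \<union> {j. b j \<noteq> 0}"]) (use that in auto)
    then show ?thesis by (auto simp: N_def)
  qed
  moreover have "N 0 = 0" "\<And>a. 0 \<le> N a" by (simp_all add: N_def)
  ultimately have "\<exists>w. (\<forall>a\<in>UNIV. 0 \<le> w a \<and> w a \<le> N a) \<and> w 1 = 1 \<and> (\<forall>m\<in>?M. w m = N m) \<and>
      (\<forall>a\<in>UNIV. \<forall>b\<in>UNIV. w (a * b) = w a * w b \<and> w (a + b) \<le> max (w a) (w b))"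
    by (intro S.multiplicative_below)
  then obtain w where w: "\<And>a. 0 \<le> w a \<and> w a \<le> N a" "w 1 = 1" "\<And>m. m \<in> ?M \<Longrightarrow> w m = N m"
    "\<And>a b. w (a * b) = w a * w b \<and> w (a + b) \<le> max (w a) (w b)"
    by blast
  have "prime_kernel {a. w a = 0}"
  proof
    have "w 0 \<le> N 0" using w(1) by blast
    then show "0 \<in> {a. w a = 0}" using w(1)[of 0] by (simp add: N_def)
    show "a + b \<in> {a. w a = 0}" if "a \<in> {a. w a = 0}" "b \<in> {a. w a = 0}" for a b
      using w(4)[of a b] w(1)[of "a + b"] that by simp
    show "a \<in> {a. w a = 0} \<or> b \<in> {a. w a = 0}" if "a * b \<in> {a. w a = 0}" for a b
      using w(4)[of a b] that by auto
  qed (use w in auto)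
  moreover have "a \<notin> {a. w a = 0}" if "finite {j. a j = 0}" for a
    using w(3)[of a] NM(2)[of a] that by simp
  ultimately show ?thesis by blast
qed

lemma sum_fun_apply: "(\<Sum>i\<in>I. f i) j = (\<Sum>i\<in>I. f i j :: 'a::comm_monoid_add)"
  by (induction I rule: infinite_finite_induct) auto

lemma prod_fun_apply: "(\<Prod>i\<in>I. f i) j = (\<Prod>i\<in>I. f i j :: 'a::comm_monoid_mult)"
  by (induction I rule: infinite_finite_induct) auto

lemma power_fun_apply: "(f ^ n) j = (f j ^ n :: 'a::monoid_mult)"
  by (induction n) auto

definition const_seqs :: "(nat \<Rightarrow> 'l) set" where
  "const_seqs = range (\<lambda>c _. c)"

lemma subring_const_seqs: "subring_set (const_seqs :: (nat \<Rightarrow> 'l::field) set)"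
  unfolding subring_set_def const_seqs_def by (auto simp: fun_eq_iff image_iff)

text \<open>A nonzero polynomial over the field has finitely many roots and \<open>s\<close> is
  injective, so a nontrivial relation with constant coefficients fails at all but finitely many
  indices and cannot hold modulo \<open>P\<close>. Thus \<open>s\<close> is transcendental and may
  receive any positive value, while the constants keep the trivial valuation.\<close>

lemma generic_valuations:
  fixes s :: "nat \<Rightarrow> 'l::field"
  assumes s: "inj s" "s \<in> set ss"
  obtains P where "prime_kernel P" "\<And>a. finite {j. a j = 0} \<Longrightarrow> a \<notin> P"
    "\<And>r. 0 < r \<Longrightarrow> \<exists>w. val_on P (adjoin_list const_seqs ss) w \<and> w s = r \<and> (\<forall>c. w (\<lambda>_. c) = (if c = 0 then 0 else 1))"
proof -
  obtain P :: "(nat \<Rightarrow> 'l) set" where P: "prime_kernel P" and av: "\<And>a. finite {j. a j = 0} \<Longrightarrow> a \<notin> P"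
    using generic_prime by blast
  interpret prime_kernel P by fact
  let ?U = "const_seqs :: (nat \<Rightarrow> 'l) set"
  define w0 :: "(nat \<Rightarrow> 'l) \<Rightarrow> real" where "w0 a = (if a 0 = 0 then 0 else 1)" for a
  have cP: "(\<lambda>_. c) \<in> P \<longleftrightarrow> c = 0" for c :: 'l
  proof
    assume "(\<lambda>_. c) \<in> P"
    then show "c = 0" using av[of "\<lambda>_. c"] by (cases "c = 0") auto
  next
    assume "c = 0"
    then show "(\<lambda>_. c) \<in> P" using zero_P by (simp add: zero_fun_def)
  qed
  have w0: "val_on P ?U w0"
    unfolding val_on_def const_seqs_def by (auto simp: w0_def cP)
  have tr: "transcendental_over ?U s" unfolding transcendental_over_def
  proof (intro ballI impI, rule ccontr)
    fix q assume q: "q \<in> poly_over ?U" "poly q s \<in> P" "\<not> P_poly q"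
    have co: "\<exists>c. coeff q i = (\<lambda>_. c)" for i using q(1) by (auto simp: poly_over_def const_seqs_def)
    \<comment> \<open>The coefficients are constant sequences. Reading them at index 0 gives a
      polynomial over the field that computes the value of \<open>q\<close> at \<open>s\<close> in
      every index.\<close>
    define q' where "q' = map_poly (\<lambda>a. a 0) q"
    have c': "coeff q' i = coeff q i j" for i j using co[of i] by (auto simp: q'_def coeff_map_poly)
    have le: "degree q' \<le> degree q" unfolding q'_def by (rule map_poly_degree_leq)
    have q'sum: "poly q' x = (\<Sum>i\<le>degree q. coeff q' i * x ^ i)" for x
      unfolding poly_altdef by (rule sum.mono_neutral_left) (use le in \<open>auto simp: coeff_eq_0\<close>)
    have ev: "poly q s j = poly q' (s j)" for j
      unfolding q'sum by (simp add: poly_altdef sum_fun_apply power_fun_apply c'[of _ j])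
    obtain i where "coeff q i \<notin> P" using q(3) by (auto simp: P_poly_def)
    moreover obtain c0 where c0: "coeff q i = (\<lambda>_. c0)" using co by blast
    ultimately have "c0 \<noteq> 0" using cP by simp
    moreover have "coeff q' i = c0" using c'[of i 0] unfolding c0 .
    ultimately have "coeff q' i \<noteq> 0" by simp
    then have "q' \<noteq> 0" by auto
    then have "finite {x. poly q' x = 0}" by (rule poly_roots_finite)
    then have "finite (s -` {x. poly q' x = 0})" using s(1) by (rule finite_vimageI)
    then have "finite {j. poly q s j = 0}" by (simp add: ev vimage_def)
    then show False using av q(2) by blast
  qed
  have ind: "independent_over ?U [s]" using tr by (simp add: independent_over_def)
  obtain us where us: "independent_over ?U ([s] @ us)" "set us \<subseteq> set ss"
    "\<forall>x\<in>set ss. \<not> transcendental_over (adjoin_list ?U ([s] @ us)) x"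
    using independent_extend[OF subring_const_seqs ind, of ss] s(2) by auto
  define ts where "ts = [s] @ us"
  have sub: "set ts \<subseteq> set ss" using us s by (simp add: ts_def)
  from valuation_family[OF subring_const_seqs w0 us(1)[folded ts_def] sub us(3)[folded ts_def]]
  obtain H where fam: "\<forall>r\<in>orthant (length ts). \<exists>w. val_on P (adjoin_list ?U ss) w \<and> (\<forall>a\<in>?U. w a = w0 a) \<and>
      (\<forall>i<length ts. w (ts ! i) = r i) \<and> (\<forall>s\<in>set ss. \<exists>h\<in>H s. w s = h r)"
    by (elim exE conjE) (rule that)
  have "\<exists>w. val_on P (adjoin_list ?U ss) w \<and> w s = r \<and> (\<forall>c. w (\<lambda>_. c) = (if c = 0 then 0 else 1))" if r: "0 < r" for r
  proof -
    \<comment> \<open>All weights are set to \<open>r\<close>; the one that counts belongs to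
      \<open>s\<close>, the first entry of \<open>ts\<close>.\<close>
    have "(\<lambda>_. r) \<in> orthant (length ts)" using r by (simp add: orthant_def)
    from bspec[OF fam this]
    obtain w where w: "val_on P (adjoin_list ?U ss) w" "\<forall>a\<in>?U. w a = w0 a" "\<forall>i<length ts. w (ts ! i) = r"
      by (elim exE conjE) (rule that)
    have "w s = r" using w(3)[rule_format, of 0] by (simp add: ts_def)
    moreover have "w (\<lambda>_. c) = (if c = 0 then 0 else 1)" for c
      using w(2) by (simp add: const_seqs_def w0_def)
    ultimately show ?thesis using w(1) by blast
  qed
  then show ?thesis using that P av by blast
qed

text \<open>A sequence of representations is a single one over the ring of sequences, where the
  Plucker relations hold exactly. Coordinates at bases vanish nowhere and stay outside
  \<open>P\<close>, so the underlying matroid is kept.\<close>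

lemma tropicalize_weak_reps:
  fixes \<Delta> :: "nat \<Rightarrow> 'e list \<Rightarrow> 'l::field"
  assumes w: "valued_subring P U w"
    and \<Delta>: "\<And>j. \<Delta> j \<in> weak_reps M ring_band"
    and mem: "\<And>xs. xs \<in> tuples (ground M) (rank M) \<Longrightarrow> (\<lambda>j. \<Delta> j xs) \<in> U"
    and av: "\<And>a. \<forall>j. a j \<noteq> 0 \<Longrightarrow> a \<notin> P"
  shows "(\<lambda>xs\<in>tuples (ground M) (rank M). w (\<lambda>j. \<Delta> j xs)) \<in> weak_reps M tropical"
proof -
  interpret valued_subring P U w by fact
  let ?T = "tuples (ground M) (rank M)"
  let ?g = "\<lambda>xs j. \<Delta> j xs"
  let ?D = "\<lambda>xs\<in>?T. w (?g xs)"
  have tr: "carrier tropical = {0..}" "(\<otimes>\<^bsub>tropical\<^esub>) = (*)" "\<one>\<^bsub>tropical\<^esub> = 1" "pzero tropical = 0"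
    by (simp_all add: tropical_def)
  have nn: "0 \<le> ?D xs" if "xs \<in> ?T" for xs using that val_nonneg[OF mem] by simp
  have D: "\<And>j xs \<sigma>. xs \<in> ?T \<Longrightarrow> \<sigma> permutes {..<rank M} \<Longrightarrow> \<Delta> j (permute_list \<sigma> xs) = (if evenperm \<sigma> then 1 else - 1) * \<Delta> j xs"
      "\<And>j xs. xs \<in> ?T \<Longrightarrow> \<Delta> j xs \<noteq> 0 \<longleftrightarrow> basis M (set xs)"
      "\<And>j xs a b c d. xs @ [a, b] \<in> ?T \<Longrightarrow> c \<in> ground M \<Longrightarrow> d \<in> ground M \<Longrightarrow>
        \<Delta> j (xs @ [a, b]) * \<Delta> j (xs @ [c, d]) - \<Delta> j (xs @ [a, c]) * \<Delta> j (xs @ [b, d]) + \<Delta> j (xs @ [a, d]) * \<Delta> j (xs @ [b, c]) = 0"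
    using \<Delta> unfolding weak_reps_field_iff by blast+
  show ?thesis unfolding weak_reps_def
  proof (intro CollectI conjI ballI allI impI)
    show "?D \<in> ?T \<rightarrow>\<^sub>E carrier tropical" using nn by (auto simp: tr)
  next
    fix xs \<sigma> assume xs: "xs \<in> ?T" and \<sigma>: "\<sigma> permutes {..<rank M}"
    have "?g (permute_list \<sigma> xs) = ?g xs \<or> ?g (permute_list \<sigma> xs) = - ?g xs"
      using D(1)[OF xs \<sigma>] by (auto simp: fun_eq_iff)
    then have "w (?g (permute_list \<sigma> xs)) = w (?g xs)" using val_minus[OF mem[OF xs]] by auto
    moreover have "sgn_in tropical \<sigma> = 1" by (simp add: sgn_in_def tr neg_tropical)
    ultimately show "?D (permute_list \<sigma> xs) = sgn_in tropical \<sigma> \<otimes>\<^bsub>tropical\<^esub> ?D xs"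
      using xs permute_tuple[OF \<sigma> xs] by (simp add: tr)
  next
    fix xs assume xs: "xs \<in> ?T"
    have "w (?g xs) \<noteq> 0 \<longleftrightarrow> basis M (set xs)"
    proof
      assume "basis M (set xs)"
      then have "?g xs \<notin> P" using D(2)[OF xs] by (intro av) auto
      then show "w (?g xs) \<noteq> 0" using val_eq_0[OF mem[OF xs]] by simp
    next
      assume nz: "w (?g xs) \<noteq> 0"
      show "basis M (set xs)"
      proof (rule ccontr)
        assume "\<not> basis M (set xs)"
        then have "?g xs = 0" using D(2)[OF xs] by (auto simp: fun_eq_iff)
        then show False using nz val_0 by simp
      qed
    qed
    then show "?D xs \<noteq> pzero tropical \<longleftrightarrow> basis M (set xs)" using xs by (simp add: tr)
  next
    fix xs a b c d assume A: "xs @ [a, b] \<in> ?T \<and> c \<in> ground M \<and> d \<in> ground M"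
    have T: "xs @ [u, v] \<in> ?T" if "u \<in> {a, b, c, d}" "v \<in> {a, b, c, d}" for u v
      using A that by (auto simp: tuples_def)
    have m: "?g (xs @ [u, v]) \<in> U" if "u \<in> {a, b, c, d}" "v \<in> {a, b, c, d}" for u v
      using mem[OF T[OF that]] .
    let ?A = "?g (xs @ [a, b]) * ?g (xs @ [c, d])"
    let ?B = "?g (xs @ [a, c]) * ?g (xs @ [b, d])"
    let ?C = "?g (xs @ [a, d]) * ?g (xs @ [b, c])"
    have U3: "?A \<in> U" "?B \<in> U" "?C \<in> U" using m by (auto intro!: U(4))
    have "?A + (- ?B + ?C) = 0" using D(3)[of xs a b c d] A by (simp add: fun_eq_iff algebra_simps)
    then have "(\<Sum>z\<in>#{#?A, - ?B, ?C#}. z) \<in> P" using zero_P by simp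
    then have "fsum tropical (image_mset (\<lambda>z. w z) {#?A, - ?B, ?C#}) \<in> nullset tropical"
      by (intro val_null_sum) (use U3 U(5) in auto)
    moreover have "w ?A = ?D (xs @ [a, b]) * ?D (xs @ [c, d])" "w ?C = ?D (xs @ [a, d]) * ?D (xs @ [b, c])"
      "w (- ?B) = ?D (xs @ [a, c]) * ?D (xs @ [b, d])"
      using val_mult m T val_minus[OF U3(2)] by simp_all
    moreover have "neg tropical (?D (xs @ [a, c]) * ?D (xs @ [b, d])) = ?D (xs @ [a, c]) * ?D (xs @ [b, d])"
      using nn[OF T] by (intro neg_tropical mult_nonneg_nonneg) auto
    ultimately show "fsum tropical {# ?D (xs @ [a, b]) \<otimes>\<^bsub>tropical\<^esub> ?D (xs @ [c, d]),
        neg tropical (?D (xs @ [a, c]) \<otimes>\<^bsub>tropical\<^esub> ?D (xs @ [b, d])),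
        ?D (xs @ [a, d]) \<otimes>\<^bsub>tropical\<^esub> ?D (xs @ [b, c]) #} \<in> nullset tropical"
      unfolding tr by simp
  qed
qed

section \<open>Finite fibers for matroid representations\<close>

lemma (in valued_subring) val_prod:
  "(\<And>i. i \<in> I \<Longrightarrow> f i \<in> U) \<Longrightarrow> prod f I \<in> U \<and> w (prod f I) = (\<Prod>i\<in>I. w (f i))"
  by (induction I rule: infinite_finite_induct) (auto simp: val_one val_mult U)

lemma equiv_symD: "equiv A r \<Longrightarrow> (a, b) \<in> r \<Longrightarrow> (b, a) \<in> r"
  by (meson equivE symD)

lemma equiv_transD: "equiv A r \<Longrightarrow> (a, b) \<in> r \<Longrightarrow> (b, c) \<in> r \<Longrightarrow> (a, c) \<in> r"
  by (meson equivE transD)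

lemma finite_tuples: "finite E \<Longrightarrow> finite (tuples E n)"
  unfolding tuples_def by (rule finite_lists_length_eq)

theorem finite_fibers_field:
  fixes M :: "'e matroid"
  assumes M: "matroid M" and C: "C \<subseteq> ground M" "indep M C" and D: "coindep M D" and disj: "C \<inter> D = {}"
    and N: "N = delete (contract M C) D" and cs: "distinct cs" "set cs = C"
    and fin: "finite_fibers_on (rescaling_classes M tropical) (rescaling_classes N tropical) (minor_map M cs D tropical)"
  shows "finite_fibers_on (rescaling_classes M (ring_band :: 'l::field band))
    (rescaling_classes N ring_band) (minor_map M cs D ring_band)"
  unfolding finite_fibers_on_def
proof (rule ballI, rule ccontr)
  interpret M: matroid M by fact
  fix z assume z: "z \<in> rescaling_classes N (ring_band :: 'l band)"
  define Ws where "Ws = {w \<in> rescaling_classes M (ring_band :: 'l band). minor_map M cs D ring_band w = z}"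
  assume "\<not> finite {w \<in> rescaling_classes M ring_band. minor_map M cs D ring_band w = z}"
  then have inf: "infinite Ws" by (simp add: Ws_def)
  let ?T = "tuples (ground M) (rank M)" and ?S = "tuples (ground N) (rank N)"
  let ?min = "minor_rep M cs D"
  have cC: "card C = length cs" using distinct_card[OF cs(1)] cs(2) by simp
  have rN: "rank N = rank M - length cs" using M.rank_minor[OF C(2) D disj] N cC by simp
  have gN: "ground N = ground M - (set cs \<union> D)" using N cs by (auto simp: delete_def contract_def)
  have lcs: "length cs \<le> rank M" using M.indep_card_le_rank[OF C(2)] cC by simp
  have scs: "set cs \<subseteq> ground M" using C cs by simp
  have app: "ys @ cs \<in> ?T" if "ys \<in> ?S" for ys
    using that gN rN lcs scs by (auto simp: tuples_def)
  have min_eq: "?min \<Delta> = (\<lambda>ys\<in>?S. \<Delta> (ys @ cs))" for \<Delta> :: "'e list \<Rightarrow> 'a"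
    by (simp add: minor_rep_def rN gN)
  have NmapF: "minor_map M cs D (ring_band :: 'l band) X = rescaling N ring_band `` (?min ` X)"
    and NmapT: "minor_map M cs D tropical Y = rescaling N tropical `` (?min ` Y)" for X Y
    using N cs by (simp_all add: minor_map_def)
  have eqF: "equiv (weak_reps M (ring_band :: 'l band)) (rescaling M ring_band)"
    and eqFN: "equiv (weak_reps N (ring_band :: 'l band)) (rescaling N ring_band)"
    by (rule equiv_rescaling_field)+
  have eqT: "equiv (weak_reps M tropical) (rescaling M tropical)"
    and eqTN: "equiv (weak_reps N tropical) (rescaling N tropical)"
    by (rule equiv_rescaling_tropical)+
  obtain \<delta> where \<delta>: "\<delta> \<in> weak_reps N (ring_band :: 'l band)" "\<delta> \<in> z"
  proof -
    obtain d where "d \<in> weak_reps N (ring_band :: 'l band)" "z = rescaling N ring_band `` {d}"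
      using z by (auto simp: rescaling_classes_def quotient_def)
    then show ?thesis using that equiv_class_self[OF eqFN] by blast
  qed
  obtain B0 where "indep M B0" "card B0 = rank M" using M.ex_indep_rank by blast
  moreover obtain b0 where "set b0 = B0" "distinct b0"
    using finite_distinct_list M.finite_indep \<open>indep M B0\<close> by blast
  ultimately interpret B: based_matroid M b0 by unfold_locales (auto simp: M.basis_iff)
  obtain F where F: "F \<subseteq> B.exchange_edges" "B.exchange_edges \<subseteq> (F \<union> F\<inverse>)\<^sup>*"
    and free: "\<forall>g :: 'e \<times> 'e \<Rightarrow> 'l. (\<forall>e. g e \<noteq> 0) \<longrightarrow> (\<exists>t. (\<forall>v. t v \<noteq> 0) \<and> (\<forall>(x,y)\<in>F. t y = g (x,y) * t x))"
    using spanning_forest[OF B.finite_exchange_edges, where 'l = 'l] by blast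
  \<comment> \<open>Normalization rescales all of \<open>M\<close>, so the minor is only rescaling
    equivalent to \<open>\<delta>\<close>, not equal to it. The scaling data are extracted later for
    each member of the sequence.\<close>
  have nf: "\<exists>\<Delta>\<in>w. \<Delta> \<in> weak_reps M ring_band \<and> B.normal_on F \<Delta> \<and> (?min \<Delta>, \<delta>) \<in> rescaling N ring_band" if w: "w \<in> Ws" for w
  proof -
    obtain \<Delta>1 where \<Delta>1: "\<Delta>1 \<in> weak_reps M (ring_band :: 'l band)" "w = rescaling M ring_band `` {\<Delta>1}"
      using w by (auto simp: Ws_def rescaling_classes_def quotient_def)
    obtain \<Delta> where \<Delta>: "(\<Delta>1, \<Delta>) \<in> rescaling M ring_band" "B.normal_on F \<Delta>"
      using B.normalize_field[OF F(1) free \<Delta>1(1)] by blast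
    have "minor_map M cs D ring_band w = z" using w by (simp add: Ws_def)
    then have "\<delta> \<in> rescaling N ring_band `` (?min ` w)" using \<delta>(2) NmapF by simp
    then obtain \<Delta>2 where \<Delta>2: "\<Delta>2 \<in> w" "(?min \<Delta>2, \<delta>) \<in> rescaling N ring_band" by blast
    have "(\<Delta>1, \<Delta>2) \<in> rescaling M ring_band" using \<Delta>2(1) \<Delta>1(2) by simp
    then have "(\<Delta>2, \<Delta>) \<in> rescaling M ring_band"
      using \<Delta>(1) equiv_transD[OF eqF] equiv_symD[OF eqF] by blast
    then have "rescaled (- {0}) (ground M) (rank M) \<Delta>2 \<Delta>" and \<Delta>w: "\<Delta> \<in> weak_reps M ring_band"
      by (simp_all add: rescaling_field_iff)
    then have "rescaled (- {0}) (ground N) (rank N) (?min \<Delta>2) (?min \<Delta>)"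
      by (intro rescaled_minor[OF _ _ scs lcs gN rN]) auto
    moreover have "?min \<Delta>2 \<in> weak_reps N ring_band" using \<Delta>2(2) by (simp add: rescaling_field_iff)
    ultimately have "(?min \<Delta>2, ?min \<Delta>) \<in> rescaling N ring_band"
      using rescaled_weak_rep[of "?min \<Delta>2" N "?min \<Delta>"] by (simp add: rescaling_field_iff min_eq)
    then have "(?min \<Delta>, \<delta>) \<in> rescaling N ring_band"
      using \<Delta>2(2) equiv_transD[OF eqFN] equiv_symD[OF eqFN] by blast
    then show ?thesis using \<Delta> \<Delta>1(2) \<Delta>w by blast
  qed
  then have "\<forall>w\<in>Ws. \<exists>\<Delta>. \<Delta> \<in> w \<and> \<Delta> \<in> weak_reps M ring_band \<and> B.normal_on F \<Delta> \<and> (?min \<Delta>, \<delta>) \<in> rescaling N ring_band"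
    by blast
  from bchoice[OF this] obtain nfm where nfm: "\<And>w. w \<in> Ws \<Longrightarrow> nfm w \<in> w \<and> nfm w \<in> weak_reps M ring_band \<and>
      B.normal_on F (nfm w) \<and> (?min (nfm w), \<delta>) \<in> rescaling N ring_band"
    by blast
  have "inj_on nfm Ws"
  proof (rule inj_onI)
    fix v w assume vw: "v \<in> Ws" "w \<in> Ws" "nfm v = nfm w"
    have q: "v \<in> weak_reps M ring_band // rescaling M ring_band" "w \<in> weak_reps M ring_band // rescaling M ring_band"
      using vw by (auto simp: Ws_def rescaling_classes_def)
    have "v \<inter> w \<noteq> {}" using nfm[OF vw(1)] nfm[OF vw(2)] vw(3) by auto
    then show "v = w" using quotient_disj[OF eqF q] by blast
  qed
  then have infF: "infinite (nfm ` Ws)" using inf finite_imageD by blast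
  \<comment> \<open>Finitely many coordinates determine a representation, so one of them takes
    infinitely many values on the normal forms.\<close>
  have "\<exists>xs\<in>?T. infinite ((\<lambda>\<Delta>. \<Delta> xs) ` nfm ` Ws)"
  proof (rule ccontr)
    assume "\<not> ?thesis"
    then have f: "\<And>xs. xs \<in> ?T \<Longrightarrow> finite ((\<lambda>\<Delta>. \<Delta> xs) ` nfm ` Ws)" by blast
    have "nfm ` Ws \<subseteq> PiE ?T (\<lambda>xs. (\<lambda>\<Delta>. \<Delta> xs) ` nfm ` Ws)"
    proof
      fix E assume E: "E \<in> nfm ` Ws"
      then have "E \<in> weak_reps M ring_band" using nfm by auto
      then have "E \<in> extensional ?T" by (simp add: weak_reps_field_iff)
      then show "E \<in> PiE ?T (\<lambda>xs. (\<lambda>\<Delta>. \<Delta> xs) ` nfm ` Ws)" using E unfolding PiE_iff by blast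
    qed
    moreover have "finite (PiE ?T (\<lambda>xs. (\<lambda>\<Delta>. \<Delta> xs) ` nfm ` Ws))"
      using f finite_tuples[OF M.ground_finite] by (intro finite_PiE) auto
    ultimately show False using infF finite_subset by blast
  qed
  then obtain x0 where x0: "x0 \<in> ?T" "infinite ((\<lambda>\<Delta>. \<Delta> x0) ` nfm ` Ws)" by blast
  then obtain s :: "nat \<Rightarrow> 'l" where s: "inj s" "range s \<subseteq> (\<lambda>\<Delta>. \<Delta> x0) ` nfm ` Ws"
    using infinite_countable_subset by blast
  have "\<exists>w\<in>Ws. nfm w x0 = s j" for j
  proof -
    have "s j \<in> (\<lambda>\<Delta>. \<Delta> x0) ` nfm ` Ws" using s(2) by blast
    then show ?thesis by auto
  qed
  then obtain W where W: "\<And>j. W j \<in> Ws" "\<And>j. nfm (W j) x0 = s j" by metis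
  define \<Delta> where "\<Delta> j = nfm (W j)" for j
  have \<Delta>: "\<Delta> j \<in> weak_reps M ring_band" "B.normal_on F (\<Delta> j)" "(?min (\<Delta> j), \<delta>) \<in> rescaling N ring_band" for j
    using nfm[OF W(1)] by (auto simp: \<Delta>_def)
  let ?g = "\<lambda>xs j. \<Delta> j xs"
  have sg: "s = ?g x0" using W(2) by (auto simp: \<Delta>_def fun_eq_iff)
  have "\<exists>c t. c \<noteq> 0 \<and> (\<forall>e\<in>ground N. t e \<noteq> 0) \<and> (\<forall>ys\<in>?S. \<delta> ys = c * (\<Prod>i<rank N. t (ys ! i)) * \<Delta> j (ys @ cs))" for j
  proof -
    have "rescaled (- {0}) (ground N) (rank N) (?min (\<Delta> j)) \<delta>" using \<Delta>(3)[of j] by (simp add: rescaling_field_iff)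
    then obtain c t where "c \<noteq> 0" "t \<in> ground N \<rightarrow> - {0}" "\<forall>ys\<in>?S. \<delta> ys = c * (\<Prod>i<rank N. t (ys ! i)) * ?min (\<Delta> j) ys"
      unfolding rescaled_def by auto
    then show ?thesis unfolding min_eq by (intro exI[of _ c] exI[of _ t]) auto
  qed
  then obtain c t where ct: "\<And>j. c j \<noteq> 0" "\<And>j e. e \<in> ground N \<Longrightarrow> t j e \<noteq> 0"
    "\<And>j ys. ys \<in> ?S \<Longrightarrow> \<delta> ys = c j * (\<Prod>i<rank N. t j (ys ! i)) * \<Delta> j (ys @ cs)" by metis
  let ?t = "\<lambda>e j. t j e"
  \<comment> \<open>The scaling data \<open>c\<close> and \<open>t\<close> are adjoined along with
    the coordinates. The valuations are then defined on them and turn the rescaling to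
    \<open>\<delta>\<close> into a tropical rescaling.\<close>
  have "finite (insert c (?g ` ?T \<union> ?t ` ground N))"
    using finite_tuples[OF M.ground_finite] M.ground_finite gN by auto
  then obtain ss where ss: "set ss = insert c (?g ` ?T \<union> ?t ` ground N)" using finite_list by blast
  have "s \<in> set ss" using ss x0(1) sg by auto
  from generic_valuations[OF s(1) this]
  obtain P where P: "prime_kernel P" and av: "\<And>a. finite {j. a j = 0} \<Longrightarrow> a \<notin> P"
    and val: "\<And>r. 0 < r \<Longrightarrow> \<exists>w. val_on P (adjoin_list const_seqs ss) w \<and> w s = r \<and> (\<forall>c. w (\<lambda>_. c) = (if c = 0 then 0 else 1))"
    by metis
  interpret P: prime_kernel P by fact
  let ?R = "adjoin_list const_seqs ss"
  have R: "subring_set ?R" by (rule P.subring_adjoin_list[OF subring_const_seqs])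
  have gen: "set ss \<subseteq> ?R" "const_seqs \<subseteq> ?R"
    using P.adjoin_list_gen[OF subring_const_seqs] P.adjoin_list_base[OF subring_const_seqs] by auto
  have constR: "(\<lambda>_. k) \<in> ?R" for k using gen(2) by (auto simp: const_seqs_def)
  have gR: "?g xs \<in> ?R" if "xs \<in> ?T" for xs using gen(1) ss that by auto
  have av': "a \<notin> P" if "\<forall>j. a j \<noteq> 0" for a using av[of a] that by simp
  obtain w where w: "\<And>r. 0 < r \<Longrightarrow> val_on P ?R (w r)" "\<And>r. 0 < r \<Longrightarrow> w r s = r"
    "\<And>r c. 0 < r \<Longrightarrow> w r (\<lambda>_. c) = (if c = 0 then 0 else 1)" using val by metis
  have vs: "valued_subring P ?R (w r)" if "0 < r" for r
    by unfold_locales (use R w(1)[OF that] in auto)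
  define Dr where "Dr r = (\<lambda>xs\<in>?T. w r (?g xs))" for r
  \<comment> \<open>The trivial valuation of \<open>\<delta>\<close>. It does not depend on
    \<open>r\<close>, so all the tropical classes lie over one class of \<open>N\<close>.\<close>
  define \<delta>' where "\<delta>' = (\<lambda>ys\<in>?S. if \<delta> ys = 0 then 0 else 1 :: real)"
  have DrW: "Dr r \<in> weak_reps M tropical" if "0 < r" for r
    unfolding Dr_def by (rule tropicalize_weak_reps[OF vs[OF that] \<Delta>(1) gR av'])
  have \<delta>'W: "\<delta>' \<in> weak_reps N tropical"
  proof -
    have "(\<lambda>xs\<in>?S. w 1 (\<lambda>j. \<delta> xs)) \<in> weak_reps N tropical"
      by (rule tropicalize_weak_reps[OF vs \<delta>(1) constR av']) simp_all
    then show ?thesis by (simp add: \<delta>'_def w(3))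
  qed
  have minDr: "(?min (Dr r), \<delta>') \<in> rescaling N tropical" if r: "0 < r" for r
  proof -
    interpret V: valued_subring P ?R "w r" by (rule vs[OF r])
    have mW: "?min (\<Delta> j) \<in> weak_reps N ring_band" for j using \<Delta>(3)[of j] by (simp add: rescaling_field_iff)
    have "(\<lambda>ys\<in>?S. w r (\<lambda>j. ?min (\<Delta> j) ys)) \<in> weak_reps N tropical"
      by (rule tropicalize_weak_reps[OF vs[OF r] mW _ av']) (simp_all add: min_eq gR app)
    moreover have "(\<lambda>ys\<in>?S. w r (\<lambda>j. ?min (\<Delta> j) ys)) = ?min (Dr r)"
      by (rule ext) (simp add: min_eq Dr_def app)
    ultimately have 1: "?min (Dr r) \<in> weak_reps N tropical" by simp
    have cR: "c \<in> ?R" using gen(1) ss by auto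
    have tR: "?t e \<in> ?R" if "e \<in> ground N" for e using gen(1) ss that by auto
    have pos: "0 < w r a" if "a \<in> ?R" "\<forall>j. a j \<noteq> 0" for a
      using V.val_nonneg[OF that(1)] V.val_eq_0[OF that(1)] av'[OF that(2)] by simp
    have "\<delta>' ys = w r c * (\<Prod>i<rank N. w r (?t (ys ! i))) * ?min (Dr r) ys" if ys: "ys \<in> ?S" for ys
    proof -
      have ti: "?t (ys ! i) \<in> ?R" if "i < rank N" for i using tR tuples_nth[OF ys that] by blast
      have p: "(\<Prod>i<rank N. ?t (ys ! i)) \<in> ?R" "w r (\<Prod>i<rank N. ?t (ys ! i)) = (\<Prod>i<rank N. w r (?t (ys ! i)))"
        using V.val_prod[of "{..<rank N}" "\<lambda>i. ?t (ys ! i)"] ti by auto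
      have "(\<lambda>_. \<delta> ys) = c * (\<Prod>i<rank N. ?t (ys ! i)) * ?g (ys @ cs)"
        using ct(3)[OF ys] by (simp add: fun_eq_iff prod_fun_apply)
      then have "w r (\<lambda>_. \<delta> ys) = w r c * w r (\<Prod>i<rank N. ?t (ys ! i)) * w r (?g (ys @ cs))"
        using V.val_mult[OF V.U(4)[OF cR p(1)] gR[OF app[OF ys]]] V.val_mult[OF cR p(1)] by simp
      then show ?thesis using ys p(2) w(3)[OF r] app[OF ys] by (simp add: \<delta>'_def min_eq Dr_def)
    qed
    moreover have "0 < w r c" using pos[OF cR] ct(1) by blast
    moreover have "(\<lambda>e. w r (?t e)) \<in> ground N \<rightarrow> {0<..}" using pos[OF tR] ct(2) by auto
    ultimately have "rescaled {0<..} (ground N) (rank N) (?min (Dr r)) \<delta>'"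
      unfolding rescaled_def by (intro bexI[of _ "w r c"] bexI[of _ "\<lambda>e. w r (?t e)"] ballI) auto
    then show ?thesis using 1 \<delta>'W by (simp add: rescaling_tropical_iff)
  qed
  define cl where "cl r = rescaling M tropical `` {Dr r}" for r
  have img: "minor_map M cs D tropical (cl r) = rescaling N tropical `` {\<delta>'}" if r: "0 < r" for r
  proof
    show "minor_map M cs D tropical (cl r) \<subseteq> rescaling N tropical `` {\<delta>'}"
    proof
      fix y assume "y \<in> minor_map M cs D tropical (cl r)"
      then obtain E where E: "(Dr r, E) \<in> rescaling M tropical" "(?min E, y) \<in> rescaling N tropical"
        by (auto simp: NmapT cl_def)
      have "rescaled {0<..} (ground N) (rank N) (?min (Dr r)) (?min E)"
        using E(1) by (intro rescaled_minor[OF _ _ scs lcs gN rN]) (auto simp: rescaling_tropical_iff)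
      then have "(?min (Dr r), ?min E) \<in> rescaling N tropical"
        using minDr[OF r] E(2) by (simp add: rescaling_tropical_iff)
      then have "(\<delta>', y) \<in> rescaling N tropical"
        using minDr[OF r] E(2) equiv_transD[OF eqTN] equiv_symD[OF eqTN] by blast
      then show "y \<in> rescaling N tropical `` {\<delta>'}" by simp
    qed
    show "rescaling N tropical `` {\<delta>'} \<subseteq> minor_map M cs D tropical (cl r)"
    proof
      fix y assume "y \<in> rescaling N tropical `` {\<delta>'}"
      then have "(?min (Dr r), y) \<in> rescaling N tropical"
        using minDr[OF r] equiv_transD[OF eqTN] by blast
      moreover have "Dr r \<in> cl r" unfolding cl_def using equiv_class_self[OF eqT DrW[OF r]] .
      ultimately show "y \<in> minor_map M cs D tropical (cl r)" unfolding NmapT by blast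
    qed
  qed
  \<comment> \<open>Coordinates that are constantly 1 keep the value 1, so each \<open>Dr r\<close>
    is in normal form. Uniqueness then allows comparing the coordinate \<open>x0\<close>, where the
    value is \<open>r\<close>.\<close>
  have "inj_on cl {0<..}"
  proof (rule inj_onI)
    fix r r' :: real assume r: "r \<in> {0<..}" "r' \<in> {0<..}" and e: "cl r = cl r'"
    have "(Dr r, Dr r') \<in> rescaling M tropical"
      using e eq_equiv_class[OF _ eqT] DrW r unfolding cl_def by auto
    moreover have "B.normal_on F (Dr q)" if q: "0 < q" for q
    proof -
      have "Dr q xs = 1" if "xs \<in> ?T" "\<And>j. \<Delta> j xs = 1" for xs
        using that w(3)[OF q, of 1] by (simp add: Dr_def)
      moreover have "exch b0 p \<in> ?T" if "p \<in> F" for p using that F(1) B.exch_tuple by (cases p) auto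
      ultimately show ?thesis using \<Delta>(2) B.b0_tuple unfolding B.normal_on_def by blast
    qed
    ultimately have "Dr r = Dr r'" using B.normal_form_unique[OF F] r by auto
    then have "w r (?g x0) = w r' (?g x0)" using x0(1) by (simp add: Dr_def fun_eq_iff) metis
    then show "r = r'" using w(2) r sg by simp
  qed
  moreover have "infinite {0::real<..}" by (simp add: infinite_Ioi)
  ultimately have "infinite (cl ` {0<..})" using finite_imageD by blast
  moreover have "cl ` {0<..} \<subseteq> {w \<in> rescaling_classes M tropical. minor_map M cs D tropical w = rescaling N tropical `` {\<delta>'}}"
    using DrW img by (auto simp: rescaling_classes_def cl_def quotient_def)
  moreover have "rescaling N tropical `` {\<delta>'} \<in> rescaling_classes N tropical"
    using \<delta>'W by (auto simp: rescaling_classes_def quotient_def)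
  ultimately show False using fin finite_subset unfolding finite_fibers_on_def by blast
qed

theorem theorem2p3:
  shows
    "(\<forall>(v :: 'k::alg_closed_field \<Rightarrow> real) (B1 :: 'a band) (B2 :: 'b band) f x S.
        nontrivial_valuation v \<and>
        band B1 \<and> finitely_generated B1 \<and> band B2 \<and> finitely_generated B2 \<and>
        f \<in> band_hom B1 B2 \<and> x \<in> band_hom B1 ring_band \<and>
        finite S \<and> generates B2 S \<longrightarrow>
        field_fiber_dim B1 B2 f x
          \<le> tropical_dim S (hom_fiber B1 B2 tropical f (compose (carrier B1) v x)))
     \<and>
     (\<forall>(M :: 'e matroid) N C D cs.
        matroid M \<and> C \<subseteq> ground M \<and> D \<subseteq> ground M \<and> C \<inter> D = {} \<and>
        indep M C \<and> coindep M D \<and> N = delete (contract M C) D \<and>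
        distinct cs \<and> set cs = C \<and>
        finite_fibers_on (rescaling_classes M tropical) (rescaling_classes N tropical)
          (minor_map M cs D tropical) \<longrightarrow>
        finite_fibers_on (rescaling_classes M (ring_band :: 'l::field band))
          (rescaling_classes N ring_band) (minor_map M cs D ring_band))"
proof (intro conjI allI impI)
  fix v :: "'k \<Rightarrow> real" and B1 :: "'a band" and B2 :: "'b band" and f and x :: "'a \<Rightarrow> 'k" and S
  assume H: "nontrivial_valuation v \<and> band B1 \<and> finitely_generated B1 \<and> band B2 \<and> finitely_generated B2 \<and>
    f \<in> band_hom B1 B2 \<and> x \<in> band_hom B1 ring_band \<and> finite S \<and> generates B2 S"
  then interpret band_fiber B1 B2 f x by (auto intro: band_fiber.intro band_fiber_axioms.intro)
  show "field_fiber_dim B1 B2 f x \<le> tropical_dim S (hom_fiber B1 B2 tropical f (compose (carrier B1) v x))"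
    using H by (intro field_fiber_dim_le_tropical) (auto simp: nontrivial_valuation_def)
next
  fix M N :: "'e matroid" and C D cs
  assume "matroid M \<and> C \<subseteq> ground M \<and> D \<subseteq> ground M \<and> C \<inter> D = {} \<and>
    indep M C \<and> coindep M D \<and> N = delete (contract M C) D \<and> distinct cs \<and> set cs = C \<and>
    finite_fibers_on (rescaling_classes M tropical) (rescaling_classes N tropical) (minor_map M cs D tropical)"
  then show "finite_fibers_on (rescaling_classes M (ring_band :: 'l band)) (rescaling_classes N ring_band)
      (minor_map M cs D ring_band)"
    by (elim conjE) (rule finite_fibers_field)
qed

end
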